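(* Let $n \ge 2$ and let $\Omega_p \subset \mathbb{C}^n$ be a domain of the class $\Omega^{(n)}$. For any continuous functions $\phi$ and $\psi$ on $\overline{\Omega}_p$, the commutator $\tilde T_{\nu_p,\phi}\tilde T_{\nu_p,\psi}-\tilde T_{\nu_p,\psi}\tilde T_{\nu_p,\phi}$ of Bergman-Toeplitz operators is compact on $A^2(\nu_p)$; in particular, the multiplication tuple $M_{\nu_p,z}$ on $A^2(\nu_p)$ is essentially normal.
   Context: Class $\Omega^{(n)}$ ($n\ge 2$): let $p=(p_1,\ldots,p_n)$, where for each $1\le i\le n$, $p_i=(p_{i,1},\ldots,p_{i,m_i})$ is an $m_i$-tuple of positive integers with $m_i\ge 2$ and $\gcd\{p_{i,1},\ldots,p_{i,m_i}\}=1$. Put $\Omega_p=\{z\in\mathbb{C}^n:\sum_{i=1}^n\sum_{j=1}^{m_i}|z_i|^{2p_{i,j}}<1\}$, with closure $\overline{\Omega}_p$ (defined by $\le 1$). $\Omega^{(n)}$ is the class of all such $\Omega_p$. $A(\Omega_p)=\{f\in C(\overline{\Omega}_p): f \text{ is holomorphic on } \Omega_p\}$. $\nu_p$ is the normalized volume measure on $\overline{\Omega}_p$. The Bergman space $A^2(\nu_p)$ is the closure of $A(\Omega_p)$ in $L^2(\nu_p)$; $\tilde P_{\nu_p}$ is the orthogonal projection of $L^2(\nu_p)$ onto $A^2(\nu_p)$. For $\phi\in L^\infty(\nu_p)$, $\tilde N_{\nu_p,\phi}$ is multiplication by $\phi$ on $L^2(\nu_p)$, and the Bergman-Toeplitz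 operator is $\tilde T_{\nu_p,\phi}=\tilde P_{\nu_p}\tilde N_{\nu_p,\phi}|_{A^2(\nu_p)}$. $M_{\nu_p,z}=(M_{\nu_p,z_1},\ldots,M_{\nu_p,z_n})$ is the tuple of multiplications by the coordinate functions $z_i$ on $A^2(\nu_p)$. An $n$-tuple $T=(T_1,\ldots,T_n)$ of commuting bounded operators on a Hilbert space is essentially normal if $T_i^*T_j-T_jT_i^*$ is compact for all $i,j$. *)

theory Defs
  imports "HOL-Analysis.Analysis"
begin

section \<open>Square-integrable functions and operators\<close>

text \<open>
  Elements of \<open>L\<^sup>2(M)\<close> are represented by square-integrable functions; the Hilbert space is the
  quotient of \<open>L2 M\<close> by almost-everywhere equality. Hence an operator on (a subspace of) \<open>L\<^sup>2(M)\<close>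
  is a map on representatives, equations between elements are read as \<open>AE x in M\<close>, and convergence
  is convergence in \<open>l2_norm M\<close>.
\<close>

definition L2 :: "'a measure \<Rightarrow> ('a \<Rightarrow> complex) set" where
  "L2 M = {f \<in> borel_measurable M. integrable M (\<lambda>x. (cmod (f x))\<^sup>2)}"

definition l2_inner :: "'a measure \<Rightarrow> ('a \<Rightarrow> complex) \<Rightarrow> ('a \<Rightarrow> complex) \<Rightarrow> complex" where
  "l2_inner M f g = (LINT x|M. f x * cnj (g x))"

definition l2_norm :: "'a measure \<Rightarrow> ('a \<Rightarrow> complex) \<Rightarrow> real" where
  "l2_norm M f = sqrt (LINT x|M. (cmod (f x))\<^sup>2)"

definition l2_closure :: "'a measure \<Rightarrow> ('a \<Rightarrow> complex) set \<Rightarrow> ('a \<Rightarrow> complex) set" where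
  "l2_closure M A = {f \<in> L2 M. \<forall>e>0. \<exists>g\<in>A. l2_norm M (\<lambda>x. f x - g x) < e}"

text \<open>
  The defining properties of the orthogonal projection and of the adjoint determine their values
  up to almost-everywhere equality when \<open>H\<close> is a closed subspace of \<open>L\<^sup>2(M)\<close> (and, for the adjoint,
  the operator is bounded on \<open>H\<close>); the choice operator only picks a representative.
\<close>

definition l2_proj ::
  "'a measure \<Rightarrow> ('a \<Rightarrow> complex) set \<Rightarrow> ('a \<Rightarrow> complex) \<Rightarrow> ('a \<Rightarrow> complex)" where
  "l2_proj M H f = (SOME g. g \<in> H \<and> (\<forall>h\<in>H. l2_inner M (\<lambda>x. f x - g x) h = 0))"

definition l2_adjoint ::
  "'a measure \<Rightarrow> ('a \<Rightarrow> complex) set \<Rightarrow> (('a \<Rightarrow> complex) \<Rightarrow> ('a \<Rightarrow> complex))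
    \<Rightarrow> ('a \<Rightarrow> complex) \<Rightarrow> ('a \<Rightarrow> complex)" where
  "l2_adjoint M H T g = (SOME h. h \<in> H \<and> (\<forall>f\<in>H. l2_inner M (T f) g = l2_inner M f h))"

text \<open>
  Linearity and boundedness together force \<open>T\<close> to respect almost-everywhere equality on \<open>H\<close>.
\<close>

definition l2_bounded_operator ::
  "'a measure \<Rightarrow> ('a \<Rightarrow> complex) set \<Rightarrow> (('a \<Rightarrow> complex) \<Rightarrow> ('a \<Rightarrow> complex)) \<Rightarrow> bool" where
  "l2_bounded_operator M H T \<longleftrightarrow>
     (\<forall>f\<in>H. T f \<in> H) \<and>
     (\<forall>f\<in>H. \<forall>g\<in>H. \<forall>a b. AE x in M. T (\<lambda>y. a * f y + b * g y) x = a * T f x + b * T g x) \<and>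
     (\<exists>C. \<forall>f\<in>H. l2_norm M (T f) \<le> C * l2_norm M f)"

definition l2_compact_operator ::
  "'a measure \<Rightarrow> ('a \<Rightarrow> complex) set \<Rightarrow> (('a \<Rightarrow> complex) \<Rightarrow> ('a \<Rightarrow> complex)) \<Rightarrow> bool" where
  "l2_compact_operator M H T \<longleftrightarrow>
     l2_bounded_operator M H T \<and>
     (\<forall>F :: nat \<Rightarrow> 'a \<Rightarrow> complex.
        range F \<subseteq> H \<and> bounded (range (\<lambda>k. l2_norm M (F k))) \<longrightarrow>
        (\<exists>g\<in>H. \<exists>r. strict_mono r \<and>
           (\<lambda>k. l2_norm M (\<lambda>x. T (F (r k)) x - g x)) \<longlonglongrightarrow> 0))"

definition op_commutator ::
  "(('a \<Rightarrow> complex) \<Rightarrow> ('a \<Rightarrow> complex)) \<Rightarrow> (('a \<Rightarrow> complex) \<Rightarrow> ('a \<Rightarrow> complex))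
    \<Rightarrow> ('a \<Rightarrow> complex) \<Rightarrow> ('a \<Rightarrow> complex)" where
  "op_commutator S T f = (\<lambda>x. S (T f) x - T (S f) x)"

definition essentially_normal ::
  "'a measure \<Rightarrow> ('a \<Rightarrow> complex) set \<Rightarrow> ('i \<Rightarrow> ('a \<Rightarrow> complex) \<Rightarrow> ('a \<Rightarrow> complex)) \<Rightarrow> bool" where
  "essentially_normal M H T \<longleftrightarrow>
     (\<forall>i. l2_bounded_operator M H (T i)) \<and>
     (\<forall>i j. \<forall>f\<in>H. AE x in M. T i (T j f) x = T j (T i f) x) \<and>
     (\<forall>i j. l2_compact_operator M H (op_commutator (l2_adjoint M H (T i)) (T j)))"


section \<open>The domains and their Bergman spaces\<close>

text \<open>The tuple \<open>p\<^sub>i\<close> is the list \<open>p i\<close>, of length \<open>m\<^sub>i\<close>.\<close>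

definition admissible :: "('n \<Rightarrow> nat list) \<Rightarrow> bool" where
  "admissible p \<longleftrightarrow>
     (\<forall>i. length (p i) \<ge> 2 \<and> (\<forall>k\<in>set (p i). k > 0) \<and> Gcd (set (p i)) = 1)"

definition Omega :: "('n::finite \<Rightarrow> nat list) \<Rightarrow> (complex ^ 'n) set" where
  "Omega p = {z. (\<Sum>i\<in>UNIV. \<Sum>j<length (p i). cmod (z $ i) ^ (2 * (p i ! j))) < 1}"

lemma closure_Omega:
  assumes "admissible p"
  shows "closure (Omega p) = {z. (\<Sum>i\<in>UNIV. \<Sum>j<length (p i). cmod (z $ i) ^ (2 * (p i ! j))) \<le> 1}"
    (is "_ = {z. ?s z \<le> 1}")
proof
  have "closed {z. ?s z \<le> 1}"
    by (intro closed_Collect_le continuous_intros)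
  then show "closure (Omega p) \<subseteq> {z. ?s z \<le> 1}"
    by (intro closure_minimal) (auto simp: Omega_def)
next
  have scale: "?s (t *\<^sub>R z) \<le> t * ?s z" if t: "0 \<le> t" "t \<le> 1" for t :: real and z
  proof -
    have "cmod ((t *\<^sub>R z) $ i) ^ (2 * (p i ! j)) \<le> t * cmod (z $ i) ^ (2 * (p i ! j))"
      if "j < length (p i)" for i j
    proof -
      have "p i ! j > 0"
        using assms nth_mem[OF that] unfolding admissible_def by blast
      then have "t ^ (2 * (p i ! j)) \<le> t ^ 1"
        by (intro power_decreasing t) auto
      then show ?thesis
        using t by (simp add: power_mult_distrib mult_right_mono)
    qed
    then show ?thesis
      unfolding sum_distrib_left by (intro sum_mono) auto
  qed
  show "{z. ?s z \<le> 1} \<subseteq> closure (Omega p)"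
  proof
    fix z assume "z \<in> {z. ?s z \<le> 1}"
    then have z: "?s z \<le> 1" by simp
    define t where "t n = 1 - inverse (real (Suc n))" for n
    have t: "0 \<le> t n" "t n < 1" for n
      by (auto simp: t_def field_simps)
    have "t n *\<^sub>R z \<in> Omega p" for n
    proof -
      have "?s (t n *\<^sub>R z) \<le> t n * ?s z"
        by (rule scale) (use t[of n] in auto)
      also have "\<dots> \<le> t n"
        using mult_left_mono[OF z, of "t n"] t[of n] by simp
      finally show ?thesis
        using t[of n] unfolding Omega_def by simp
    qed
    moreover have "(\<lambda>n. t n *\<^sub>R z) \<longlonglongrightarrow> (1 - 0) *\<^sub>R z"
      unfolding t_def by (intro tendsto_intros LIMSEQ_inverse_real_of_nat)
    ultimately show "z \<in> closure (Omega p)"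
      unfolding closure_sequential by (intro exI[of _ "\<lambda>n. t n *\<^sub>R z"]) auto
  qed
qed

text \<open>Holomorphy in several variables: complex (Frechet) differentiability at every point.\<close>

definition holomorphic_vec_on :: "(complex ^ 'n::finite \<Rightarrow> complex) \<Rightarrow> (complex ^ 'n) set \<Rightarrow> bool" where
  "holomorphic_vec_on f S \<longleftrightarrow>
     (\<forall>z\<in>S. \<exists>f'. (f has_derivative f') (at z) \<and> (\<forall>c v. f' (c *s v) = c * f' v))"

definition A_space :: "('n::finite \<Rightarrow> nat list) \<Rightarrow> (complex ^ 'n \<Rightarrow> complex) set" where
  "A_space p = {f. continuous_on (closure (Omega p)) f \<and> holomorphic_vec_on f (Omega p)}"

text \<open>The measure \<open>nu p\<close> lives on \<open>closure (Omega p)\<close>: values of functions elsewhere are irrelevant.\<close>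

definition nu :: "('n::finite \<Rightarrow> nat list) \<Rightarrow> (complex ^ 'n) measure" where
  "nu p = uniform_measure (restrict_space lborel (closure (Omega p))) (closure (Omega p))"

definition bergman :: "('n::finite \<Rightarrow> nat list) \<Rightarrow> (complex ^ 'n \<Rightarrow> complex) set" where
  "bergman p = l2_closure (nu p) (A_space p)"

definition toeplitz ::
  "('n::finite \<Rightarrow> nat list) \<Rightarrow> (complex ^ 'n \<Rightarrow> complex)
    \<Rightarrow> (complex ^ 'n \<Rightarrow> complex) \<Rightarrow> (complex ^ 'n \<Rightarrow> complex)" where
  "toeplitz p \<phi> f = l2_proj (nu p) (bergman p) (\<lambda>z. \<phi> z * f z)"

definition coord_mult :: "'n::finite \<Rightarrow> (complex ^ 'n \<Rightarrow> complex) \<Rightarrow> (complex ^ 'n \<Rightarrow> complex)" where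
  "coord_mult i f = (\<lambda>z. z $ i * f z)"

end

theory Submission
  imports Defs "HOL-Complex_Analysis.Cauchy_Integral_Formula" "HOL-Library.Diagonal_Subsequence"
begin

text \<open>
  Write \<open>Q = I - P\<close>. Since \<open>[T\<^sub>\<phi>, T\<^sub>\<psi>] = P \<psi> Q \<phi> - P \<phi> Q \<psi>\<close> on the Bergman space and the adjoint of
  multiplication by \<open>z\<^sub>i\<close> is the Toeplitz operator of its conjugate, everything follows once the Hankel operators
  \<open>f \<mapsto> Q (\<phi> f)\<close> are compact. The continuous symbols with this property form a uniformly closed algebra that
  contains the coordinates, so by Stone-Weierstrass it suffices to treat the conjugate coordinate of \<open>z\<^sub>j\<close>.
  By torus invariance its Hankel operator maps the monomials to orthogonal vectors, and it remains to see that
  the ratio of norms tends to \<open>0\<close>. Its square is the variance of \<open>|z\<^sub>j|\<^sup>2\<close> divided by its mean, under the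
  probability measure proportional to \<open>|z\<^sup>\<alpha>|\<^sup>2 d\<nu>\<close> for the exponent \<open>\<alpha>\<close> lowered by one in the \<open>j\<close>-th place.
  By strict logarithmic convexity of the domain these measures concentrate, uniformly in \<open>\<alpha>\<close>, on the torus
  where \<open>|z\<^sup>\<alpha>|\<close> is maximal as \<open>|\<alpha>| \<rightarrow> \<infinity>\<close>.
\<close>

section \<open>Square-integrable functions\<close>

text \<open>The variance has to be small relative to the mean of \<open>|z\<^sub>j|\<^sup>2\<close>,
  and that mean may itself tend to 0 along a sequence of exponents, so concentration in absolute
  terms is not enough. Let M be the maximum of the squared modulus of the monomial. Away from the
  peak torus this squared modulus is at most \<open>s ^ (4 * mdeg \<alpha>)\<close> times M for some
  s < 1, while the total mass is at least a constant times \<open>t ^ (2 * mdeg \<alpha>)\<close>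
  times M for any t < 1 fixed beforehand. Taking t = s separates the two rates. Uniformity in
  \<alpha> comes from measuring the mass on a translate of one fixed ball, whatever the peak is.

  Estimates on monomials determine the Hankel operator only if polynomials are dense. A function in
  the algebra is merely continuous at the boundary, so it is expanded one coordinate at a time:
  multiplying one coordinate by a number of the closed unit disc keeps the closed domain inside
  itself, and one-variable Taylor theory applies to each such slice, including those through
  boundary points.\<close>

lemma L2_measurable: "f \<in> L2 M \<Longrightarrow> f \<in> borel_measurable M"
  by (simp add: L2_def)

lemma L2_integrable_sq: "f \<in> L2 M \<Longrightarrow> integrable M (\<lambda>x. (cmod (f x))\<^sup>2)"
  by (simp add: L2_def)

lemma borel_measurable_cnj [measurable]:
  "f \<in> borel_measurable M \<Longrightarrow> (\<lambda>x. cnj (f x)) \<in> borel_measurable M"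
  by (rule borel_measurable_continuous_on[OF continuous_on_cnj[OF continuous_on_id]])

lemma L2_zero [simp]: "(\<lambda>x. 0) \<in> L2 M"
  by (simp add: L2_def)

lemma L2_lin:
  assumes "f \<in> L2 M" "g \<in> L2 M"
  shows "(\<lambda>x. a * f x + b * g x) \<in> L2 M"
proof -
  note [measurable] = L2_measurable[OF assms(1)] L2_measurable[OF assms(2)]
  have le: "(cmod (a * f x + b * g x))\<^sup>2 \<le> 2 * (cmod a)\<^sup>2 * (cmod (f x))\<^sup>2 + 2 * (cmod b)\<^sup>2 * (cmod (g x))\<^sup>2" for x
  proof -
    have "(cmod (a * f x + b * g x))\<^sup>2 \<le> (cmod (a * f x) + cmod (b * g x))\<^sup>2"
      by (intro power_mono norm_triangle_ineq) auto
    also have "\<dots> \<le> 2 * (cmod (a * f x))\<^sup>2 + 2 * (cmod (b * g x))\<^sup>2"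
      using sum_squares_bound[of "cmod (a * f x)" "cmod (b * g x)"] by (simp add: power2_sum)
    finally show ?thesis by (simp add: norm_mult power_mult_distrib mult.assoc)
  qed
  have "integrable M (\<lambda>x. (cmod (a * f x + b * g x))\<^sup>2)"
  proof (rule Bochner_Integration.integrable_bound)
    show "integrable M (\<lambda>x. 2 * (cmod a)\<^sup>2 * (cmod (f x))\<^sup>2 + 2 * (cmod b)\<^sup>2 * (cmod (g x))\<^sup>2)"
      using assms by (intro Bochner_Integration.integrable_add integrable_mult_right L2_integrable_sq)
  qed (use le in auto)
  then show ?thesis by (simp add: L2_def)
qed

lemma L2_add: "f \<in> L2 M \<Longrightarrow> g \<in> L2 M \<Longrightarrow> (\<lambda>x. f x + g x) \<in> L2 M"
  using L2_lin[of f M g 1 1] by simp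

lemma L2_diff: "f \<in> L2 M \<Longrightarrow> g \<in> L2 M \<Longrightarrow> (\<lambda>x. f x - g x) \<in> L2 M"
  using L2_lin[of f M g 1 "-1"] by simp

lemma L2_cmult: "f \<in> L2 M \<Longrightarrow> (\<lambda>x. a * f x) \<in> L2 M"
  using L2_lin[of f M f a 0] by simp

lemma L2_sum: "(\<And>i. i \<in> A \<Longrightarrow> f i \<in> L2 M) \<Longrightarrow> (\<lambda>x. \<Sum>i\<in>A. f i x) \<in> L2 M"
  by (induction A rule: infinite_finite_induct) (auto intro: L2_add)

lemma L2_integrable_inner:
  assumes "f \<in> L2 M" "g \<in> L2 M"
  shows "integrable M (\<lambda>x. f x * cnj (g x))"
proof -
  note [measurable] = L2_measurable[OF assms(1)] L2_measurable[OF assms(2)]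
  show ?thesis
  proof (rule Bochner_Integration.integrable_bound)
    show "integrable M (\<lambda>x. (cmod (f x))\<^sup>2 + (cmod (g x))\<^sup>2)"
      using assms by (intro Bochner_Integration.integrable_add L2_integrable_sq)
    have "cmod (f x) * cmod (g x) \<le> (cmod (f x))\<^sup>2 + (cmod (g x))\<^sup>2" for x
      using sum_squares_bound[of "cmod (f x)" "cmod (g x)"]
        mult_nonneg_nonneg[OF norm_ge_zero[of "f x"] norm_ge_zero[of "g x"]] by linarith
    then show "AE x in M. cmod (f x * cnj (g x)) \<le> norm ((cmod (f x))\<^sup>2 + (cmod (g x))\<^sup>2)"
      by (simp add: norm_mult)
  qed measurable
qed

lemma l2_inner_lin_left:
  assumes "f \<in> L2 M" "g \<in> L2 M" "h \<in> L2 M"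
  shows "l2_inner M (\<lambda>x. a * f x + b * g x) h = a * l2_inner M f h + b * l2_inner M g h"
proof -
  have "(\<lambda>x. (a * f x + b * g x) * cnj (h x)) = (\<lambda>x. a * (f x * cnj (h x)) + b * (g x * cnj (h x)))"
    by (simp add: algebra_simps)
  then show ?thesis
    unfolding l2_inner_def
    by (simp add: L2_integrable_inner assms)
qed

lemma l2_inner_cnj: "cnj (l2_inner M f g) = l2_inner M g f"
proof -
  have "cnj (l2_inner M f g) = (LINT x|M. cnj (f x * cnj (g x)))"
    unfolding l2_inner_def by (rule Bochner_Integration.integral_cnj[symmetric])
  then show ?thesis by (simp add: l2_inner_def mult.commute)
qed

lemma l2_inner_lin_right:
  assumes "f \<in> L2 M" "g \<in> L2 M" "h \<in> L2 M"
  shows "l2_inner M h (\<lambda>x. a * f x + b * g x) = cnj a * l2_inner M h f + cnj b * l2_inner M h g"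
  using arg_cong[OF l2_inner_lin_left[OF assms, of a b], of cnj] by (simp add: l2_inner_cnj)

lemma l2_inner_diff_left:
  "f \<in> L2 M \<Longrightarrow> g \<in> L2 M \<Longrightarrow> h \<in> L2 M \<Longrightarrow>
    l2_inner M (\<lambda>x. f x - g x) h = l2_inner M f h - l2_inner M g h"
  using l2_inner_lin_left[of f M g h 1 "-1"] by simp

lemma l2_inner_diff_right:
  "f \<in> L2 M \<Longrightarrow> g \<in> L2 M \<Longrightarrow> h \<in> L2 M \<Longrightarrow>
    l2_inner M h (\<lambda>x. f x - g x) = l2_inner M h f - l2_inner M h g"
  using l2_inner_lin_right[of f M g h 1 "-1"] by simp

lemma l2_inner_cmult_left: "l2_inner M (\<lambda>x. a * f x) h = a * l2_inner M f h"
  by (simp add: l2_inner_def mult.assoc)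

lemma l2_inner_cmult_right: "l2_inner M h (\<lambda>x. a * f x) = cnj a * l2_inner M h f"
  using arg_cong[OF l2_inner_cmult_left[of M a f h], of cnj] by (simp add: l2_inner_cnj)

lemma l2_inner_sum_left:
  assumes "\<And>i. i \<in> A \<Longrightarrow> f i \<in> L2 M" "h \<in> L2 M"
  shows "l2_inner M (\<lambda>x. \<Sum>i\<in>A. f i x) h = (\<Sum>i\<in>A. l2_inner M (f i) h)"
  unfolding l2_inner_def using assms
  by (simp add: sum_distrib_right L2_integrable_inner)

lemma l2_norm_nonneg [simp]: "0 \<le> l2_norm M f"
  by (simp add: l2_norm_def)

lemma l2_norm_sq: "(l2_norm M f)\<^sup>2 = (LINT x|M. (cmod (f x))\<^sup>2)"
  by (simp add: l2_norm_def)

lemma l2_inner_self: "l2_inner M f f = of_real ((l2_norm M f)\<^sup>2)"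
  unfolding l2_norm_sq l2_inner_def
  by (simp add: complex_norm_square[symmetric] flip: integral_complex_of_real)

text \<open>Keeping the scalar free lets one expansion serve Cauchy-Schwarz (optimal
  \<open>c\<close>), the triangle inequality and Pythagoras (\<open>c = 1\<close>), the
  parallelogram law (\<open>c = 1\<close> together with \<open>c = -1\<close>) and the variation
  behind the orthogonality of the projection error.\<close>

lemma l2_norm_sq_lin:
  assumes "f \<in> L2 M" "g \<in> L2 M"
  shows "(l2_norm M (\<lambda>x. f x - c * g x))\<^sup>2
    = (l2_norm M f)\<^sup>2 - 2 * Re (cnj c * l2_inner M f g) + (cmod c)\<^sup>2 * (l2_norm M g)\<^sup>2"
proof -
  let ?h = "\<lambda>x. f x - c * g x"
  have cg: "(\<lambda>x. c * g x) \<in> L2 M" and h: "?h \<in> L2 M"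
    using assms by (auto intro: L2_cmult L2_diff)
  have "of_real ((l2_norm M ?h)\<^sup>2) = l2_inner M ?h ?h"
    by (simp add: l2_inner_self)
  also have "\<dots> = l2_inner M f f - cnj c * l2_inner M f g - (c * cnj (l2_inner M f g) - c * cnj c * l2_inner M g g)"
    by (simp add: l2_inner_diff_left l2_inner_diff_right assms cg h l2_inner_cmult_left
        l2_inner_cmult_right l2_inner_cnj algebra_simps)
  also have "\<dots> = of_real ((l2_norm M f)\<^sup>2 - 2 * Re (cnj c * l2_inner M f g) + (cmod c)\<^sup>2 * (l2_norm M g)\<^sup>2)"
    unfolding l2_inner_self complex_norm_square[symmetric]
    by (simp add: complex_eq_iff algebra_simps)
  finally show ?thesis
    using of_real_eq_iff by blast
qed

lemma l2_norm_zero [simp]: "l2_norm M (\<lambda>x. 0) = 0"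
  by (simp add: l2_norm_def)

lemma l2_norm_eq_0_iff:
  assumes "f \<in> L2 M"
  shows "l2_norm M f = 0 \<longleftrightarrow> (AE x in M. f x = 0)"
  using integral_nonneg_eq_0_iff_AE[OF L2_integrable_sq[OF assms]]
  by (simp add: l2_norm_def)

lemma l2_norm_cong_AE:
  assumes "f \<in> borel_measurable M" "g \<in> borel_measurable M" "AE x in M. f x = g x"
  shows "l2_norm M f = l2_norm M g"
proof -
  have "(LINT x|M. (cmod (f x))\<^sup>2) = (LINT x|M. (cmod (g x))\<^sup>2)"
    using assms by (intro integral_cong_AE) auto
  then show ?thesis by (simp add: l2_norm_def)
qed

lemma l2_inner_cong_AE:
  assumes "f \<in> borel_measurable M" "g \<in> borel_measurable M" "AE x in M. f x = g x"
    and "h \<in> borel_measurable M"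
  shows "l2_inner M f h = l2_inner M g h"
  unfolding l2_inner_def using assms by (intro integral_cong_AE) auto

lemma L2_cong_AE:
  assumes "f \<in> L2 M" "g \<in> borel_measurable M" "AE x in M. f x = g x"
  shows "g \<in> L2 M"
proof -
  have "integrable M (\<lambda>x. (cmod (f x))\<^sup>2) \<longleftrightarrow> integrable M (\<lambda>x. (cmod (g x))\<^sup>2)"
    using assms(2,3) L2_measurable[OF assms(1)] by (intro integrable_cong_AE) auto
  then show ?thesis using assms by (simp add: L2_def)
qed

lemma l2_norm_cmult: "l2_norm M (\<lambda>x. a * f x) = cmod a * l2_norm M f"
  by (simp add: l2_norm_def norm_mult power_mult_distrib real_sqrt_mult)

lemma l2_norm_minus_commute: "l2_norm M (\<lambda>x. f x - g x) = l2_norm M (\<lambda>x. g x - f x)"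
  by (simp add: l2_norm_def norm_minus_commute)

lemma l2_Cauchy_Schwarz:
  assumes "f \<in> L2 M" "g \<in> L2 M"
  shows "cmod (l2_inner M f g) \<le> l2_norm M f * l2_norm M g"
proof (cases "l2_norm M g = 0")
  case True
  then have "AE x in M. g x = 0" using l2_norm_eq_0_iff assms by blast
  then have "l2_inner M g f = l2_inner M (\<lambda>x. 0) f"
    using assms by (intro l2_inner_cong_AE) (auto dest: L2_measurable)
  then have "l2_inner M f g = cnj 0" using l2_inner_cnj[of M g f] by (simp add: l2_inner_def)
  then show ?thesis by simp
next
  case False
  define b where "b = (l2_norm M g)\<^sup>2"
  have b: "b > 0" using False by (simp add: b_def)
  \<comment> \<open>The coefficient of the component of \<open>f\<close> along \<open>g\<close>. It
    minimises the expanded square, whose nonnegativity is then the claim.\<close>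
  define c where "c = l2_inner M f g / of_real b"
  have "0 \<le> (l2_norm M (\<lambda>x. f x - c * g x))\<^sup>2" by simp
  also have "\<dots> = (l2_norm M f)\<^sup>2 - 2 * Re (cnj c * l2_inner M f g) + (cmod c)\<^sup>2 * b"
    by (simp add: l2_norm_sq_lin assms b_def)
  also have "cnj c * l2_inner M f g = of_real ((cmod (l2_inner M f g))\<^sup>2 / b)"
    by (simp add: c_def mult.commute flip: complex_norm_square)
  also have "(cmod c)\<^sup>2 * b = (cmod (l2_inner M f g))\<^sup>2 / b"
    using b by (simp add: c_def norm_divide power_divide power2_eq_square)
  finally have "(cmod (l2_inner M f g))\<^sup>2 / b \<le> (l2_norm M f)\<^sup>2"
    by simp
  then have "(cmod (l2_inner M f g))\<^sup>2 \<le> (l2_norm M f * l2_norm M g)\<^sup>2"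
    using b by (simp add: b_def field_simps power_mult_distrib)
  then show ?thesis by (rule power2_le_imp_le) simp
qed

lemma l2_norm_triangle_diff:
  assumes "f \<in> L2 M" "g \<in> L2 M"
  shows "l2_norm M (\<lambda>x. f x - g x) \<le> l2_norm M f + l2_norm M g"
proof -
  have "(l2_norm M (\<lambda>x. f x - g x))\<^sup>2 = (l2_norm M f)\<^sup>2 - 2 * Re (l2_inner M f g) + (l2_norm M g)\<^sup>2"
    using l2_norm_sq_lin[OF assms, of 1] by simp
  also have "\<dots> \<le> (l2_norm M f + l2_norm M g)\<^sup>2"
    using l2_Cauchy_Schwarz[OF assms] abs_Re_le_cmod[of "l2_inner M f g"]
    by (simp add: power2_sum)
  finally show ?thesis by (rule power2_le_imp_le) simp
qed

lemma l2_norm_triangle: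
  assumes "f \<in> L2 M" "g \<in> L2 M"
  shows "l2_norm M (\<lambda>x. f x + g x) \<le> l2_norm M f + l2_norm M g"
  using l2_norm_triangle_diff[OF assms(1) L2_cmult[OF assms(2)], of "-1"] l2_norm_cmult[of M "-1" g]
  by simp

lemma l2_dist_triangle:
  assumes "f \<in> L2 M" "g \<in> L2 M" "h \<in> L2 M"
  shows "l2_norm M (\<lambda>x. f x - h x) \<le> l2_norm M (\<lambda>x. f x - g x) + l2_norm M (\<lambda>x. g x - h x)"
  using l2_norm_triangle[OF L2_diff[OF assms(1,2)] L2_diff[OF assms(2,3)]] by simp

lemma l2_norm_sum:
  assumes "\<And>i. i \<in> A \<Longrightarrow> f i \<in> L2 M"
  shows "l2_norm M (\<lambda>x. \<Sum>i\<in>A. f i x) \<le> (\<Sum>i\<in>A. l2_norm M (f i))"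
  using assms
proof (induction A rule: infinite_finite_induct)
  case (insert a A)
  have "l2_norm M (\<lambda>x. f a x + (\<Sum>i\<in>A. f i x)) \<le> l2_norm M (f a) + l2_norm M (\<lambda>x. \<Sum>i\<in>A. f i x)"
    using insert.prems by (intro l2_norm_triangle L2_sum) auto
  also have "\<dots> \<le> l2_norm M (f a) + (\<Sum>i\<in>A. l2_norm M (f i))"
    using insert by auto
  finally show ?case using insert by simp
qed auto

lemma l2_norm_sq_orthogonal_sum:
  assumes "finite A" "\<And>i. i \<in> A \<Longrightarrow> f i \<in> L2 M"
    and orth: "\<And>i j. i \<in> A \<Longrightarrow> j \<in> A \<Longrightarrow> i \<noteq> j \<Longrightarrow> l2_inner M (f i) (f j) = 0"
  shows "(l2_norm M (\<lambda>x. \<Sum>i\<in>A. f i x))\<^sup>2 = (\<Sum>i\<in>A. (l2_norm M (f i))\<^sup>2)"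
proof -
  let ?s = "\<lambda>x. \<Sum>i\<in>A. f i x"
  have inner_fi: "l2_inner M (f i) ?s = of_real ((l2_norm M (f i))\<^sup>2)" if "i \<in> A" for i
  proof -
    have "l2_inner M (f i) ?s = cnj (\<Sum>j\<in>A. l2_inner M (f j) (f i))"
      using assms that by (subst l2_inner_cnj[symmetric]) (simp add: l2_inner_sum_left)
    also have "(\<Sum>j\<in>A. l2_inner M (f j) (f i)) = (\<Sum>j\<in>A. if j = i then of_real ((l2_norm M (f i))\<^sup>2) else 0)"
      using orth that by (intro sum.cong) (auto simp: l2_inner_self)
    also have "\<dots> = of_real ((l2_norm M (f i))\<^sup>2)" using that assms(1) by simp
    finally show ?thesis by simp
  qed
  have "of_real ((l2_norm M ?s)\<^sup>2) = l2_inner M ?s ?s" by (simp add: l2_inner_self)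
  also have "\<dots> = (\<Sum>i\<in>A. l2_inner M (f i) ?s)"
    using assms by (intro l2_inner_sum_left L2_sum) auto
  also have "\<dots> = of_real (\<Sum>i\<in>A. (l2_norm M (f i))\<^sup>2)" using inner_fi by simp
  finally show ?thesis using of_real_eq_iff by blast
qed

text \<open>Weighting the squared increments by \<open>2\<^sup>k\<close> keeps their series integrable, so it is finite almost
  everywhere and the increments decay geometrically there.\<close>

lemma L2_complete:
  assumes F: "\<And>k. F k \<in> L2 M"
    and Cauchy: "\<And>e. e > 0 \<Longrightarrow> \<exists>N. \<forall>k\<ge>N. \<forall>l\<ge>N. l2_norm M (\<lambda>x. F k x - F l x) < e"
  shows "\<exists>g\<in>L2 M. (\<lambda>k. l2_norm M (\<lambda>x. F k x - g x)) \<longlonglongrightarrow> 0"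
proof -
  have [measurable]: "F k \<in> borel_measurable M" for k using F by (rule L2_measurable)
  have "\<exists>N. \<forall>j. \<forall>k\<ge>N j. \<forall>l\<ge>N j. l2_norm M (\<lambda>x. F k x - F l x) < (1/2)^j"
    by (intro choice allI Cauchy) auto
  then obtain N where N: "\<And>j k l. k \<ge> N j \<Longrightarrow> l \<ge> N j \<Longrightarrow> l2_norm M (\<lambda>x. F k x - F l x) < (1/2)^j"
    by blast
  \<comment> \<open>The running maximum puts \<open>r i\<close> past all thresholds
    \<open>N j\<close> with j at most i, so the increments along \<open>r\<close> are bounded by
    powers of 1/2.\<close>
  define r where "r j = Max (N ` {..j})" for j
  have rN: "r i \<ge> N j" if "j \<le> i" for i j
    unfolding r_def using that by (intro Max_ge) auto
  define D where "D j x = F (r (Suc j)) x - F (r j) x" for j x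
  have D_L2: "D j \<in> L2 M" for j unfolding D_def by (intro L2_diff F)
  have [measurable]: "D j \<in> borel_measurable M" for j using D_L2 by (rule L2_measurable)
  have nD: "l2_norm M (D j) \<le> (1/2)^j" for j
    using N[of j "r (Suc j)" "r j"] rN[of j] unfolding D_def by (simp add: less_imp_le)
  have nn_sq: "(\<integral>\<^sup>+x. ennreal ((cmod (h x))\<^sup>2) \<partial>M) = ennreal ((l2_norm M h)\<^sup>2)" if "h \<in> L2 M" for h
    unfolding l2_norm_sq by (intro nn_integral_eq_integral L2_integrable_sq that) auto
  have "(\<integral>\<^sup>+x. (\<Sum>j. ennreal (2^j * (cmod (D j x))\<^sup>2)) \<partial>M) = (\<Sum>j. \<integral>\<^sup>+x. ennreal (2^j * (cmod (D j x))\<^sup>2) \<partial>M)"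
    by (intro nn_integral_suminf) auto
  also have "\<dots> = (\<Sum>j. ennreal (2^j * (l2_norm M (D j))\<^sup>2))"
    by (simp add: ennreal_mult nn_integral_cmult nn_sq D_L2)
  also have "\<dots> \<le> (\<Sum>j. ennreal ((1/2)^j))"
  proof (intro suminf_le ennreal_leI)
    fix j
    have "2^j * (l2_norm M (D j))\<^sup>2 \<le> 2^j * ((1/2)^j)\<^sup>2"
      by (intro mult_left_mono power_mono nD) auto
    also have "\<dots> = (1/2)^j" by (simp add: power2_eq_square flip: power_mult_distrib)
    finally show "2^j * (l2_norm M (D j))\<^sup>2 \<le> (1/2)^j" .
  qed auto
  also have "\<dots> = ennreal (\<Sum>j. (1/2)^j)" by (intro suminf_ennreal2) auto
  also have "\<dots> < \<infinity>" by simp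
  finally have "(\<integral>\<^sup>+x. (\<Sum>j. ennreal (2^j * (cmod (D j x))\<^sup>2)) \<partial>M) \<noteq> \<infinity>" by simp
  then have "AE x in M. (\<Sum>j. ennreal (2^j * (cmod (D j x))\<^sup>2)) \<noteq> \<infinity>"
    by (intro nn_integral_PInf_AE) auto
  then have "AE x in M. convergent (\<lambda>j. F (r j) x)"
  proof (eventually_elim)
    fix x assume "(\<Sum>j. ennreal (2^j * (cmod (D j x))\<^sup>2)) \<noteq> \<infinity>"
    then have "summable (\<lambda>j. 2^j * (cmod (D j x))\<^sup>2)"
      by (intro summable_suminf_not_top) auto
    then have "Bseq (\<lambda>j. 2^j * (cmod (D j x))\<^sup>2)"
      using summable_LIMSEQ_zero convergentI convergent_imp_Bseq by blast
    then obtain B where B: "B > 0" "\<And>j. 2^j * (cmod (D j x))\<^sup>2 \<le> B"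
      unfolding Bseq_def by auto
    have le: "cmod (D j x) \<le> sqrt B * (sqrt (1/2))^j" for j
    proof (rule power2_le_imp_le)
      have "(cmod (D j x))\<^sup>2 \<le> B * (1/2)^j"
        using B(2)[of j] by (simp add: field_simps power_divide)
      also have "\<dots> = (sqrt B)\<^sup>2 * ((sqrt (1/2))\<^sup>2)^j"
        using B by simp
      also have "\<dots> = (sqrt B * (sqrt (1/2))^j)\<^sup>2"
        by (simp only: power_mult_distrib power_mult[symmetric] mult.commute[of j])
      finally show "(cmod (D j x))\<^sup>2 \<le> (sqrt B * (sqrt (1/2))^j)\<^sup>2" .
    qed (use B in simp)
    have "summable (\<lambda>j. sqrt B * (sqrt (1/2))^j)"
      by (intro summable_mult summable_geometric) (simp add: real_sqrt_divide)
    then have "summable (\<lambda>j. D j x)"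
      by (rule summable_comparison_test[rotated]) (use le in auto)
    then have "convergent (\<lambda>n. \<Sum>j<n. D j x)" by (simp add: summable_iff_convergent)
    then have "convergent (\<lambda>n. (F (r n) x - F (r 0) x) + F (r 0) x)"
      unfolding D_def by (intro convergent_add convergent_const)
        (simp add: sum_lessThan_telescope[of "\<lambda>n. F (r n) x"])
    then show "convergent (\<lambda>j. F (r j) x)" by simp
  qed
  note conv = this
  define g where "g x = lim (\<lambda>j. F (r j) x)" for x
  have [measurable]: "g \<in> borel_measurable M"
    unfolding g_def by (intro borel_measurable_lim_metric) auto
  have lim: "AE x in M. (\<lambda>j. F (r j) x) \<longlonglongrightarrow> g x"
    using conv by eventually_elim (simp add: g_def convergent_LIMSEQ_iff)
  \<comment> \<open>Fatou's lemma along the subsequence carries the Cauchy bound over to the limit.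
    It yields both the square integrability of \<open>F k - g\<close> and the rate of convergence of
    the whole sequence.\<close>
  have fatou: "(\<integral>\<^sup>+x. ennreal ((cmod (F k x - g x))\<^sup>2) \<partial>M) \<le> ennreal (((1/2)^j)\<^sup>2)" if "k \<ge> N j" for k j
  proof -
    have "(\<integral>\<^sup>+x. ennreal ((cmod (F k x - g x))\<^sup>2) \<partial>M)
      = (\<integral>\<^sup>+x. liminf (\<lambda>i. ennreal ((cmod (F k x - F (r i) x))\<^sup>2)) \<partial>M)"
      using lim
    proof (intro nn_integral_cong_AE, eventually_elim)
      fix x assume "(\<lambda>j. F (r j) x) \<longlonglongrightarrow> g x"
      then have "(\<lambda>i. ennreal ((cmod (F k x - F (r i) x))\<^sup>2)) \<longlonglongrightarrow> ennreal ((cmod (F k x - g x))\<^sup>2)"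
        by (intro tendsto_intros tendsto_ennrealI)
      then show "ennreal ((cmod (F k x - g x))\<^sup>2) = liminf (\<lambda>i. ennreal ((cmod (F k x - F (r i) x))\<^sup>2))"
        by (rule lim_imp_Liminf[symmetric, rotated]) simp
    qed
    also have "\<dots> \<le> liminf (\<lambda>i. \<integral>\<^sup>+x. ennreal ((cmod (F k x - F (r i) x))\<^sup>2) \<partial>M)"
      by (intro nn_integral_liminf) auto
    also have "\<dots> = liminf (\<lambda>i. ennreal ((l2_norm M (\<lambda>x. F k x - F (r i) x))\<^sup>2))"
      by (simp add: nn_sq L2_diff F)
    also have "\<dots> \<le> ennreal (((1/2)^j)\<^sup>2)"
    proof (rule Liminf_le)
      show "\<forall>\<^sub>F i in sequentially. ennreal ((l2_norm M (\<lambda>x. F k x - F (r i) x))\<^sup>2) \<le> ennreal (((1/2)^j)\<^sup>2)"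
        using eventually_ge_at_top[of j]
      proof eventually_elim
        case (elim i)
        show ?case
          using N[OF that rN[OF elim]] by (intro ennreal_leI power_mono) auto
      qed
    qed simp
    finally show ?thesis .
  qed
  have diff_L2: "(\<lambda>x. F k x - g x) \<in> L2 M" if "k \<ge> N j" for k j
  proof -
    have "(\<integral>\<^sup>+x. ennreal ((cmod (F k x - g x))\<^sup>2) \<partial>M) < \<infinity>"
      using fatou[OF that] by (rule le_less_trans) (simp add: ennreal_less_top)
    then have "integrable M (\<lambda>x. (cmod (F k x - g x))\<^sup>2)"
      by (intro integrableI_bounded) auto
    then show ?thesis by (simp add: L2_def)
  qed
  have g_L2: "g \<in> L2 M"
    using L2_diff[OF F diff_L2[of 0 "N 0"], of "N 0"] by simp
  have small: "l2_norm M (\<lambda>x. F k x - g x) \<le> (1/2)^j" if "k \<ge> N j" for k j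
  proof -
    have "ennreal ((l2_norm M (\<lambda>x. F k x - g x))\<^sup>2) \<le> ennreal (((1/2)^j)\<^sup>2)"
      using fatou[OF that] nn_sq[OF diff_L2[OF that]] by simp
    then have "(l2_norm M (\<lambda>x. F k x - g x))\<^sup>2 \<le> ((1/2)^j)\<^sup>2"
      by (subst (asm) ennreal_le_iff) auto
    then show ?thesis by (rule power2_le_imp_le) simp
  qed
  have "(\<lambda>k. l2_norm M (\<lambda>x. F k x - g x)) \<longlonglongrightarrow> 0"
  proof (rule LIMSEQ_I)
    fix e :: real assume "e > 0"
    then obtain j where j: "(1/2)^j < e" using real_arch_pow_inv[of e "1/2"] by auto
    show "\<exists>no. \<forall>k\<ge>no. norm (l2_norm M (\<lambda>x. F k x - g x) - 0) < e"
      using small[of j] j by (intro exI[of _ "N j"]) (auto intro: le_less_trans)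
  qed
  then show ?thesis using g_L2 by blast
qed

section \<open>Orthogonal projection onto a closed subspace of square-integrable functions\<close>

locale l2_closed_subspace =
  fixes M :: "'a measure" and H :: "('a \<Rightarrow> complex) set"
  assumes H_subset: "H \<subseteq> L2 M"
    and zero_mem: "(\<lambda>x. 0) \<in> H"
    and lin_mem: "f \<in> H \<Longrightarrow> g \<in> H \<Longrightarrow> (\<lambda>x. a * f x + b * g x) \<in> H"
    and closed: "range F \<subseteq> H \<Longrightarrow> g \<in> L2 M \<Longrightarrow> (\<lambda>k. l2_norm M (\<lambda>x. F k x - g x)) \<longlonglongrightarrow> 0 \<Longrightarrow> g \<in> H"
begin

lemma mem_L2: "f \<in> H \<Longrightarrow> f \<in> L2 M"
  using H_subset by blast

lemma mem_measurable: "f \<in> H \<Longrightarrow> f \<in> borel_measurable M"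
  by (intro L2_measurable mem_L2)

lemma add_mem: "f \<in> H \<Longrightarrow> g \<in> H \<Longrightarrow> (\<lambda>x. f x + g x) \<in> H"
  using lin_mem[of f g 1 1] by simp

lemma diff_mem: "f \<in> H \<Longrightarrow> g \<in> H \<Longrightarrow> (\<lambda>x. f x - g x) \<in> H"
  using lin_mem[of f g 1 "-1"] by simp

lemma cmult_mem: "f \<in> H \<Longrightarrow> (\<lambda>x. a * f x) \<in> H"
  using lin_mem[of f f a 0] by simp

lemma sum_mem: "(\<And>i. i \<in> A \<Longrightarrow> f i \<in> H) \<Longrightarrow> (\<lambda>x. \<Sum>i\<in>A. f i x) \<in> H"
  by (induction A rule: infinite_finite_induct) (auto intro: add_mem zero_mem)

text \<open>A minimising sequence for the distance from \<open>f\<close> to \<open>H\<close> is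
  Cauchy by the parallelogram law; its limit attains the distance, and varying it in the direction
  \<open>h\<close> forces orthogonality.\<close>

lemma exists_projection:
  assumes f: "f \<in> L2 M"
  shows "\<exists>g\<in>H. \<forall>h\<in>H. l2_inner M (\<lambda>x. f x - g x) h = 0"
proof -
  define d where "d = (INF g\<in>H. (l2_norm M (\<lambda>x. f x - g x))\<^sup>2)"
  have bdd: "bdd_below ((\<lambda>g. (l2_norm M (\<lambda>x. f x - g x))\<^sup>2) ` H)"
    by (intro bdd_belowI[of _ 0]) auto
  have d_le: "d \<le> (l2_norm M (\<lambda>x. f x - g x))\<^sup>2" if "g \<in> H" for g
    unfolding d_def using that bdd by (rule cINF_lower[rotated])
  have "\<exists>g. g \<in> H \<and> (l2_norm M (\<lambda>x. f x - g x))\<^sup>2 < d + 1 / real (Suc k)" for k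
    using cINF_less_iff[of H "\<lambda>g. (l2_norm M (\<lambda>x. f x - g x))\<^sup>2" "d + 1 / real (Suc k)"] zero_mem bdd
    by (auto simp: d_def)
  then obtain G where G: "\<And>k. G k \<in> H" "\<And>k. (l2_norm M (\<lambda>x. f x - G k x))\<^sup>2 < d + 1 / real (Suc k)"
    by metis
  \<comment> \<open>The midpoint of \<open>G k\<close> and \<open>G l\<close> lies in
    \<open>H\<close>, so its squared distance to \<open>f\<close> is at least \<open>d\<close>. The
    parallelogram law turns this into a bound on the distance of the two members.\<close>
  have close: "(l2_norm M (\<lambda>x. G k x - G l x))\<^sup>2 \<le> 2 / real (Suc k) + 2 / real (Suc l)" for k l
  proof -
    let ?u = "\<lambda>x. f x - G k x" and ?v = "\<lambda>x. f x - G l x"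
    have uv: "?u \<in> L2 M" "?v \<in> L2 M" using f G(1) by (auto intro: L2_diff mem_L2)
    have "d \<le> (l2_norm M (\<lambda>x. f x - (1/2 * G k x + 1/2 * G l x)))\<^sup>2"
      using lin_mem[OF G(1)[of k] G(1)[of l], of "1/2" "1/2"] by (rule d_le)
    also have "(\<lambda>x. f x - (1/2 * G k x + 1/2 * G l x)) = (\<lambda>x. 1/2 * (?u x - (-1) * ?v x))"
      by (auto simp: fun_eq_iff algebra_simps)
    also have "(l2_norm M \<dots>)\<^sup>2 = 1/4 * (l2_norm M (\<lambda>x. ?u x - (-1) * ?v x))\<^sup>2"
      by (subst l2_norm_cmult) (simp add: power_divide)
    finally have *: "4 * d \<le> (l2_norm M (\<lambda>x. ?u x - (-1) * ?v x))\<^sup>2" by simp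
    have "(l2_norm M (\<lambda>x. ?u x - 1 * ?v x))\<^sup>2 + (l2_norm M (\<lambda>x. ?u x - (-1) * ?v x))\<^sup>2
      = 2 * (l2_norm M ?u)\<^sup>2 + 2 * (l2_norm M ?v)\<^sup>2"
      using l2_norm_sq_lin[OF uv, of 1] l2_norm_sq_lin[OF uv, of "-1"] by simp
    moreover have "l2_norm M (\<lambda>x. ?u x - 1 * ?v x) = l2_norm M (\<lambda>x. G k x - G l x)"
      using l2_norm_minus_commute[of M "G k" "G l"] by simp
    ultimately show ?thesis using * G(2)[of k] G(2)[of l] by simp
  qed
  have "\<exists>g\<in>L2 M. (\<lambda>k. l2_norm M (\<lambda>x. G k x - g x)) \<longlonglongrightarrow> 0"
  proof (rule L2_complete)
    fix e :: real assume e: "e > 0"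
    obtain N where N: "4 / real (Suc N) < e\<^sup>2"
      using reals_Archimedean[of "e\<^sup>2 / 4"] e by (auto simp: field_simps)
    have "l2_norm M (\<lambda>x. G k x - G l x) < e" if "k \<ge> N" "l \<ge> N" for k l
    proof (rule power2_less_imp_less)
      have "2 / real (Suc k) \<le> 2 / real (Suc N)" "2 / real (Suc l) \<le> 2 / real (Suc N)"
        using that by (auto intro!: divide_left_mono)
      then show "(l2_norm M (\<lambda>x. G k x - G l x))\<^sup>2 < e\<^sup>2"
        using close[of k l] N by simp
    qed (use e in simp)
    then show "\<exists>N. \<forall>k\<ge>N. \<forall>l\<ge>N. l2_norm M (\<lambda>x. G k x - G l x) < e" by blast
  qed (use G(1) mem_L2 in blast)
  then obtain g where g: "g \<in> L2 M" "(\<lambda>k. l2_norm M (\<lambda>x. G k x - g x)) \<longlonglongrightarrow> 0" by blast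
  have gH: "g \<in> H" using closed[of G g] g G(1) by blast
  have n_le: "l2_norm M (\<lambda>x. f x - g x) \<le> sqrt d"
  proof (rule LIMSEQ_le_const)
    have "(\<lambda>k. sqrt (d + 1 / real (Suc k)) + l2_norm M (\<lambda>x. G k x - g x)) \<longlonglongrightarrow> sqrt (d + 0) + 0"
      using LIMSEQ_inverse_real_of_nat unfolding inverse_eq_divide by (intro tendsto_intros g)
    then show "(\<lambda>k. sqrt (d + 1 / real (Suc k)) + l2_norm M (\<lambda>x. G k x - g x)) \<longlonglongrightarrow> sqrt d" by simp
    have "l2_norm M (\<lambda>x. f x - g x) \<le> sqrt (d + 1 / real (Suc k)) + l2_norm M (\<lambda>x. G k x - g x)" for k
      using l2_dist_triangle[OF f mem_L2[OF G(1)[of k]] g(1)] real_le_rsqrt[OF less_imp_le[OF G(2)[of k]]]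
      by linarith
    then show "\<exists>N. \<forall>k\<ge>N. l2_norm M (\<lambda>x. f x - g x) \<le> sqrt (d + 1 / real (Suc k)) + l2_norm M (\<lambda>x. G k x - g x)"
      by blast
  qed
  have d0: "d \<ge> 0" unfolding d_def using zero_mem by (intro cINF_greatest) auto
  have u_le: "(l2_norm M (\<lambda>x. f x - g x))\<^sup>2 \<le> d"
    using power_mono[OF n_le, of 2] d0 by simp
  have "l2_inner M (\<lambda>x. f x - g x) h = 0" if h: "h \<in> H" for h
  proof -
    let ?u = "\<lambda>x. f x - g x"
    define w where "w = l2_inner M ?u h"
    \<comment> \<open>The optimal step would divide by the squared norm of \<open>h\<close>; adding
      1 covers \<open>h\<close> of norm 0 and still makes the quadratic loss at most half of the
      linear gain.\<close>
    define t where "t = 1 / (1 + (l2_norm M h)\<^sup>2)"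
    have t: "t > 0" "t * (l2_norm M h)\<^sup>2 \<le> 1"
      by (auto simp: t_def field_simps add_pos_nonneg)
    define c where "c = of_real t * w"
    have "(\<lambda>x. g x + c * h x) \<in> H" using lin_mem[OF gH h, of 1 c] by simp
    from d_le[OF this] have "d \<le> (l2_norm M (\<lambda>x. ?u x - c * h x))\<^sup>2" by (simp add: algebra_simps)
    also have "\<dots> = (l2_norm M ?u)\<^sup>2 - 2 * Re (cnj c * w) + (cmod c)\<^sup>2 * (l2_norm M h)\<^sup>2"
      unfolding w_def by (rule l2_norm_sq_lin[OF L2_diff[OF f g(1)] mem_L2[OF h]])
    also have "cnj c * w = of_real t * (w * cnj w)" by (simp add: c_def)
    also have "\<dots> = of_real (t * (cmod w)\<^sup>2)" by (simp only: of_real_mult complex_norm_square)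
    also have "(cmod c)\<^sup>2 * (l2_norm M h)\<^sup>2 = t * (cmod w)\<^sup>2 * (t * (l2_norm M h)\<^sup>2)"
      using t by (simp add: c_def norm_mult power_mult_distrib power2_eq_square)
    finally have "2 * (t * (cmod w)\<^sup>2) \<le> t * (cmod w)\<^sup>2 * (t * (l2_norm M h)\<^sup>2)"
      using u_le by simp
    also have "\<dots> \<le> t * (cmod w)\<^sup>2 * 1"
      using t by (intro mult_left_mono) auto
    finally have "t * (cmod w)\<^sup>2 \<le> 0" by simp
    then show ?thesis using t by (simp add: w_def[symmetric] mult_le_0_iff)
  qed
  then show ?thesis using gH by blast
qed

abbreviation P where "P \<equiv> l2_proj M H"

lemma
  assumes f: "f \<in> L2 M"
  shows proj_mem: "P f \<in> H"
    and proj_orthogonal: "h \<in> H \<Longrightarrow> l2_inner M (\<lambda>x. f x - P f x) h = 0"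
proof -
  have "P f \<in> H \<and> (\<forall>h\<in>H. l2_inner M (\<lambda>x. f x - P f x) h = 0)"
    unfolding l2_proj_def using exists_projection[OF f] unfolding Bex_def by (rule someI_ex)
  then show "P f \<in> H" "h \<in> H \<Longrightarrow> l2_inner M (\<lambda>x. f x - P f x) h = 0" by auto
qed

lemma proj_L2: "f \<in> L2 M \<Longrightarrow> P f \<in> L2 M"
  by (rule mem_L2[OF proj_mem])

lemma proj_inner_left:
  assumes "f \<in> L2 M" "h \<in> H"
  shows "l2_inner M (P f) h = l2_inner M f h"
  using proj_orthogonal[OF assms] l2_inner_diff_left[OF assms(1) proj_L2[OF assms(1)] mem_L2[OF assms(2)]]
  by simp

lemma proj_inner_right: "f \<in> L2 M \<Longrightarrow> h \<in> H \<Longrightarrow> l2_inner M h (P f) = l2_inner M h f"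
  using arg_cong[OF proj_inner_left[of f h], of cnj] by (simp add: l2_inner_cnj)

lemma eq_AE_if_inner_eq:
  assumes "g \<in> H" "g' \<in> H" "\<And>h. h \<in> H \<Longrightarrow> l2_inner M g h = l2_inner M g' h"
  shows "AE x in M. g x = g' x"
proof -
  have "l2_inner M (\<lambda>x. g x - g' x) (\<lambda>x. g x - g' x) = 0"
    using l2_inner_diff_left[OF mem_L2[OF assms(1)] mem_L2[OF assms(2)] mem_L2[OF diff_mem[OF assms(1,2)]]]
      assms(3)[OF diff_mem[OF assms(1,2)]] by simp
  then have "l2_norm M (\<lambda>x. g x - g' x) = 0" by (simp add: l2_inner_self)
  then have "AE x in M. g x - g' x = 0"
    using l2_norm_eq_0_iff[OF mem_L2[OF diff_mem[OF assms(1,2)]]] by simp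
  then show ?thesis by eventually_elim simp
qed

lemma proj_unique:
  assumes "f \<in> L2 M" "g \<in> H" "\<And>h. h \<in> H \<Longrightarrow> l2_inner M f h = l2_inner M g h"
  shows "AE x in M. P f x = g x"
  using eq_AE_if_inner_eq[OF proj_mem[OF assms(1)] assms(2)] assms by (simp add: proj_inner_left)

lemma proj_ident: "f \<in> H \<Longrightarrow> AE x in M. P f x = f x"
  by (rule proj_unique[OF mem_L2]) (assumption, assumption, rule refl)

lemma proj_lin:
  assumes "f \<in> L2 M" "g \<in> L2 M"
  shows "AE x in M. P (\<lambda>x. a * f x + b * g x) x = a * P f x + b * P g x"
proof (rule proj_unique)
  fix h assume "h \<in> H"
  then show "l2_inner M (\<lambda>x. a * f x + b * g x) h = l2_inner M (\<lambda>x. a * P f x + b * P g x) h"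
    using l2_inner_lin_left[OF assms, of h] l2_inner_lin_left[OF proj_L2[OF assms(1)] proj_L2[OF assms(2)], of h]
      assms by (simp add: mem_L2 proj_inner_left)
qed (use assms in \<open>blast intro: L2_lin lin_mem proj_mem\<close>)+

lemma proj_diff:
  assumes "f \<in> L2 M" "g \<in> L2 M"
  shows "AE x in M. P (\<lambda>x. f x - g x) x = P f x - P g x"
  using proj_lin[OF assms, of 1 "-1"] by simp

lemma proj_Pythagoras:
  assumes "f \<in> L2 M" "h \<in> H"
  shows "(l2_norm M (\<lambda>x. f x - h x))\<^sup>2
    = (l2_norm M (\<lambda>x. f x - P f x))\<^sup>2 + (l2_norm M (\<lambda>x. P f x - h x))\<^sup>2"
proof -
  let ?u = "\<lambda>x. f x - P f x" and ?v = "\<lambda>x. h x - P f x"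
  have v: "?v \<in> H" using assms by (intro diff_mem proj_mem)
  have "(l2_norm M (\<lambda>x. ?u x - 1 * ?v x))\<^sup>2 = (l2_norm M ?u)\<^sup>2 + (l2_norm M ?v)\<^sup>2"
    using l2_norm_sq_lin[OF L2_diff[OF assms(1) proj_L2[OF assms(1)]] mem_L2[OF v], of 1]
      proj_orthogonal[OF assms(1) v] by simp
  then show ?thesis by (simp add: l2_norm_minus_commute[of M h])
qed

lemma proj_best: "f \<in> L2 M \<Longrightarrow> h \<in> H \<Longrightarrow> l2_norm M (\<lambda>x. f x - P f x) \<le> l2_norm M (\<lambda>x. f x - h x)"
  by (rule power2_le_imp_le) (simp_all add: proj_Pythagoras)

lemma proj_norm_le: "f \<in> L2 M \<Longrightarrow> l2_norm M (P f) \<le> l2_norm M f"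
  using proj_Pythagoras[OF _ zero_mem, of f] by (intro power2_le_imp_le[of "l2_norm M (P f)"]) simp_all

end

section \<open>Compactness\<close>

abbreviation (input) pairing_sum :: "'a measure \<Rightarrow> ('a \<Rightarrow> complex) list \<Rightarrow> ('a \<Rightarrow> complex) \<Rightarrow> real" where
  "pairing_sum M gs f \<equiv> \<Sum>g\<leftarrow>gs. cmod (l2_inner M f g)"

text \<open>For a linear operator this estimate is equivalent to compactness; unlike the sequential
  definition it is visibly stable under sums, products and limits of symbols.\<close>

definition compactness_estimate ::
  "'a measure \<Rightarrow> ('a \<Rightarrow> complex) set \<Rightarrow> (('a \<Rightarrow> complex) \<Rightarrow> ('a \<Rightarrow> complex)) \<Rightarrow> bool" where
  "compactness_estimate M H T \<longleftrightarrow> (\<forall>e>0. \<exists>gs. set gs \<subseteq> L2 M \<and>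
     (\<forall>f\<in>H. l2_norm M (T f) \<le> e * l2_norm M f + pairing_sum M gs f))"

lemma bounded_seqs_common_subseq:
  fixes u :: "'b \<Rightarrow> nat \<Rightarrow> complex"
  assumes "finite A" "\<And>a. a \<in> A \<Longrightarrow> bounded (range (u a))"
  shows "\<exists>r. strict_mono r \<and> (\<forall>a\<in>A. convergent (u a \<circ> r))"
  using assms
proof (induction A rule: finite_induct)
  case empty
  show ?case using strict_mono_id by blast
next
  case (insert b A)
  then obtain r where r: "strict_mono r" "\<forall>a\<in>A. convergent (u a \<circ> r)" by blast
  have "bounded (range (u b \<circ> r))"
    using insert.prems[of b] by (rule bounded_subset) auto
  then obtain l s where s: "strict_mono s" "((u b \<circ> r) \<circ> s) \<longlonglongrightarrow> l"
    using bounded_imp_convergent_subsequence by blast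
  have "convergent (u a \<circ> (r \<circ> s))" if "a \<in> insert b A" for a
  proof (cases "a = b")
    case True
    then show ?thesis using s(2) by (auto simp: convergent_def comp_assoc)
  next
    case False
    then show ?thesis using r(2) that convergent_subseq_convergent[of "u a \<circ> r" s] s(1)
      by (auto simp: comp_assoc)
  qed
  then show ?case using r(1) s(1) strict_mono_o by blast
qed

lemma Cauchy_sum_list:
  fixes u :: "'b \<Rightarrow> nat \<Rightarrow> complex"
  assumes "\<And>g. g \<in> set gs \<Longrightarrow> Cauchy (u g)" "e > 0"
  shows "\<exists>N. \<forall>k\<ge>N. \<forall>l\<ge>N. (\<Sum>g\<leftarrow>gs. cmod (u g k - u g l)) < e"
  using assms
proof (induction gs arbitrary: e)
  case (Cons g gs)
  obtain N where N: "\<forall>k\<ge>N. \<forall>l\<ge>N. (\<Sum>g\<leftarrow>gs. cmod (u g k - u g l)) < e / 2"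
    using Cons.IH[of "e / 2"] Cons.prems by auto
  obtain N' where N': "\<forall>k\<ge>N'. \<forall>l\<ge>N'. cmod (u g k - u g l) < e / 2"
    using Cons.prems(1)[of g] Cons.prems(2) unfolding Cauchy_def dist_norm
    by (metis half_gt_zero list.set_intros(1))
  have "(\<Sum>g\<leftarrow>g # gs. cmod (u g k - u g l)) < e" if "k \<ge> max N N'" "l \<ge> max N N'" for k l
  proof -
    have "(\<Sum>g\<leftarrow>gs. cmod (u g k - u g l)) < e / 2" "cmod (u g k - u g l) < e / 2"
      using N N' that by auto
    then show ?thesis by simp
  qed
  then show ?case by blast
qed auto

text \<open>Along a subsequence on which all pairings from the lists for the tolerances 1/(m+1)
  converge, the estimate applied to differences makes the images Cauchy; completeness and closedness
  of \<open>H\<close> supply the limit. Boundedness of \<open>T\<close> is the estimate with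
  tolerance 1 followed by Cauchy-Schwarz.\<close>

lemma (in l2_closed_subspace) compact_if_estimate:
  assumes T_mem: "\<And>f. f \<in> H \<Longrightarrow> T f \<in> H"
    and T_lin: "\<And>f g a b. f \<in> H \<Longrightarrow> g \<in> H \<Longrightarrow>
      AE x in M. T (\<lambda>y. a * f y + b * g y) x = a * T f x + b * T g x"
    and est: "compactness_estimate M H T"
  shows "l2_compact_operator M H T"
  unfolding l2_compact_operator_def
proof (intro conjI allI impI)
  obtain gs where gs: "set gs \<subseteq> L2 M"
    "\<And>f. f \<in> H \<Longrightarrow> l2_norm M (T f) \<le> 1 * l2_norm M f + pairing_sum M gs f"
    using est unfolding compactness_estimate_def by (meson zero_less_one)
  have "l2_norm M (T f) \<le> (1 + (\<Sum>g\<leftarrow>gs. l2_norm M g)) * l2_norm M f" if "f \<in> H" for f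
  proof -
    have "pairing_sum M gs f \<le> (\<Sum>g\<leftarrow>gs. l2_norm M f * l2_norm M g)"
      using gs(1) mem_L2[OF that] by (intro sum_list_mono l2_Cauchy_Schwarz) auto
    also have "\<dots> = l2_norm M f * (\<Sum>g\<leftarrow>gs. l2_norm M g)" by (rule sum_list_const_mult)
    finally show ?thesis using gs(2)[OF that] by (simp add: algebra_simps)
  qed
  then show "l2_bounded_operator M H T"
    unfolding l2_bounded_operator_def using T_mem T_lin by blast
next
  fix F :: "nat \<Rightarrow> 'a \<Rightarrow> complex"
  assume "range F \<subseteq> H \<and> bounded (range (\<lambda>k. l2_norm M (F k)))"
  then have F: "\<And>k. F k \<in> H" and bdd: "bounded (range (\<lambda>k. l2_norm M (F k)))" by auto
  then obtain B where B: "\<And>k. l2_norm M (F k) \<le> B"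
    unfolding bounded_iff by auto
  have B0: "B \<ge> 0" using B[of 0] l2_norm_nonneg[of M "F 0"] by linarith
  have "\<exists>gs. set gs \<subseteq> L2 M \<and> (\<forall>f\<in>H. l2_norm M (T f) \<le>
      e * l2_norm M f + pairing_sum M gs f)" if "e > 0" for e
    using est that unfolding compactness_estimate_def by blast
  then have "\<forall>m. \<exists>gs. set gs \<subseteq> L2 M \<and> (\<forall>f\<in>H. l2_norm M (T f) \<le>
      1 / real (Suc m) * l2_norm M f + pairing_sum M gs f)"
    by (meson of_nat_0_less_iff zero_less_Suc zero_less_divide_1_iff)
  then obtain gs where gs: "\<And>m. set (gs m) \<subseteq> L2 M"
    "\<And>m f. f \<in> H \<Longrightarrow> l2_norm M (T f) \<le> 1 / real (Suc m) * l2_norm M f + pairing_sum M (gs m) f"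
    by metis
  \<comment> \<open>The m-th requirement concerns the finite list belonging to tolerance 1/(m+1). It
    can be met by passing to a subsequence because the pairings are bounded, so diagonalisation
    meets all requirements at once.\<close>
  interpret subseqs "\<lambda>m s. \<forall>g\<in>set (gs m). convergent ((\<lambda>k. l2_inner M (F k) g) \<circ> s)"
  proof
    fix m and s :: "nat \<Rightarrow> nat"
    assume "strict_mono s"
    have "bounded (range (\<lambda>k. l2_inner M (F (s k)) g))" if "g \<in> set (gs m)" for g
    proof (rule boundedI)
      fix z assume "z \<in> range (\<lambda>k. l2_inner M (F (s k)) g)"
      then obtain k where "z = l2_inner M (F (s k)) g" by blast
      then have "cmod z \<le> l2_norm M (F (s k)) * l2_norm M g"
        using l2_Cauchy_Schwarz mem_L2 F gs(1) that by blast
      also have "\<dots> \<le> B * l2_norm M g" by (intro mult_right_mono B) simp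
      finally show "cmod z \<le> B * l2_norm M g" .
    qed
    then show "\<exists>r'. strict_mono r' \<and> (\<forall>g\<in>set (gs m). convergent ((\<lambda>k. l2_inner M (F k) g) \<circ> (s \<circ> r')))"
      using bounded_seqs_common_subseq[of "set (gs m)" "\<lambda>g k. l2_inner M (F (s k)) g"]
      by (simp add: o_def)
  qed
  define r where "r = diagseq"
  have r: "strict_mono r" unfolding r_def by (rule subseq_diagseq)
  have conv: "Cauchy (\<lambda>k. l2_inner M (F (r k)) g)" if "g \<in> set (gs m)" for m g
  proof -
    \<comment> \<open>The diagonal sequence is a subsequence of the m-th stage only after its first
      \<open>Suc m\<close> entries, which is why the convergence is first shown for the shifted
      sequence.\<close>
    have "\<forall>g\<in>set (gs m). convergent ((\<lambda>k. l2_inner M (F k) g) \<circ> (diagseq \<circ> (+) (Suc m)))"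
    proof (rule diagseq_holds)
      fix t s :: "nat \<Rightarrow> nat" and n
      assume "strict_mono t" "\<forall>g\<in>set (gs n). convergent ((\<lambda>k. l2_inner M (F k) g) \<circ> s)"
      then show "\<forall>g\<in>set (gs n). convergent ((\<lambda>k. l2_inner M (F k) g) \<circ> (s \<circ> t))"
        using convergent_subseq_convergent by (metis comp_assoc)
    qed
    then have "convergent (\<lambda>k. l2_inner M (F (r (k + Suc m))) g)"
      using that by (simp add: r_def o_def add.commute)
    then have "convergent (\<lambda>k. l2_inner M (F (r k)) g)"
      by (subst (asm) convergent_ignore_initial_segment)
    then show ?thesis by (rule convergent_Cauchy)
  qed
  have "\<exists>g\<in>L2 M. (\<lambda>k. l2_norm M (\<lambda>x. T (F (r k)) x - g x)) \<longlonglongrightarrow> 0"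
  proof (rule L2_complete)
    fix e :: real assume e: "e > 0"
    \<comment> \<open>Differences of members of the sequence have norm at most \<open>2 * B\<close>,
      so this \<open>m\<close> makes the first term of the estimate at most
      \<open>e / 2\<close>.\<close>
    obtain m where m: "4 * B / e < real m" using reals_Archimedean2 by blast
    have "4 * B < real m * e" using m e by (simp add: pos_divide_less_eq)
    then have "4 * B \<le> real (Suc m) * e" using e by (simp add: distrib_right)
    then have m': "1 / real (Suc m) * (2 * B) \<le> e / 2" by (simp add: divide_le_eq mult.commute)
    obtain N where N: "\<forall>k\<ge>N. \<forall>l\<ge>N. (\<Sum>g\<leftarrow>gs m. cmod (l2_inner M (F (r k)) g - l2_inner M (F (r l)) g)) < e / 2"
      using Cauchy_sum_list[of "gs m" "\<lambda>g k. l2_inner M (F (r k)) g" "e / 2"] conv e by auto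
    have "l2_norm M (\<lambda>x. T (F (r k)) x - T (F (r l)) x) < e" if "k \<ge> N" "l \<ge> N" for k l
    proof -
      let ?d = "\<lambda>x. F (r k) x - F (r l) x"
      have d: "?d \<in> H" using F by (intro diff_mem)
      have inner_d: "l2_inner M ?d g = l2_inner M (F (r k)) g - l2_inner M (F (r l)) g"
        if "g \<in> set (gs m)" for g
        by (rule l2_inner_diff_left[OF mem_L2[OF F] mem_L2[OF F]]) (use gs(1)[of m] that in auto)
      have "AE x in M. T ?d x = T (F (r k)) x - T (F (r l)) x"
        using T_lin[OF F[of "r k"] F[of "r l"], of 1 "-1"] by simp
      then have "AE x in M. T (F (r k)) x - T (F (r l)) x = T ?d x" by eventually_elim (rule sym)
      then have "l2_norm M (\<lambda>x. T (F (r k)) x - T (F (r l)) x) = l2_norm M (T ?d)"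
        by (intro l2_norm_cong_AE mem_measurable diff_mem T_mem F)
      also have "\<dots> \<le> 1 / real (Suc m) * l2_norm M ?d + pairing_sum M (gs m) ?d"
        by (rule gs(2)[OF d])
      also have "1 / real (Suc m) * l2_norm M ?d \<le> 1 / real (Suc m) * (2 * B)"
        using l2_norm_triangle_diff[OF mem_L2[OF F] mem_L2[OF F], of "r k" "r l"] B[of "r k"] B[of "r l"]
        by (intro mult_left_mono) auto
      also have "\<dots> \<le> e / 2" by (rule m')
      also have "pairing_sum M (gs m) ?d
          = (\<Sum>g\<leftarrow>gs m. cmod (l2_inner M (F (r k)) g - l2_inner M (F (r l)) g))"
        by (simp add: inner_d cong: map_cong)
      finally show ?thesis using N that by force
    qed
    then show "\<exists>N. \<forall>k\<ge>N. \<forall>l\<ge>N. l2_norm M (\<lambda>x. T (F (r k)) x - T (F (r l)) x) < e" by blast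
  qed (use T_mem F mem_L2 in blast)
  then obtain g where g: "g \<in> L2 M" "(\<lambda>k. l2_norm M (\<lambda>x. T (F (r k)) x - g x)) \<longlonglongrightarrow> 0" by blast
  moreover have "g \<in> H" using closed[of "\<lambda>k. T (F (r k))" g] g T_mem F by blast
  ultimately show "\<exists>g\<in>H. \<exists>r. strict_mono r \<and> (\<lambda>k. l2_norm M (\<lambda>x. T (F (r k)) x - g x)) \<longlonglongrightarrow> 0"
    using r by blast
qed

lemma l2_closed_subspace_closure:
  assumes A: "A \<subseteq> L2 M" and zero: "(\<lambda>x. 0) \<in> A"
    and lin: "\<And>f g a b. f \<in> A \<Longrightarrow> g \<in> A \<Longrightarrow> (\<lambda>x. a * f x + b * g x) \<in> A"
  shows "l2_closed_subspace M (l2_closure M A)"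
proof
  show "l2_closure M A \<subseteq> L2 M" by (auto simp: l2_closure_def)
  have "\<exists>g\<in>A. l2_norm M (\<lambda>x. 0 - g x) < e" if "e > 0" for e
    using zero that by (intro bexI[of _ "\<lambda>x. 0"]) auto
  then show "(\<lambda>x. 0) \<in> l2_closure M A" by (simp add: l2_closure_def)
next
  fix f g a b assume fg: "f \<in> l2_closure M A" "g \<in> l2_closure M A"
  then have L2: "f \<in> L2 M" "g \<in> L2 M" by (auto simp: l2_closure_def)
  have "\<exists>h\<in>A. l2_norm M (\<lambda>x. (a * f x + b * g x) - h x) < e" if e: "e > 0" for e
  proof -
    define d where "d = e / (cmod a + cmod b + 1)"
    have pos: "cmod a + cmod b + 1 > 0" by (simp add: add_nonneg_pos)
    have d: "d > 0" using e pos by (simp add: d_def)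
    obtain f' g' where f': "f' \<in> A" "l2_norm M (\<lambda>x. f x - f' x) < d"
      and g': "g' \<in> A" "l2_norm M (\<lambda>x. g x - g' x) < d"
      using fg d unfolding l2_closure_def by blast
    have L2': "f' \<in> L2 M" "g' \<in> L2 M" using A f' g' by auto
    have "l2_norm M (\<lambda>x. a * (f x - f' x) + b * (g x - g' x))
      \<le> l2_norm M (\<lambda>x. a * (f x - f' x)) + l2_norm M (\<lambda>x. b * (g x - g' x))"
      by (intro l2_norm_triangle L2_cmult L2_diff L2 L2')
    also have "\<dots> \<le> cmod a * d + cmod b * d"
      unfolding l2_norm_cmult using f' g' by (intro add_mono mult_left_mono) auto
    also have "\<dots> < (cmod a + cmod b + 1) * d" using d by (simp add: algebra_simps)
    also have "\<dots> = e" using pos by (simp add: d_def)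
    finally show ?thesis
      using lin[OF f'(1) g'(1), of a b] by (intro bexI) (simp_all add: algebra_simps)
  qed
  then show "(\<lambda>x. a * f x + b * g x) \<in> l2_closure M A"
    using L2_lin[OF L2] by (simp add: l2_closure_def)
next
  fix F g
  assume F: "range F \<subseteq> l2_closure M A" and g: "g \<in> L2 M"
    and lim: "(\<lambda>k. l2_norm M (\<lambda>x. F k x - g x)) \<longlonglongrightarrow> 0"
  have "\<exists>h\<in>A. l2_norm M (\<lambda>x. g x - h x) < e" if e: "e > 0" for e
  proof -
    have "e / 2 > 0" using e by simp
    then obtain k where k: "l2_norm M (\<lambda>x. F k x - g x) < e / 2"
      using order_tendstoD(2)[OF lim, of "e / 2"] eventually_happens'[OF sequentially_bot] by blast
    have Fk: "F k \<in> l2_closure M A" using F by auto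
    then obtain h where h: "h \<in> A" "l2_norm M (\<lambda>x. F k x - h x) < e / 2"
      using \<open>e / 2 > 0\<close> unfolding l2_closure_def by blast
    have "l2_norm M (\<lambda>x. g x - h x) \<le> l2_norm M (\<lambda>x. g x - F k x) + l2_norm M (\<lambda>x. F k x - h x)"
      by (rule l2_dist_triangle[OF g]) (use Fk h A in \<open>auto simp: l2_closure_def\<close>)
    then show ?thesis using k h l2_norm_minus_commute[of M g "F k"] by (intro bexI[of _ h]) auto
  qed
  then show "g \<in> l2_closure M A" using g by (simp add: l2_closure_def)
qed

lemma compactness_estimate_scaled:
  assumes S: "compactness_estimate M H S" and c: "c \<ge> 0"
    and le: "\<And>f. f \<in> H \<Longrightarrow> l2_norm M (T f) \<le> c * l2_norm M (S f)"
  shows "compactness_estimate M H T"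
  unfolding compactness_estimate_def
proof (intro allI impI)
  fix e :: real assume e: "e > 0"
  \<comment> \<open>The added 1 keeps the divisor positive when \<open>c = 0\<close>. The factor
    \<open>c\<close> in front of the pairings is absorbed into the vectors of the list.\<close>
  have pos: "e / (c + 1) > 0" using e c by simp
  obtain gs where gs: "set gs \<subseteq> L2 M"
    "\<And>f. f \<in> H \<Longrightarrow> l2_norm M (S f) \<le> e / (c + 1) * l2_norm M f + pairing_sum M gs f"
    using S pos unfolding compactness_estimate_def by blast
  let ?gs = "map (\<lambda>g x. of_real c * g x) gs"
  have "l2_norm M (T f) \<le> e * l2_norm M f + pairing_sum M ?gs f" if f: "f \<in> H" for f
  proof -
    have "l2_norm M (T f) \<le> c * (e / (c + 1) * l2_norm M f + pairing_sum M gs f)"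
      using le[OF f] gs(2)[OF f] c by (meson mult_left_mono order_trans)
    also have "\<dots> = c / (c + 1) * (e * l2_norm M f) + c * pairing_sum M gs f"
      by (simp add: distrib_left)
    also have "c / (c + 1) * (e * l2_norm M f) \<le> 1 * (e * l2_norm M f)"
      using c e by (intro mult_right_mono) auto
    also have "c * pairing_sum M gs f = pairing_sum M ?gs f"
      using c by (simp add: o_def l2_inner_cmult_right norm_mult sum_list_const_mult)
    finally show ?thesis by simp
  qed
  moreover have "set ?gs \<subseteq> L2 M" using gs(1) by (auto intro: L2_cmult)
  ultimately show "\<exists>gs. set gs \<subseteq> L2 M \<and> (\<forall>f\<in>H. l2_norm M (T f) \<le> e * l2_norm M f + pairing_sum M gs f)"
    by blast
qed

lemma compactness_estimate_add:
  assumes S: "compactness_estimate M H S" "compactness_estimate M H S'"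
    and le: "\<And>f. f \<in> H \<Longrightarrow> l2_norm M (T f) \<le> l2_norm M (S f) + l2_norm M (S' f)"
  shows "compactness_estimate M H T"
  unfolding compactness_estimate_def
proof (intro allI impI)
  fix e :: real assume e: "e > 0"
  then have pos: "e / 2 > 0" by simp
  obtain gs where gs: "set gs \<subseteq> L2 M"
    "\<And>f. f \<in> H \<Longrightarrow> l2_norm M (S f) \<le> e / 2 * l2_norm M f + pairing_sum M gs f"
    using S(1) pos unfolding compactness_estimate_def by blast
  obtain gs' where gs': "set gs' \<subseteq> L2 M"
    "\<And>f. f \<in> H \<Longrightarrow> l2_norm M (S' f) \<le> e / 2 * l2_norm M f + pairing_sum M gs' f"
    using S(2) pos unfolding compactness_estimate_def by blast
  have "l2_norm M (T f) \<le> e * l2_norm M f + pairing_sum M (gs @ gs') f" if f: "f \<in> H" for f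
    using le[OF f] gs(2)[OF f] gs'(2)[OF f] by simp
  moreover have "set (gs @ gs') \<subseteq> L2 M" using gs(1) gs'(1) by auto
  ultimately show "\<exists>gs. set gs \<subseteq> L2 M \<and> (\<forall>f\<in>H. l2_norm M (T f) \<le> e * l2_norm M f + pairing_sum M gs f)"
    by blast
qed

lemma compactness_estimate_limit:
  assumes "\<And>e. e > 0 \<Longrightarrow> \<exists>S. compactness_estimate M H S \<and>
      (\<forall>f\<in>H. l2_norm M (T f) \<le> l2_norm M (S f) + e * l2_norm M f)"
  shows "compactness_estimate M H T"
  unfolding compactness_estimate_def
proof (intro allI impI)
  fix e :: real assume e: "e > 0"
  then have pos: "e / 2 > 0" by simp
  obtain S where S: "compactness_estimate M H S"
    "\<And>f. f \<in> H \<Longrightarrow> l2_norm M (T f) \<le> l2_norm M (S f) + e / 2 * l2_norm M f"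
    using assms[OF pos] by blast
  obtain gs where gs: "set gs \<subseteq> L2 M"
    "\<And>f. f \<in> H \<Longrightarrow> l2_norm M (S f) \<le> e / 2 * l2_norm M f + pairing_sum M gs f"
    using S(1) pos unfolding compactness_estimate_def by blast
  have "l2_norm M (T f) \<le> e * l2_norm M f + pairing_sum M gs f" if f: "f \<in> H" for f
    using S(2)[OF f] gs(2)[OF f] by simp
  then show "\<exists>gs. set gs \<subseteq> L2 M \<and> (\<forall>f\<in>H. l2_norm M (T f) \<le> e * l2_norm M f + pairing_sum M gs f)"
    using gs(1) by blast
qed

text \<open>Pairings of \<open>A f\<close> against a finite list become pairings of \<open>f\<close>
  against its image under an adjoint \<open>A'\<close>. This handles a bounded operator applied
  first; one applied last is handled by \<open>compactness_estimate_scaled\<close>.\<close>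

lemma compactness_estimate_comp:
  assumes S: "compactness_estimate M H S" and c: "c \<ge> 0"
    and A: "\<And>f. f \<in> H \<Longrightarrow> A f \<in> H" "\<And>f. f \<in> H \<Longrightarrow> l2_norm M (A f) \<le> c * l2_norm M f"
    and A': "\<And>g. g \<in> L2 M \<Longrightarrow> A' g \<in> L2 M"
      "\<And>f g. f \<in> H \<Longrightarrow> g \<in> L2 M \<Longrightarrow> l2_inner M (A f) g = l2_inner M f (A' g)"
  shows "compactness_estimate M H (\<lambda>f. S (A f))"
  unfolding compactness_estimate_def
proof (intro allI impI)
  fix e :: real assume e: "e > 0"
  have pos: "e / (c + 1) > 0" using e c by simp
  obtain gs where gs: "set gs \<subseteq> L2 M"
    "\<And>f. f \<in> H \<Longrightarrow> l2_norm M (S f) \<le> e / (c + 1) * l2_norm M f + pairing_sum M gs f"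
    using S pos unfolding compactness_estimate_def by blast
  have "l2_norm M (S (A f)) \<le> e * l2_norm M f + pairing_sum M (map A' gs) f" if f: "f \<in> H" for f
  proof -
    have "l2_norm M (S (A f)) \<le> e / (c + 1) * l2_norm M (A f) + pairing_sum M gs (A f)"
      by (rule gs(2)[OF A(1)[OF f]])
    also have "e / (c + 1) * l2_norm M (A f) \<le> e / (c + 1) * (c * l2_norm M f)"
      using pos by (intro mult_left_mono A(2)[OF f]) simp
    also have "\<dots> = c / (c + 1) * (e * l2_norm M f)" by simp
    also have "\<dots> \<le> 1 * (e * l2_norm M f)"
      using c e by (intro mult_right_mono) auto
    also have "pairing_sum M gs (A f) = pairing_sum M (map A' gs) f"
      using gs(1) by (auto simp: o_def A'(2)[OF f] subset_iff cong: map_cong)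
    finally show ?thesis by simp
  qed
  moreover have "set (map A' gs) \<subseteq> L2 M" using gs(1) A'(1) by auto
  ultimately show "\<exists>gs. set gs \<subseteq> L2 M \<and> (\<forall>f\<in>H. l2_norm M (S (A f)) \<le> e * l2_norm M f + pairing_sum M gs f)"
    by blast
qed

section \<open>Operators on representatives and almost-everywhere equality\<close>

context l2_closed_subspace
begin

lemma proj_dist_le:
  assumes "f \<in> L2 M" "g \<in> L2 M"
  shows "l2_norm M (\<lambda>x. P f x - P g x) \<le> l2_norm M (\<lambda>x. f x - g x)"
proof -
  have "AE x in M. P f x - P g x = P (\<lambda>x. f x - g x) x"
    using proj_diff[OF assms] by eventually_elim (rule sym)
  then have "l2_norm M (\<lambda>x. P f x - P g x) = l2_norm M (P (\<lambda>x. f x - g x))"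
    by (rule l2_norm_cong_AE[OF mem_measurable[OF diff_mem[OF proj_mem proj_mem]]
          mem_measurable[OF proj_mem[OF L2_diff]], OF assms assms])
  also have "\<dots> \<le> l2_norm M (\<lambda>x. f x - g x)" by (rule proj_norm_le[OF L2_diff[OF assms]])
  finally show ?thesis .
qed

lemma bounded_operator_diff_AE:
  assumes "l2_bounded_operator M H T" "f \<in> H" "g \<in> H"
  shows "AE x in M. T (\<lambda>y. f y - g y) x = T f x - T g x"
proof -
  have "AE x in M. T (\<lambda>y. 1 * f y + (-1) * g y) x = 1 * T f x + (-1) * T g x"
    using assms unfolding l2_bounded_operator_def by blast
  then show ?thesis by simp
qed

text \<open>Operators act on representatives, so replacing an argument by an equivalent one needs
  proof: the difference has norm 0, and boundedness gives its image norm 0. This is what makes a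
  product of two operators linear up to null sets.\<close>

lemma bounded_operator_cong_AE:
  assumes T: "l2_bounded_operator M H T" and fg: "f \<in> H" "g \<in> H" "AE x in M. f x = g x"
  shows "AE x in M. T f x = T g x"
proof -
  let ?d = "\<lambda>x. f x - g x"
  obtain C where C: "\<And>f. f \<in> H \<Longrightarrow> l2_norm M (T f) \<le> C * l2_norm M f" and Tm: "\<And>f. f \<in> H \<Longrightarrow> T f \<in> H"
    using T unfolding l2_bounded_operator_def by blast
  have "AE x in M. f x - g x = 0" using fg(3) by eventually_elim simp
  then have "l2_norm M ?d = 0"
    using l2_norm_eq_0_iff[OF mem_L2[OF diff_mem[OF fg(1,2)]]] by simp
  then have "l2_norm M (T ?d) = 0"
    using C[OF diff_mem[OF fg(1,2)]] l2_norm_nonneg[of M "T ?d"] by simp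
  then have "AE x in M. T ?d x = 0"
    using l2_norm_eq_0_iff[OF mem_L2[OF Tm[OF diff_mem[OF fg(1,2)]]]] by simp
  then show ?thesis using bounded_operator_diff_AE[OF T fg(1,2)] by eventually_elim simp
qed

text \<open>Meant for the adjoint, a value of the choice operator that is known only up to null
  sets.\<close>

lemma bounded_operator_cong:
  assumes T: "l2_bounded_operator M H T" and mem: "\<And>f. f \<in> H \<Longrightarrow> T' f \<in> H"
    and eq: "\<And>f. f \<in> H \<Longrightarrow> AE x in M. T' f x = T f x"
  shows "l2_bounded_operator M H T'"
  unfolding l2_bounded_operator_def
proof (intro conjI ballI allI)
  have Tm: "\<And>f. f \<in> H \<Longrightarrow> T f \<in> H" using T unfolding l2_bounded_operator_def by blast
  have nrm: "l2_norm M (T' f) = l2_norm M (T f)" if "f \<in> H" for f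
    by (rule l2_norm_cong_AE[OF mem_measurable[OF mem[OF that]] mem_measurable[OF Tm[OF that]] eq[OF that]])
  then show "\<exists>C. \<forall>f\<in>H. l2_norm M (T' f) \<le> C * l2_norm M f"
    using T unfolding l2_bounded_operator_def by simp
  fix f g a b assume fg: "f \<in> H" "g \<in> H"
  have "AE x in M. T (\<lambda>y. a * f y + b * g y) x = a * T f x + b * T g x"
    using T fg unfolding l2_bounded_operator_def by blast
  then show "AE x in M. T' (\<lambda>y. a * f y + b * g y) x = a * T' f x + b * T' g x"
    using eq[OF fg(1)] eq[OF fg(2)] eq[OF lin_mem[OF fg, of a b]] by eventually_elim simp
qed (rule mem)

lemma compact_commutator_if_estimate:
  assumes S: "l2_bounded_operator M H S" and T: "l2_bounded_operator M H T"
    and est: "compactness_estimate M H (op_commutator S T)"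
  shows "l2_compact_operator M H (op_commutator S T)"
proof (rule compact_if_estimate[OF _ _ est])
  have Sm: "\<And>f. f \<in> H \<Longrightarrow> S f \<in> H" and Tm: "\<And>f. f \<in> H \<Longrightarrow> T f \<in> H"
    using S T unfolding l2_bounded_operator_def by blast+
  show "op_commutator S T f \<in> H" if "f \<in> H" for f
    unfolding op_commutator_def using that by (intro diff_mem Sm Tm)
  fix f g a b assume fg: "f \<in> H" "g \<in> H"
  let ?u = "\<lambda>y. a * f y + b * g y"
  have lin: "AE x in M. R (R' ?u) x = a * R (R' f) x + b * R (R' g) x"
    if R: "l2_bounded_operator M H R" and R': "l2_bounded_operator M H R'" for R R'
  proof -
    have R'm: "R' f \<in> H" "R' g \<in> H" "R' ?u \<in> H"
      using R' fg lin_mem[OF fg] unfolding l2_bounded_operator_def by blast+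
    have "AE x in M. R' ?u x = a * R' f x + b * R' g x"
      using R' fg unfolding l2_bounded_operator_def by blast
    then have "AE x in M. R (R' ?u) x = R (\<lambda>x. a * R' f x + b * R' g x) x"
      using lin_mem[OF R'm(1,2)] by (intro bounded_operator_cong_AE[OF R R'm(3)])
    moreover have "AE x in M. R (\<lambda>x. a * R' f x + b * R' g x) x = a * R (R' f) x + b * R (R' g) x"
      using R R'm unfolding l2_bounded_operator_def by blast
    ultimately show ?thesis by eventually_elim simp
  qed
  show "AE x in M. op_commutator S T ?u x = a * op_commutator S T f x + b * op_commutator S T g x"
    using lin[OF S T] lin[OF T S] unfolding op_commutator_def
    by eventually_elim (simp add: algebra_simps)
qed

end

section \<open>The domain and its volume measure\<close>

text \<open>By Vitali's theorem an open set is a countable disjoint union of balls up to a null set,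
  and pulling back by an isometry turns each ball into one of the same radius, hence of the same
  volume. One inequality suffices, since the inverse isometry gives the other.\<close>

lemma emeasure_lborel_open_le_isometry:
  fixes R S :: "'a::euclidean_space \<Rightarrow> 'a"
  assumes U: "open U" and iso: "\<And>x y. dist (R x) (R y) = dist x y"
    and inv: "\<And>x. S (R x) = x" "\<And>x. R (S x) = x"
  shows "emeasure lborel U \<le> emeasure lborel (R -` U)"
proof -
  let ?K = "{(x, r). 0 < r \<and> ball x r \<subseteq> U}"
  have cont: "continuous_on UNIV R"
    unfolding continuous_on_iff using iso by auto
  have [measurable]: "R \<in> borel \<rightarrow>\<^sub>M borel"
    by (rule borel_measurable_continuous_onI[OF cont])
  have ball_vimage: "R -` ball x r = ball (S x) r" for x r
    using iso[of "S x"] inv by (auto simp: mem_ball)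
  obtain C where C: "countable C" "C \<subseteq> ?K"
    "pairwise (\<lambda>i j. disjnt (ball (fst i) (snd i)) (ball (fst j) (snd j))) C"
    "negligible (U - (\<Union>i\<in>C. ball (fst i) (snd i)))"
  proof (rule Vitali_covering_theorem_balls[of U ?K fst snd])
    fix x and d :: real assume x: "x \<in> U" "0 < d"
    then obtain e where e: "e > 0" "ball x e \<subseteq> U" using U open_contains_ball by blast
    have "ball x (min e (d / 2)) \<subseteq> U"
      using e(2) by (meson ball_min_Int dual_order.trans inf_le1 subset_ball min.cobounded1)
    then show "\<exists>i. i \<in> ?K \<and> x \<in> ball (fst i) (snd i) \<and> snd i < d"
      using x e by (intro exI[of _ "(x, min e (d / 2))"]) auto
  qed blast
  let ?B = "\<lambda>i. ball (fst i) (snd i)"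
  have disj: "disjoint_family_on ?B C"
    using C(3) by (auto simp: disjoint_family_on_def pairwise_def disjnt_def)
  have disj': "disjoint_family_on (\<lambda>i. R -` ?B i) C"
    using disj by (force simp: disjoint_family_on_def)
  have meas: "R -` ball x r \<in> sets lborel" for x r
    unfolding ball_vimage by simp
  have UB: "open (\<Union>i\<in>C. ?B i)" by blast
  \<comment> \<open>The covering theorem gives a null set of the completed measure; the remainder is
    a Borel set, so it is null for \<open>lborel\<close> as well.\<close>
  have null: "emeasure lborel (U - (\<Union>i\<in>C. ?B i)) = 0"
  proof -
    have "U - (\<Union>i\<in>C. ?B i) \<in> null_sets lebesgue" using C(4) by (simp add: negligible_iff_null_sets)
    moreover have "U - (\<Union>i\<in>C. ?B i) \<in> sets lborel" using U UB by (auto intro!: sets.Diff)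
    ultimately show ?thesis by (simp add: null_sets_def emeasure_completion main_part_sets)
  qed
  have "emeasure lborel U \<le> emeasure lborel ((\<Union>i\<in>C. ?B i) \<union> (U - (\<Union>i\<in>C. ?B i)))"
    using U UB by (intro emeasure_mono) (auto intro!: sets.Un sets.Diff)
  also have "\<dots> \<le> emeasure lborel (\<Union>i\<in>C. ?B i) + emeasure lborel (U - (\<Union>i\<in>C. ?B i))"
    using U UB by (intro emeasure_subadditive) (auto intro!: sets.Diff)
  also have "\<dots> = emeasure lborel (\<Union>i\<in>C. ?B i)" by (simp add: null)
  also have "\<dots> = (\<integral>\<^sup>+i. emeasure lborel (?B i) \<partial>count_space C)"
    using C(1) disj by (intro emeasure_UN_countable) auto
  also have "\<dots> = (\<integral>\<^sup>+i. emeasure lborel (R -` ?B i) \<partial>count_space C)"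
    using C(2) by (intro nn_integral_cong) (auto simp: ball_vimage emeasure_ball)
  also have "\<dots> = emeasure lborel (\<Union>i\<in>C. R -` ?B i)"
    using C(1) disj' meas by (intro emeasure_UN_countable[symmetric]) auto
  also have "\<dots> \<le> emeasure lborel (R -` U)"
  proof (intro emeasure_mono)
    show "(\<Union>i\<in>C. R -` ?B i) \<subseteq> R -` U" using C(2) by fastforce
    show "R -` U \<in> sets lborel"
      using open_vimage[OF U cont] by simp
  qed
  finally show ?thesis .
qed

text \<open>Lebesgue measure is determined by its values on boxes, which are open, so equality on
  open sets is enough.\<close>

lemma lborel_distr_isometry:
  fixes R S :: "'a::euclidean_space \<Rightarrow> 'a"
  assumes iso: "\<And>x y. dist (R x) (R y) = dist x y"
    and inv: "\<And>x. S (R x) = x" "\<And>x. R (S x) = x"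
  shows "distr lborel lborel R = lborel"
proof -
  have isoS: "dist (S x) (S y) = dist x y" for x y using iso[of "S x" "S y"] inv by simp
  have cont: "continuous_on UNIV R"
    unfolding continuous_on_iff using iso by auto
  have [measurable]: "R \<in> borel \<rightarrow>\<^sub>M borel"
    by (rule borel_measurable_continuous_onI[OF cont])
  have op: "emeasure lborel (R -` U) = emeasure lborel U" if "open U" for U
  proof (rule antisym)
    have "emeasure lborel (R -` U) \<le> emeasure lborel (S -` R -` U)"
      by (rule emeasure_lborel_open_le_isometry[OF open_vimage[OF that cont] isoS inv(2,1)])
    also have "S -` R -` U = U" using inv by auto
    finally show "emeasure lborel (R -` U) \<le> emeasure lborel U" .
    show "emeasure lborel U \<le> emeasure lborel (R -` U)"
      by (rule emeasure_lborel_open_le_isometry[OF that iso inv])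
  qed
  show ?thesis
  proof (rule lborel_eqI[symmetric])
    fix l u :: 'a assume "\<And>b. b \<in> Basis \<Longrightarrow> l \<bullet> b \<le> u \<bullet> b"
    then show "emeasure (distr lborel lborel R) (box l u) = (\<Prod>b\<in>Basis. (u - l) \<bullet> b)"
      by (simp add: emeasure_distr op open_box)
  qed simp
qed

text \<open>One map for three purposes: rotations of the torus (all \<open>w i\<close> of modulus
  1), motion along a single coordinate (\<open>coord_scale\<close>) and dilations (constant
  \<open>w\<close>).\<close>

definition scale_coords :: "('n \<Rightarrow> complex) \<Rightarrow> complex ^ 'n::finite \<Rightarrow> complex ^ 'n" where
  "scale_coords w z = (\<chi> i. w i * z $ i)"

lemma scale_coords_nth [simp]: "scale_coords w z $ i = w i * z $ i"
  by (simp add: scale_coords_def)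

lemma continuous_on_scale_coords [continuous_intros]: "continuous_on S (scale_coords w)"
  unfolding scale_coords_def by (intro continuous_intros)

lemma lborel_distr_scale_coords:
  assumes "\<And>i. cmod (w i) = 1"
  shows "distr lborel lborel (scale_coords w) = lborel"
proof (rule lborel_distr_isometry)
  fix x y
  have "cmod (w i * x $ i - w i * y $ i) = cmod (x $ i - y $ i)" for i
    using assms by (simp add: norm_mult flip: right_diff_distrib)
  then show "dist (scale_coords w x) (scale_coords w y) = dist x y"
    by (simp add: dist_vec_def dist_norm)
next
  have nz: "w i \<noteq> 0" for i using assms[of i] by auto
  fix x
  show "scale_coords (\<lambda>i. inverse (w i)) (scale_coords w x) = x"
    "scale_coords w (scale_coords (\<lambda>i. inverse (w i)) x) = x"
    using nz by (auto simp: vec_eq_iff)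
qed

definition lev :: "('n::finite \<Rightarrow> nat list) \<Rightarrow> complex ^ 'n \<Rightarrow> real" where
  "lev p z = (\<Sum>i\<in>UNIV. \<Sum>j<length (p i). cmod (z $ i) ^ (2 * (p i ! j)))"

lemma continuous_on_lev [continuous_intros]: "continuous_on S (lev p)"
  unfolding lev_def by (intro continuous_intros)

lemma lev_mono: "(\<And>i. cmod (w $ i) \<le> cmod (z $ i)) \<Longrightarrow> lev p w \<le> lev p z"
  unfolding lev_def by (intro sum_mono power_mono) auto

section \<open>Geometry of the closed domain and invariance of its measure\<close>

locale omega_domain =
  fixes p :: "'n::finite \<Rightarrow> nat list"
  assumes admissible: "admissible p"
begin

abbreviation K where "K \<equiv> closure (Omega p)"

lemma exponent_pos: "j < length (p i) \<Longrightarrow> p i ! j > 0"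
  using admissible nth_mem unfolding admissible_def by blast

lemma length_pos: "length (p i) > 0"
proof -
  have "length (p i) \<ge> 2" using admissible unfolding admissible_def by blast
  then show ?thesis by linarith
qed

lemma K_iff: "z \<in> K \<longleftrightarrow> lev p z \<le> 1"
  by (simp add: closure_Omega[OF admissible] lev_def)

lemma Omega_iff: "z \<in> Omega p \<longleftrightarrow> lev p z < 1"
  by (simp add: Omega_def lev_def)

lemma open_Omega: "open (Omega p)"
proof -
  have "Omega p = {z. lev p z < 1}" by (auto simp: Omega_iff)
  then show ?thesis by (auto intro!: open_Collect_less continuous_intros)
qed

lemma term_le_lev:
  assumes "j < length (p i)" shows "cmod (z $ i) ^ (2 * (p i ! j)) \<le> lev p z"
proof -
  have "cmod (z $ i) ^ (2 * (p i ! j)) \<le> (\<Sum>j<length (p i). cmod (z $ i) ^ (2 * (p i ! j)))"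
    by (rule member_le_sum[of j]) (use assms in auto)
  also have "\<dots> \<le> lev p z" unfolding lev_def
    by (rule member_le_sum[of i]) (auto intro: sum_nonneg)
  finally show ?thesis .
qed

lemma K_nth_le: assumes "z \<in> K" shows "cmod (z $ i) \<le> 1"
proof (rule ccontr)
  assume "\<not> ?thesis"
  then have "1 < cmod (z $ i) ^ (2 * (p i ! 0))"
    using exponent_pos[OF length_pos] by (intro one_less_power) auto
  then show False using term_le_lev[OF length_pos, of z i] assms K_iff by fastforce
qed

lemma K_mono: "z \<in> K \<Longrightarrow> (\<And>i. cmod (w $ i) \<le> cmod (z $ i)) \<Longrightarrow> w \<in> K"
  using lev_mono K_iff order_trans by metis

lemma scale_coords_mem_K:
  assumes "z \<in> K" "\<And>i. cmod (w i) \<le> 1" shows "scale_coords w z \<in> K"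
  using assms(2) by (intro K_mono[OF assms(1)]) (simp add: norm_mult mult_left_le_one_le)

lemma bounded_K: "bounded K"
proof -
  have "norm z \<le> real CARD('n)" if "z \<in> K" for z
  proof -
    have "norm z \<le> (\<Sum>i\<in>UNIV. norm (z $ i))" unfolding norm_vec_def by (rule L2_set_le_sum) auto
    also have "\<dots> \<le> (\<Sum>i\<in>(UNIV::'n set). 1)" using that by (intro sum_mono K_nth_le)
    finally show ?thesis by simp
  qed
  then show ?thesis unfolding bounded_iff by blast
qed

lemma compact_K: "compact K"
  using bounded_K by (simp add: compact_eq_bounded_closed)

lemma zero_mem_Omega: "0 \<in> Omega p"
proof -
  have "lev p 0 = 0"
    unfolding lev_def using exponent_pos by (intro sum.neutral ballI) (auto simp: power_0_left)
  then show ?thesis by (simp add: Omega_iff)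
qed

text \<open>Every summand of \<open>lev\<close> is an even power of the convex function
  \<open>cmod (z $ i)\<close>. Convexity later keeps combinations of a peak point with a small ball
  inside the domain.\<close>

lemma convex_K: "convex K"
proof -
  have cnv: "convex_on UNIV (\<lambda>z::complex^'n. cmod (z $ i) ^ (2 * (p i ! j)))" for i j
  proof -
    have "convex_on UNIV (\<lambda>z::complex^'n. cmod (z $ i))"
    proof (rule convex_onI)
      fix t :: real and x y :: "complex^'n" assume "0 < t" "t < 1"
      then show "cmod (((1 - t) *\<^sub>R x + t *\<^sub>R y) $ i) \<le> (1 - t) * cmod (x $ i) + t * cmod (y $ i)"
        using norm_triangle_ineq[of "(1 - t) *\<^sub>R (x $ i)" "t *\<^sub>R (y $ i)"] by simp
    qed simp
    note * = this
    show ?thesis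
    proof (rule convex_onI)
      fix t :: real and x y :: "complex^'n" assume t: "0 < t" "t < 1"
      have "cmod (((1 - t) *\<^sub>R x + t *\<^sub>R y) $ i) ^ (2 * (p i ! j))
        \<le> ((1 - t) * cmod (x $ i) + t * cmod (y $ i)) ^ (2 * (p i ! j))"
        using convex_onD[OF *, of t x y] t by (intro power_mono) auto
      also have "\<dots> \<le> (1 - t) * cmod (x $ i) ^ (2 * (p i ! j)) + t * cmod (y $ i) ^ (2 * (p i ! j))"
        using convex_onD[OF convex_power_even[of "2 * (p i ! j)"], of t "cmod (x $ i)" "cmod (y $ i)"] t
        by simp
      finally show "cmod (((1 - t) *\<^sub>R x + t *\<^sub>R y) $ i) ^ (2 * (p i ! j))
        \<le> (1 - t) * cmod (x $ i) ^ (2 * (p i ! j)) + t * cmod (y $ i) ^ (2 * (p i ! j))" .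
    qed simp
  qed
  have "lev p ((1 - t) *\<^sub>R x + t *\<^sub>R y) \<le> (1 - t) * lev p x + t * lev p y" if "0 \<le> t" "t \<le> 1" for t x y
    unfolding lev_def sum_distrib_left sum.distrib[symmetric]
    using that by (intro sum_mono convex_onD[OF cnv]) auto
  note lev_conv = this
  show ?thesis
  proof (rule convexI)
    fix x y and u v :: real assume *: "x \<in> K" "y \<in> K" "0 \<le> u" "0 \<le> v" "u + v = 1"
    then have u: "u = 1 - v" "v \<le> 1" by auto
    have "lev p (u *\<^sub>R x + v *\<^sub>R y) \<le> u * lev p x + v * lev p y"
      unfolding u(1) using * u(2) by (intro lev_conv)
    also have "\<dots> \<le> u * 1 + v * 1" using * by (intro add_mono mult_left_mono) (auto simp: K_iff)
    finally show "u *\<^sub>R x + v *\<^sub>R y \<in> K" using * by (simp add: K_iff)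
  qed
qed

lemma emeasure_K_finite: "emeasure lborel K \<noteq> \<infinity>"
  using emeasure_compact_finite[OF compact_K] by simp

lemma emeasure_K_pos: "emeasure lborel K \<noteq> 0"
proof -
  obtain r where r: "r > 0" "ball 0 r \<subseteq> Omega p"
    using open_Omega zero_mem_Omega open_contains_ball by blast
  have "0 < emeasure lborel (ball (0::complex^'n) r)"
    using r by (simp add: emeasure_ball)
  also have "\<dots> \<le> emeasure lborel K"
    using r closure_subset[of "Omega p"] by (intro emeasure_mono) auto
  finally show ?thesis by simp
qed

lemma space_nu [simp]: "space (nu p) = K"
  by (simp add: nu_def space_restrict_space)

lemma sets_nu: "sets (nu p) = sets (restrict_space borel K)"
  by (simp add: nu_def sets_restrict_space)

lemma emeasure_nu:
  assumes "A \<in> sets borel" "A \<subseteq> K"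
  shows "emeasure (nu p) A = emeasure lborel A / emeasure lborel K"
proof -
  have "A \<in> sets (restrict_space lborel K)" using assms by (auto simp: sets_restrict_space)
  moreover have "K \<inter> A = A" using assms by auto
  ultimately show ?thesis
    using assms unfolding nu_def
    by (subst emeasure_uniform_measure) (auto simp: emeasure_restrict_space sets_restrict_space)
qed

lemma finite_measure_nu: "finite_measure (nu p)"
  by (rule finite_measureI)
     (use emeasure_K_finite emeasure_K_pos in \<open>simp add: emeasure_nu ennreal_divide_eq_top_iff\<close>)

sublocale nu: finite_measure "nu p" by (rule finite_measure_nu)

lemma continuous_measurable: "continuous_on K f \<Longrightarrow> f \<in> borel_measurable (nu p)"
  using borel_measurable_continuous_on_restrict measurable_cong_sets[OF sets_nu refl] by blast

lemma continuous_bounded: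
  fixes f :: "complex ^ 'n \<Rightarrow> complex"
  assumes "continuous_on K f"
  obtains B where "B > 0" "\<And>z. z \<in> K \<Longrightarrow> cmod (f z) \<le> B"
proof -
  have "bounded (f ` K)" using compact_continuous_image[OF assms compact_K] compact_imp_bounded by blast
  then show thesis using that unfolding bounded_pos by auto
qed

lemma nu_L2I:
  assumes "f \<in> borel_measurable (nu p)" "\<And>z. z \<in> K \<Longrightarrow> cmod (f z) \<le> B"
  shows "f \<in> L2 (nu p)"
proof -
  have "integrable (nu p) (\<lambda>x. (cmod (f x))\<^sup>2)"
  proof (rule nu.integrable_const_bound)
    show "AE x in nu p. norm ((cmod (f x))\<^sup>2) \<le> B\<^sup>2"
      by (rule AE_I2) (use assms(2) in \<open>auto intro!: power_mono\<close>)
  qed (use assms(1) in measurable)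
  then show ?thesis using assms(1) by (simp add: L2_def)
qed

lemma continuous_L2: assumes "continuous_on K f" shows "f \<in> L2 (nu p)"
proof -
  obtain B where "\<And>z. z \<in> K \<Longrightarrow> cmod (f z) \<le> B" using continuous_bounded[OF assms] by blast
  then show ?thesis by (rule nu_L2I[OF continuous_measurable[OF assms]])
qed

lemma
  assumes f: "f \<in> L2 (nu p)" and g: "g \<in> borel_measurable (nu p)"
    and B: "\<And>z. z \<in> K \<Longrightarrow> cmod (g z) \<le> B"
  shows bounded_mult_L2: "(\<lambda>z. g z * f z) \<in> L2 (nu p)"
    and bounded_mult_norm: "l2_norm (nu p) (\<lambda>z. g z * f z) \<le> B * l2_norm (nu p) f"
proof -
  note [measurable] = L2_measurable[OF f] g
  have le: "(cmod (g z * f z))\<^sup>2 \<le> B\<^sup>2 * (cmod (f z))\<^sup>2" if "z \<in> K" for z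
    unfolding norm_mult power_mult_distrib using B[OF that] by (intro mult_right_mono power_mono) auto
  have int: "integrable (nu p) (\<lambda>z. B\<^sup>2 * (cmod (f z))\<^sup>2)"
    using L2_integrable_sq[OF f] by simp
  have int2: "integrable (nu p) (\<lambda>z. (cmod (g z * f z))\<^sup>2)"
    by (rule Bochner_Integration.integrable_bound[OF int]) (use le in \<open>auto intro!: AE_I2\<close>)
  then show "(\<lambda>z. g z * f z) \<in> L2 (nu p)" by (simp add: L2_def)
  have B0: "B \<ge> 0" using B[of 0] zero_mem_Omega closure_subset norm_ge_zero order_trans by blast
  have "(l2_norm (nu p) (\<lambda>z. g z * f z))\<^sup>2 \<le> (B * l2_norm (nu p) f)\<^sup>2"
    unfolding l2_norm_sq power_mult_distrib
    using integral_mono[OF int2 int] le by simp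
  then show "l2_norm (nu p) (\<lambda>z. g z * f z) \<le> B * l2_norm (nu p) f"
    by (rule power2_le_imp_le) (use B0 in simp)
qed

lemma l2_norm_le_sup:
  assumes "f \<in> borel_measurable (nu p)" "\<And>z. z \<in> K \<Longrightarrow> cmod (f z) \<le> B"
  shows "l2_norm (nu p) f \<le> B * l2_norm (nu p) (\<lambda>z. 1)"
  using bounded_mult_norm[OF continuous_L2[OF continuous_on_const], of f B 1] assms by simp

lemma distr_nu_scale_coords:
  assumes w: "\<And>i. cmod (w i) = 1"
  shows "distr (nu p) (nu p) (scale_coords w) = nu p"
proof (rule measure_eqI)
  have inK: "scale_coords w z \<in> K \<longleftrightarrow> z \<in> K" for z
    using w by (simp add: K_iff lev_def norm_mult)
  have [measurable]: "scale_coords w \<in> borel \<rightarrow>\<^sub>M borel"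
    by (intro borel_measurable_continuous_onI continuous_intros)
  have mb: "scale_coords w \<in> nu p \<rightarrow>\<^sub>M nu p"
    using measurable_restrict_space3[of "scale_coords w" borel borel K K] inK
    by (subst measurable_cong_sets[OF sets_nu sets_nu]) auto
  fix A assume "A \<in> sets (distr (nu p) (nu p) (scale_coords w))"
  then have A: "A \<in> sets borel" "A \<subseteq> K" "A \<in> sets (nu p)" by (auto simp: sets_nu sets_restrict_space)
  have pre: "scale_coords w -` A \<inter> K = scale_coords w -` A" using A(2) inK by auto
  have pre': "scale_coords w -` A \<in> sets borel"
    using measurable_sets_borel[of "scale_coords w" borel A] A(1) by simp
  have "emeasure (distr (nu p) (nu p) (scale_coords w)) A = emeasure (nu p) (scale_coords w -` A)"
    using A mb by (simp add: emeasure_distr pre)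
  also have "\<dots> = emeasure lborel (scale_coords w -` A) / emeasure lborel K"
    using pre pre' by (intro emeasure_nu) auto
  also have "emeasure lborel (scale_coords w -` A) = emeasure (distr lborel lborel (scale_coords w)) A"
    using A(1) by (simp add: emeasure_distr)
  also have "\<dots> = emeasure lborel A" by (simp add: lborel_distr_scale_coords w)
  also have "\<dots> / emeasure lborel K = emeasure (nu p) A"
    using A by (simp add: emeasure_nu)
  finally show "emeasure (distr (nu p) (nu p) (scale_coords w)) A = emeasure (nu p) A" .
qed simp

text \<open>The rotation preserves the measure, so the inner product equals \<open>c\<close> times
  itself.\<close>

lemma l2_inner_eq_0_if_rotation:
  assumes w: "\<And>i. cmod (w i) = 1"
    and f: "f \<in> borel_measurable (nu p)" and g: "g \<in> borel_measurable (nu p)"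
    and eq: "\<And>z. z \<in> K \<Longrightarrow> f (scale_coords w z) * cnj (g (scale_coords w z)) = c * (f z * cnj (g z))"
    and c: "c \<noteq> 1"
  shows "l2_inner (nu p) f g = 0"
proof -
  have mb: "scale_coords w \<in> nu p \<rightarrow>\<^sub>M nu p"
  proof -
    have "scale_coords w \<in> borel \<rightarrow>\<^sub>M borel"
      by (intro borel_measurable_continuous_onI continuous_intros)
    then show ?thesis
      using measurable_restrict_space3[of "scale_coords w" borel borel K K] scale_coords_mem_K w
      by (subst measurable_cong_sets[OF sets_nu sets_nu]) auto
  qed
  have "l2_inner (nu p) f g = integral\<^sup>L (distr (nu p) (nu p) (scale_coords w)) (\<lambda>z. f z * cnj (g z))"
    by (simp add: distr_nu_scale_coords[OF w] l2_inner_def)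
  also have "\<dots> = (LINT z|nu p. f (scale_coords w z) * cnj (g (scale_coords w z)))"
    using f g by (intro integral_distr mb borel_measurable_times borel_measurable_cnj)
  also have "\<dots> = (LINT z|nu p. c * (f z * cnj (g z)))"
    by (intro Bochner_Integration.integral_cong) (auto simp: eq)
  also have "\<dots> = c * l2_inner (nu p) f g" by (simp add: l2_inner_def)
  finally show ?thesis using c by simp
qed

end

section \<open>Hankel operators\<close>

lemma A_space_lin:
  assumes "f \<in> A_space p" "g \<in> A_space p"
  shows "(\<lambda>z. a * f z + b * g z) \<in> A_space p"
proof -
  have "\<exists>D. ((\<lambda>z. a * f z + b * g z) has_derivative D) (at z) \<and> (\<forall>c v. D (c *s v) = c * D v)"
    if z: "z \<in> Omega p" for z
  proof -
    obtain f' g' where f': "(f has_derivative f') (at z)" "\<forall>c v. f' (c *s v) = c * f' v"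
      and g': "(g has_derivative g') (at z)" "\<forall>c v. g' (c *s v) = c * g' v"
      using assms z unfolding A_space_def holomorphic_vec_on_def mem_Collect_eq by blast
    have "((\<lambda>z. a * f z + b * g z) has_derivative (\<lambda>v. a * f' v + b * g' v)) (at z)"
      by (intro has_derivative_add has_derivative_mult_right f' g')
    then show ?thesis
      using f'(2) g'(2) by (intro exI[of _ "\<lambda>v. a * f' v + b * g' v"]) (simp add: algebra_simps)
  qed
  moreover have "continuous_on (closure (Omega p)) (\<lambda>z. a * f z + b * g z)"
    using assms unfolding A_space_def by (intro continuous_intros) auto
  ultimately show ?thesis by (simp add: A_space_def holomorphic_vec_on_def)
qed

lemma A_space_const: "(\<lambda>z. a) \<in> A_space p"
  unfolding A_space_def holomorphic_vec_on_def by (auto intro!: exI[of _ "\<lambda>v. 0"])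

lemma A_space_mult:
  assumes "f \<in> A_space p" "g \<in> A_space p"
  shows "(\<lambda>z. f z * g z) \<in> A_space p"
proof -
  have "\<exists>D. ((\<lambda>z. f z * g z) has_derivative D) (at z) \<and> (\<forall>c v. D (c *s v) = c * D v)"
    if z: "z \<in> Omega p" for z
  proof -
    obtain f' g' where f': "(f has_derivative f') (at z)" "\<forall>c v. f' (c *s v) = c * f' v"
      and g': "(g has_derivative g') (at z)" "\<forall>c v. g' (c *s v) = c * g' v"
      using assms z unfolding A_space_def holomorphic_vec_on_def mem_Collect_eq by blast
    have "((\<lambda>z. f z * g z) has_derivative (\<lambda>v. f z * g' v + f' v * g z)) (at z)"
      by (intro has_derivative_mult f' g')
    then show ?thesis
      using f'(2) g'(2) by (intro exI[of _ "\<lambda>v. f z * g' v + f' v * g z"]) (simp add: algebra_simps)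
  qed
  moreover have "continuous_on (closure (Omega p)) (\<lambda>z. f z * g z)"
    using assms unfolding A_space_def by (intro continuous_intros) auto
  ultimately show ?thesis by (simp add: A_space_def holomorphic_vec_on_def)
qed

lemma A_space_coord:
  fixes p :: "'n::finite \<Rightarrow> nat list"
  shows "(\<lambda>z. z $ i) \<in> A_space p"
proof -
  have "((\<lambda>z. z $ i) has_derivative (\<lambda>v. v $ i)) (at z)" for z :: "complex ^ 'n"
    by (rule bounded_linear_imp_has_derivative[OF bounded_linear_vec_nth])
  then show ?thesis
    unfolding A_space_def holomorphic_vec_on_def
    by (auto intro!: exI[of _ "\<lambda>v. v $ i"] continuous_intros)
qed

context omega_domain
begin

abbreviation H where "H \<equiv> bergman p"

lemma A_space_L2: "f \<in> A_space p \<Longrightarrow> f \<in> L2 (nu p)"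
  by (auto simp: A_space_def intro: continuous_L2)

sublocale B: l2_closed_subspace "nu p" H
  unfolding bergman_def
  by (rule l2_closed_subspace_closure)
     (use A_space_L2 A_space_const A_space_lin in blast)+

lemma A_space_mem_H:
  assumes "f \<in> A_space p" shows "f \<in> H"
proof -
  have "\<exists>g\<in>A_space p. l2_norm (nu p) (\<lambda>z. f z - g z) < e" if "e > 0" for e
    using assms that by (intro bexI[of _ f]) auto
  then show ?thesis using A_space_L2[OF assms] by (simp add: bergman_def l2_closure_def)
qed

lemma H_approx:
  assumes "f \<in> H" "e > 0"
  obtains g where "g \<in> A_space p" "l2_norm (nu p) (\<lambda>z. f z - g z) < e"
  using assms unfolding bergman_def l2_closure_def by blast

lemma continuous_mult_L2:
  assumes "continuous_on K \<phi>" "f \<in> L2 (nu p)"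
  shows "(\<lambda>z. \<phi> z * f z) \<in> L2 (nu p)"
proof -
  obtain B where "\<And>z. z \<in> K \<Longrightarrow> cmod (\<phi> z) \<le> B" using continuous_bounded[OF assms(1)] by blast
  then show ?thesis by (rule bounded_mult_L2[OF assms(2) continuous_measurable[OF assms(1)]])
qed

lemma continuous_mult_bounded:
  assumes "continuous_on K \<phi>"
  obtains B where "B > 0" "\<And>f. f \<in> L2 (nu p) \<Longrightarrow> l2_norm (nu p) (\<lambda>z. \<phi> z * f z) \<le> B * l2_norm (nu p) f"
proof -
  obtain B where B: "B > 0" "\<And>z. z \<in> K \<Longrightarrow> cmod (\<phi> z) \<le> B" using continuous_bounded[OF assms] by blast
  show thesis by (rule that[OF B(1) bounded_mult_norm[OF _ continuous_measurable[OF assms] B(2)]])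
qed

text \<open>Multiplication by \<open>h\<close> preserves the algebra and is bounded in the norm, so
  it preserves the closure too.\<close>

lemma A_space_mult_mem_H:
  assumes h: "h \<in> A_space p" and f: "f \<in> H"
  shows "(\<lambda>z. h z * f z) \<in> H"
proof -
  have ch: "continuous_on K h" using h by (simp add: A_space_def)
  obtain B where B: "B > 0" "\<And>f. f \<in> L2 (nu p) \<Longrightarrow> l2_norm (nu p) (\<lambda>z. h z * f z) \<le> B * l2_norm (nu p) f"
    using continuous_mult_bounded[OF ch] by blast
  have "\<exists>g\<in>A_space p. l2_norm (nu p) (\<lambda>z. h z * f z - g z) < e" if e: "e > 0" for e
  proof -
    obtain g where g: "g \<in> A_space p" "l2_norm (nu p) (\<lambda>z. f z - g z) < e / B"
      using H_approx[OF f, of "e / B"] e B(1) by auto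
    have "l2_norm (nu p) (\<lambda>z. h z * (f z - g z)) \<le> B * l2_norm (nu p) (\<lambda>z. f z - g z)"
      by (rule B(2)[OF L2_diff[OF B.mem_L2[OF f] A_space_L2[OF g(1)]]])
    also have "\<dots> < e" using g(2) B(1) by (simp add: pos_less_divide_eq mult.commute)
    finally show ?thesis
      using A_space_mult[OF h g(1)] by (intro bexI) (simp_all add: algebra_simps)
  qed
  then show ?thesis
    using continuous_mult_L2[OF ch B.mem_L2[OF f]] by (simp add: bergman_def l2_closure_def)
qed

definition hankel :: "(complex ^ 'n \<Rightarrow> complex) \<Rightarrow> (complex ^ 'n \<Rightarrow> complex) \<Rightarrow> (complex ^ 'n \<Rightarrow> complex)" where
  "hankel \<phi> f = (\<lambda>z. \<phi> z * f z - B.P (\<lambda>z. \<phi> z * f z) z)"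

definition hankel_compact :: "(complex ^ 'n \<Rightarrow> complex) \<Rightarrow> bool" where
  "hankel_compact \<phi> \<longleftrightarrow> continuous_on K \<phi> \<and> compactness_estimate (nu p) H (hankel \<phi>)"

lemma hankel_L2: "continuous_on K \<phi> \<Longrightarrow> f \<in> L2 (nu p) \<Longrightarrow> hankel \<phi> f \<in> L2 (nu p)"
  unfolding hankel_def by (rule L2_diff[OF continuous_mult_L2 B.proj_L2[OF continuous_mult_L2]])

text \<open>Any member of \<open>H\<close> may replace the projection in an upper bound. The Hankel
  estimates that follow consist in choosing a convenient competitor \<open>h\<close>; the projection
  itself is never computed.\<close>

lemma hankel_best:
  assumes "continuous_on K \<phi>" "f \<in> L2 (nu p)" "h \<in> H"
  shows "l2_norm (nu p) (hankel \<phi> f) \<le> l2_norm (nu p) (\<lambda>z. \<phi> z * f z - h z)"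
  unfolding hankel_def by (rule B.proj_best[OF continuous_mult_L2[OF assms(1,2)] assms(3)])

lemma hankel_compact_holomorphic:
  assumes h: "h \<in> A_space p" shows "hankel_compact h"
proof -
  have ch: "continuous_on K h" using h by (simp add: A_space_def)
  have "l2_norm (nu p) (hankel h f) \<le> 0" if f: "f \<in> H" for f
    using hankel_best[OF ch B.mem_L2[OF f] A_space_mult_mem_H[OF h f]] by simp
  then have "compactness_estimate (nu p) H (hankel h)"
    unfolding compactness_estimate_def
    by (intro allI impI exI[of _ "[]"]) (simp add: order_trans[OF _ mult_nonneg_nonneg])
  then show ?thesis using ch by (simp add: hankel_compact_def)
qed

lemma hankel_compact_add:
  assumes "hankel_compact \<phi>" "hankel_compact \<psi>"
  shows "hankel_compact (\<lambda>z. \<phi> z + \<psi> z)"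
proof -
  have c: "continuous_on K \<phi>" "continuous_on K \<psi>" "continuous_on K (\<lambda>z. \<phi> z + \<psi> z)"
    using assms by (auto simp: hankel_compact_def intro: continuous_on_add)
  have "l2_norm (nu p) (hankel (\<lambda>z. \<phi> z + \<psi> z) f) \<le> l2_norm (nu p) (hankel \<phi> f) + l2_norm (nu p) (hankel \<psi> f)"
    if f: "f \<in> H" for f
  proof -
    note f2 = B.mem_L2[OF f]
    have "l2_norm (nu p) (hankel (\<lambda>z. \<phi> z + \<psi> z) f)
      \<le> l2_norm (nu p) (\<lambda>z. (\<phi> z + \<psi> z) * f z - (B.P (\<lambda>z. \<phi> z * f z) z + B.P (\<lambda>z. \<psi> z * f z) z))"
      by (rule hankel_best[OF c(3) f2 B.add_mem[OF B.proj_mem B.proj_mem]])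
         (rule continuous_mult_L2[OF _ f2], rule c)+
    also have "\<dots> = l2_norm (nu p) (\<lambda>z. hankel \<phi> f z + hankel \<psi> f z)"
      by (simp add: hankel_def algebra_simps)
    also have "\<dots> \<le> l2_norm (nu p) (hankel \<phi> f) + l2_norm (nu p) (hankel \<psi> f)"
      by (rule l2_norm_triangle[OF hankel_L2[OF c(1) f2] hankel_L2[OF c(2) f2]])
    finally show ?thesis .
  qed
  then show ?thesis
    using assms c compactness_estimate_add unfolding hankel_compact_def by blast
qed

text \<open>With the competitor P \<phi> P \<psi> f the error splits as \<open>hankel \<phi>\<close>
  applied to P \<psi> f plus \<phi> times \<open>hankel \<psi> f\<close>. The first part is a
  compact operator after a bounded one, whose adjoint is \<open>cnj \<psi>\<close> times the
  projection; the second is a bounded multiplication after a compact operator.\<close>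

lemma hankel_compact_mult:
  assumes "hankel_compact \<phi>" "hankel_compact \<psi>"
  shows "hankel_compact (\<lambda>z. \<phi> z * \<psi> z)"
proof -
  have c: "continuous_on K \<phi>" "continuous_on K \<psi>" "continuous_on K (\<lambda>z. \<phi> z * \<psi> z)"
    using assms by (auto simp: hankel_compact_def intro: continuous_on_mult)
  have cc: "continuous_on K (\<lambda>z. cnj (\<psi> z))" using c(2) by (intro continuous_intros)
  obtain b where b: "b > 0" "\<And>f. f \<in> L2 (nu p) \<Longrightarrow> l2_norm (nu p) (\<lambda>z. \<phi> z * f z) \<le> b * l2_norm (nu p) f"
    using continuous_mult_bounded[OF c(1)] by blast
  obtain b' where b': "b' > 0" "\<And>f. f \<in> L2 (nu p) \<Longrightarrow> l2_norm (nu p) (\<lambda>z. \<psi> z * f z) \<le> b' * l2_norm (nu p) f"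
    using continuous_mult_bounded[OF c(2)] by blast
  let ?A = "\<lambda>f. B.P (\<lambda>z. \<psi> z * f z)"
  have Amem: "?A f \<in> H" if "f \<in> H" for f
    by (rule B.proj_mem[OF continuous_mult_L2[OF c(2) B.mem_L2[OF that]]])
  have E1: "compactness_estimate (nu p) H (\<lambda>f. hankel \<phi> (?A f))"
  proof (rule compactness_estimate_comp[where c = b' and S = "hankel \<phi>" and A = ?A and A' = "\<lambda>g z. cnj (\<psi> z) * B.P g z"])
    show "compactness_estimate (nu p) H (hankel \<phi>)" using assms by (simp add: hankel_compact_def)
    show "b' \<ge> 0" using b' by simp
    show "l2_norm (nu p) (?A f) \<le> b' * l2_norm (nu p) f" if "f \<in> H" for f
      using B.proj_norm_le[OF continuous_mult_L2[OF c(2) B.mem_L2[OF that]]] b'(2)[OF B.mem_L2[OF that]]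
      by (rule order_trans)
    show "(\<lambda>z. cnj (\<psi> z) * B.P g z) \<in> L2 (nu p)" if "g \<in> L2 (nu p)" for g
      by (rule continuous_mult_L2[OF cc B.proj_L2[OF that]])
    show "l2_inner (nu p) (?A f) g = l2_inner (nu p) f (\<lambda>z. cnj (\<psi> z) * B.P g z)"
      if "f \<in> H" "g \<in> L2 (nu p)" for f g
    proof -
      have \<psi>f: "(\<lambda>z. \<psi> z * f z) \<in> L2 (nu p)" by (rule continuous_mult_L2[OF c(2) B.mem_L2[OF that(1)]])
      have "l2_inner (nu p) (?A f) g = l2_inner (nu p) (?A f) (B.P g)"
        by (rule B.proj_inner_right[OF that(2) B.proj_mem[OF \<psi>f], symmetric])
      also have "\<dots> = l2_inner (nu p) (\<lambda>z. \<psi> z * f z) (B.P g)"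
        by (rule B.proj_inner_left[OF \<psi>f B.proj_mem[OF that(2)]])
      also have "\<dots> = l2_inner (nu p) f (\<lambda>z. cnj (\<psi> z) * B.P g z)"
        by (simp add: l2_inner_def mult_ac)
      finally show ?thesis .
    qed
  qed (rule Amem)
  have E2: "compactness_estimate (nu p) H (\<lambda>f z. \<phi> z * hankel \<psi> f z)"
  proof (rule compactness_estimate_scaled[where c = b])
    show "compactness_estimate (nu p) H (hankel \<psi>)" using assms by (simp add: hankel_compact_def)
  qed (use b hankel_L2[OF c(2) B.mem_L2] in auto)
  have "l2_norm (nu p) (hankel (\<lambda>z. \<phi> z * \<psi> z) f)
      \<le> l2_norm (nu p) (hankel \<phi> (?A f)) + l2_norm (nu p) (\<lambda>z. \<phi> z * hankel \<psi> f z)" if f: "f \<in> H" for f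
  proof -
    note f2 = B.mem_L2[OF f] and A2 = B.mem_L2[OF Amem[OF f]]
    have "l2_norm (nu p) (hankel (\<lambda>z. \<phi> z * \<psi> z) f)
      \<le> l2_norm (nu p) (\<lambda>z. \<phi> z * \<psi> z * f z - B.P (\<lambda>z. \<phi> z * ?A f z) z)"
      by (rule hankel_best[OF c(3) f2 B.proj_mem[OF continuous_mult_L2[OF c(1) A2]]])
    also have "\<dots> = l2_norm (nu p) (\<lambda>z. hankel \<phi> (?A f) z + \<phi> z * hankel \<psi> f z)"
      by (simp add: hankel_def algebra_simps)
    also have "\<dots> \<le> l2_norm (nu p) (hankel \<phi> (?A f)) + l2_norm (nu p) (\<lambda>z. \<phi> z * hankel \<psi> f z)"
      by (rule l2_norm_triangle[OF hankel_L2[OF c(1) A2] continuous_mult_L2[OF c(1) hankel_L2[OF c(2) f2]]])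
    finally show ?thesis .
  qed
  then show ?thesis
    using c(3) compactness_estimate_add[OF E1 E2] by (auto simp: hankel_compact_def)
qed

lemma hankel_compact_limit:
  assumes c: "continuous_on K \<phi>"
    and ap: "\<And>e. e > 0 \<Longrightarrow> \<exists>\<psi>. hankel_compact \<psi> \<and> (\<forall>z\<in>K. cmod (\<phi> z - \<psi> z) \<le> e)"
  shows "hankel_compact \<phi>"
proof -
  have "\<exists>S. compactness_estimate (nu p) H S \<and>
      (\<forall>f\<in>H. l2_norm (nu p) (hankel \<phi> f) \<le> l2_norm (nu p) (S f) + e * l2_norm (nu p) f)" if e: "e > 0" for e
  proof -
    obtain \<psi> where \<psi>: "hankel_compact \<psi>" "\<And>z. z \<in> K \<Longrightarrow> cmod (\<phi> z - \<psi> z) \<le> e" using ap[OF e] by blast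
    have c\<psi>: "continuous_on K \<psi>" using \<psi> by (simp add: hankel_compact_def)
    have cd: "continuous_on K (\<lambda>z. \<phi> z - \<psi> z)" using c c\<psi> by (intro continuous_intros)
    have "l2_norm (nu p) (hankel \<phi> f) \<le> l2_norm (nu p) (hankel \<psi> f) + e * l2_norm (nu p) f" if f: "f \<in> H" for f
    proof -
      note f2 = B.mem_L2[OF f]
      have "l2_norm (nu p) (hankel \<phi> f) \<le> l2_norm (nu p) (\<lambda>z. \<phi> z * f z - B.P (\<lambda>z. \<psi> z * f z) z)"
        by (rule hankel_best[OF c f2 B.proj_mem[OF continuous_mult_L2[OF c\<psi> f2]]])
      also have "\<dots> = l2_norm (nu p) (\<lambda>z. hankel \<psi> f z + (\<phi> z - \<psi> z) * f z)"
        by (simp add: hankel_def algebra_simps)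
      also have "\<dots> \<le> l2_norm (nu p) (hankel \<psi> f) + l2_norm (nu p) (\<lambda>z. (\<phi> z - \<psi> z) * f z)"
        by (rule l2_norm_triangle[OF hankel_L2[OF c\<psi> f2] continuous_mult_L2[OF cd f2]])
      also have "l2_norm (nu p) (\<lambda>z. (\<phi> z - \<psi> z) * f z) \<le> e * l2_norm (nu p) f"
        by (rule bounded_mult_norm[OF f2 continuous_measurable[OF cd] \<psi>(2)])
      finally show ?thesis by simp
    qed
    then show ?thesis using \<psi>(1) unfolding hankel_compact_def by blast
  qed
  then show ?thesis using c compactness_estimate_limit unfolding hankel_compact_def by blast
qed

lemma hankel_compact_const: "hankel_compact (\<lambda>z. a)"
  by (rule hankel_compact_holomorphic[OF A_space_const])

lemma hankel_compact_sum: "(\<And>i. i \<in> A \<Longrightarrow> hankel_compact (\<phi> i)) \<Longrightarrow> hankel_compact (\<lambda>z. \<Sum>i\<in>A. \<phi> i z)"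
  by (induction A rule: infinite_finite_induct) (auto intro: hankel_compact_add hankel_compact_const)

lemma real_linear_complex_form:
  "complex_of_real (Re w * u + Im w * v)
    = (of_real u - \<i> * of_real v) / 2 * w + (of_real u + \<i> * of_real v) / 2 * cnj w"
proof -
  have "(of_real u - \<i> * of_real v) / 2 * w + (of_real u + \<i> * of_real v) / 2 * cnj w
    = of_real u * ((w + cnj w) / 2) - \<i> * of_real v * ((w - cnj w) / 2)"
    by (simp add: field_simps)
  also have "\<dots> = of_real u * of_real (Re w) - \<i> * of_real v * (\<i> * of_real (Im w))"
    by (simp add: complex_add_cnj complex_diff_cnj)
  also have "\<dots> = complex_of_real (Re w * u + Im w * v)" by (simp add: mult_ac flip: mult.assoc[of \<i> \<i>])
  finally show ?thesis by (rule sym)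
qed

text \<open>The polynomial functions of the Stone-Weierstrass theorem are generated by real-linear
  functionals, and each of these is a complex combination of the coordinates and their
  conjugates.\<close>

lemma hankel_compact_real_linear:
  assumes cnj: "\<And>j. hankel_compact (\<lambda>z. cnj (z $ j))" and L: "bounded_linear (L :: complex ^ 'n \<Rightarrow> real)"
  shows "hankel_compact (\<lambda>z. of_real (L z))"
proof -
  interpret L: bounded_linear L by (rule L)
  have exp: "L z = (\<Sum>i\<in>UNIV. Re (z $ i) * L (axis i 1) + Im (z $ i) * L (axis i \<i>))" for z
  proof -
    have "z = (\<Sum>i\<in>UNIV. Re (z $ i) *\<^sub>R axis i 1 + Im (z $ i) *\<^sub>R axis i \<i>)"
    proof (rule vec_eq_iff[THEN iffD2], rule allI)
      fix k
      have "(Re (z $ i) *\<^sub>R axis i 1 + Im (z $ i) *\<^sub>R axis i \<i>) $ k = (if i = k then z $ k else 0)" for i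
        by (auto simp: axis_def complex_eq_iff)
      then have "(\<Sum>i\<in>UNIV. (Re (z $ i) *\<^sub>R axis i 1 + Im (z $ i) *\<^sub>R axis i \<i>) $ k) = (\<Sum>i\<in>UNIV. if i = k then z $ k else 0)"
        by (rule sum.cong[OF refl])
      also have "\<dots> = z $ k" by simp
      finally show "z $ k = (\<Sum>i\<in>UNIV. Re (z $ i) *\<^sub>R axis i 1 + Im (z $ i) *\<^sub>R axis i \<i>) $ k"
        unfolding sum_component by (rule sym)
    qed
    then have "L z = L (\<Sum>i\<in>UNIV. Re (z $ i) *\<^sub>R axis i 1 + Im (z $ i) *\<^sub>R axis i \<i>)" by (rule arg_cong)
    also have "\<dots> = (\<Sum>i\<in>UNIV. Re (z $ i) * L (axis i 1) + Im (z $ i) * L (axis i \<i>))"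
      by (simp add: L.sum L.add L.scaleR)
    finally show ?thesis .
  qed
  define a where "a i = (of_real (L (axis i 1)) - \<i> * of_real (L (axis i \<i>))) / 2" for i
  define b where "b i = (of_real (L (axis i 1)) + \<i> * of_real (L (axis i \<i>))) / 2" for i
  have "of_real (L z) = (\<Sum>i\<in>UNIV. a i * z $ i + b i * cnj (z $ i))" for z
    unfolding exp[of z] of_real_sum a_def b_def
    by (rule sum.cong[OF refl]) (rule real_linear_complex_form)
  then have eq: "(\<lambda>z. of_real (L z)) = (\<lambda>z. \<Sum>i\<in>UNIV. a i * z $ i + b i * cnj (z $ i))" by (rule ext)
  show ?thesis unfolding eq
    by (intro hankel_compact_sum hankel_compact_add hankel_compact_mult hankel_compact_const cnj
        hankel_compact_holomorphic[OF A_space_coord])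
qed

lemma hankel_compact_continuous:
  assumes cnj: "\<And>j. hankel_compact (\<lambda>z. cnj (z $ j))" and \<phi>: "continuous_on K \<phi>"
  shows "hankel_compact \<phi>"
proof (rule hankel_compact_limit[OF \<phi>])
  fix e :: real assume e: "e > 0"
  have poly: "hankel_compact (\<lambda>z. of_real (r z))" if "real_polynomial_function r" for r :: "complex ^ 'n \<Rightarrow> real"
    using that
  proof (induction rule: real_polynomial_function.induct)
    case (linear f)
    then show ?case by (rule hankel_compact_real_linear[OF cnj])
  next
    case (const c)
    show ?case by (rule hankel_compact_const)
  next
    case (add f g)
    then show ?case using hankel_compact_add by simp
  next
    case (mult f g)
    then show ?case using hankel_compact_mult by simp
  qed
  obtain g where g: "polynomial_function g" "\<forall>z\<in>K. norm (\<phi> z - g z) < e"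
    using Stone_Weierstrass_polynomial_function[OF compact_K \<phi> e] by blast
  have "real_polynomial_function (\<lambda>z. Re (g z))" "real_polynomial_function (\<lambda>z. Im (g z))"
    using g(1) bounded_linear_Re bounded_linear_Im unfolding polynomial_function_def o_def by blast+
  then have "hankel_compact (\<lambda>z. of_real (Re (g z)) + \<i> * of_real (Im (g z)))"
    by (intro hankel_compact_add hankel_compact_mult hankel_compact_const poly)
  then have "hankel_compact g" by (simp flip: complex_eq)
  then show "\<exists>\<psi>. hankel_compact \<psi> \<and> (\<forall>z\<in>K. cmod (\<phi> z - \<psi> z) \<le> e)"
    using g(2) less_imp_le by blast
qed

section \<open>Toeplitz operators and their commutators\<close>

lemma bounded_operator_toeplitz:
  assumes \<phi>: "continuous_on K \<phi>"
  shows "l2_bounded_operator (nu p) H (toeplitz p \<phi>)"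
  unfolding l2_bounded_operator_def
proof (intro conjI ballI allI)
  note m = continuous_mult_L2[OF \<phi> B.mem_L2]
  show "toeplitz p \<phi> f \<in> H" if "f \<in> H" for f
    unfolding toeplitz_def by (rule B.proj_mem[OF m[OF that]])
  obtain b where b: "b > 0" "\<And>f. f \<in> L2 (nu p) \<Longrightarrow> l2_norm (nu p) (\<lambda>z. \<phi> z * f z) \<le> b * l2_norm (nu p) f"
    using continuous_mult_bounded[OF \<phi>] by blast
  have "l2_norm (nu p) (toeplitz p \<phi> f) \<le> b * l2_norm (nu p) f" if "f \<in> H" for f
    unfolding toeplitz_def
    using B.proj_norm_le[OF m[OF that]] b(2)[OF B.mem_L2[OF that]] by (rule order_trans)
  then show "\<exists>C. \<forall>f\<in>H. l2_norm (nu p) (toeplitz p \<phi> f) \<le> C * l2_norm (nu p) f" by blast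
  fix f g a b assume fg: "f \<in> H" "g \<in> H"
  show "AE x in nu p. toeplitz p \<phi> (\<lambda>y. a * f y + b * g y) x = a * toeplitz p \<phi> f x + b * toeplitz p \<phi> g x"
    using B.proj_lin[OF m[OF fg(1)] m[OF fg(2)], of a b] unfolding toeplitz_def by (simp add: algebra_simps)
qed

lemma compact_toeplitz_commutator:
  assumes \<phi>: "hankel_compact \<phi>" and \<psi>: "hankel_compact \<psi>"
  shows "l2_compact_operator (nu p) H (op_commutator (toeplitz p \<phi>) (toeplitz p \<psi>))"
proof (rule B.compact_commutator_if_estimate)
  have c: "continuous_on K \<phi>" "continuous_on K \<psi>" using assms by (auto simp: hankel_compact_def)
  show "l2_bounded_operator (nu p) H (toeplitz p \<phi>)" "l2_bounded_operator (nu p) H (toeplitz p \<psi>)"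
    by (rule bounded_operator_toeplitz[OF c(1)], rule bounded_operator_toeplitz[OF c(2)])
  have E: "compactness_estimate (nu p) H (\<lambda>f z. \<alpha> z * hankel \<beta> f z)"
    if \<alpha>: "continuous_on K \<alpha>" and \<beta>: "hankel_compact \<beta>" for \<alpha> \<beta>
  proof -
    obtain b where b: "b > 0" "\<And>f. f \<in> L2 (nu p) \<Longrightarrow> l2_norm (nu p) (\<lambda>z. \<alpha> z * f z) \<le> b * l2_norm (nu p) f"
      using continuous_mult_bounded[OF \<alpha>] by blast
    have c\<beta>: "continuous_on K \<beta>" and E\<beta>: "compactness_estimate (nu p) H (hankel \<beta>)"
      using \<beta> by (auto simp: hankel_compact_def)
    show ?thesis
      by (rule compactness_estimate_scaled[OF E\<beta>, of b]) (use b hankel_L2[OF c\<beta> B.mem_L2] in auto)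
  qed
  show "compactness_estimate (nu p) H (op_commutator (toeplitz p \<phi>) (toeplitz p \<psi>))"
  proof (rule compactness_estimate_add[OF E[OF c(1) \<psi>] E[OF c(2) \<phi>]])
    fix f assume f: "f \<in> H"
    note f2 = B.mem_L2[OF f]
    have m: "(\<lambda>z. \<alpha> z * B.P (\<lambda>z. \<beta> z * f z) z) \<in> L2 (nu p)" "(\<lambda>z. \<alpha> z * (\<beta> z * f z)) \<in> L2 (nu p)"
      if "continuous_on K \<alpha>" "continuous_on K \<beta>" for \<alpha> \<beta>
      by (rule continuous_mult_L2[OF that(1) B.proj_L2[OF continuous_mult_L2[OF that(2) f2]]],
          rule continuous_mult_L2[OF that(1) continuous_mult_L2[OF that(2) f2]])
    have part: "l2_norm (nu p) (\<lambda>z. B.P (\<lambda>z. \<alpha> z * B.P (\<lambda>z. \<beta> z * f z) z) z - B.P (\<lambda>z. \<alpha> z * (\<beta> z * f z)) z)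
      \<le> l2_norm (nu p) (\<lambda>z. \<alpha> z * hankel \<beta> f z)"
      if "continuous_on K \<alpha>" "continuous_on K \<beta>" for \<alpha> \<beta>
    proof -
      have "l2_norm (nu p) (\<lambda>z. B.P (\<lambda>z. \<alpha> z * B.P (\<lambda>z. \<beta> z * f z) z) z - B.P (\<lambda>z. \<alpha> z * (\<beta> z * f z)) z)
        \<le> l2_norm (nu p) (\<lambda>z. \<alpha> z * B.P (\<lambda>z. \<beta> z * f z) z - \<alpha> z * (\<beta> z * f z))"
        by (rule B.proj_dist_le[OF m[OF that]])
      also have "\<dots> = l2_norm (nu p) (\<lambda>z. \<alpha> z * (\<beta> z * f z) - \<alpha> z * B.P (\<lambda>z. \<beta> z * f z) z)"
        by (rule l2_norm_minus_commute)
      also have "\<dots> = l2_norm (nu p) (\<lambda>z. \<alpha> z * hankel \<beta> f z)"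
        by (simp add: hankel_def right_diff_distrib)
      finally show ?thesis .
    qed
    let ?a = "B.P (\<lambda>z. \<phi> z * B.P (\<lambda>z. \<psi> z * f z) z)" and ?b = "B.P (\<lambda>z. \<psi> z * B.P (\<lambda>z. \<phi> z * f z) z)"
    \<comment> \<open>The projection of \<phi> \<psi> f is common to both products. Comparing each
      product with it costs one Hankel operator, because the projection does not increase
      distances.\<close>
    let ?c = "B.P (\<lambda>z. \<phi> z * (\<psi> z * f z))"
    have c_eq: "?c = B.P (\<lambda>z. \<psi> z * (\<phi> z * f z))" by (simp add: mult.left_commute)
    have "l2_norm (nu p) (op_commutator (toeplitz p \<phi>) (toeplitz p \<psi>) f) = l2_norm (nu p) (\<lambda>z. ?a z - ?b z)"
      by (simp add: op_commutator_def toeplitz_def)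
    also have "\<dots> \<le> l2_norm (nu p) (\<lambda>z. ?a z - ?c z) + l2_norm (nu p) (\<lambda>z. ?c z - ?b z)"
      by (rule l2_dist_triangle[OF B.proj_L2[OF m(1)] B.proj_L2[OF m(2)] B.proj_L2[OF m(1)]]) (rule c)+
    also have "l2_norm (nu p) (\<lambda>z. ?c z - ?b z) = l2_norm (nu p) (\<lambda>z. ?b z - ?c z)"
      by (rule l2_norm_minus_commute)
    also have "l2_norm (nu p) (\<lambda>z. ?a z - ?c z) \<le> l2_norm (nu p) (\<lambda>z. \<phi> z * hankel \<psi> f z)"
      by (rule part[OF c])
    also have "l2_norm (nu p) (\<lambda>z. ?b z - ?c z) \<le> l2_norm (nu p) (\<lambda>z. \<psi> z * hankel \<phi> f z)"
      unfolding c_eq by (rule part[OF c(2,1)])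
    finally show "l2_norm (nu p) (op_commutator (toeplitz p \<phi>) (toeplitz p \<psi>) f)
      \<le> l2_norm (nu p) (\<lambda>z. \<phi> z * hankel \<psi> f z) + l2_norm (nu p) (\<lambda>z. \<psi> z * hankel \<phi> f z)" by simp
  qed
qed

section \<open>Coordinate multiplications and their adjoints\<close>

lemma continuous_on_coord: "continuous_on K (\<lambda>z. z $ i)" "continuous_on K (\<lambda>z. cnj (z $ i))"
  by (intro continuous_intros)+

lemma coord_mult_mem_H: "f \<in> H \<Longrightarrow> coord_mult i f \<in> H"
  unfolding coord_mult_def by (rule A_space_mult_mem_H[OF A_space_coord])

lemma coord_mult_norm_le: "f \<in> L2 (nu p) \<Longrightarrow> l2_norm (nu p) (\<lambda>z. z $ i * f z) \<le> l2_norm (nu p) f"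
  using bounded_mult_norm[OF _ continuous_measurable[OF continuous_on_coord(1)] K_nth_le] by simp

lemma bounded_operator_coord_mult: "l2_bounded_operator (nu p) H (coord_mult i)"
  unfolding l2_bounded_operator_def
proof (intro conjI ballI allI)
  show "\<exists>C. \<forall>f\<in>H. l2_norm (nu p) (coord_mult i f) \<le> C * l2_norm (nu p) f"
    using coord_mult_norm_le[OF B.mem_L2] unfolding coord_mult_def by (intro exI[of _ 1]) simp
  show "coord_mult i f \<in> H" if "f \<in> H" for f using that by (rule coord_mult_mem_H)
  fix f g a b
  have "coord_mult i (\<lambda>y. a * f y + b * g y) x = a * coord_mult i f x + b * coord_mult i g x" for x
    by (simp add: coord_mult_def algebra_simps)
  then show "AE x in nu p. coord_mult i (\<lambda>y. a * f y + b * g y) x = a * coord_mult i f x + b * coord_mult i g x"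
    by simp
qed

text \<open>The Toeplitz operator of the conjugate coordinate satisfies the condition defining the
  adjoint. So the choice has a witness, and whatever it picks agrees with this operator outside a
  null set.\<close>

lemma
  assumes g: "g \<in> H"
  shows adjoint_coord_mult_mem: "l2_adjoint (nu p) H (coord_mult i) g \<in> H"
    and adjoint_coord_mult_AE: "AE z in nu p. l2_adjoint (nu p) H (coord_mult i) g z = toeplitz p (\<lambda>z. cnj (z $ i)) g z"
proof -
  have m: "(\<lambda>z. cnj (z $ i) * g z) \<in> L2 (nu p)"
    by (rule continuous_mult_L2[OF continuous_on_coord(2) B.mem_L2[OF g]])
  have T: "toeplitz p (\<lambda>z. cnj (z $ i)) g \<in> H" unfolding toeplitz_def by (rule B.proj_mem[OF m])
  have eq: "l2_inner (nu p) (coord_mult i f) g = l2_inner (nu p) f (toeplitz p (\<lambda>z. cnj (z $ i)) g)" if "f \<in> H" for f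
  proof -
    have "l2_inner (nu p) f (toeplitz p (\<lambda>z. cnj (z $ i)) g) = l2_inner (nu p) f (\<lambda>z. cnj (z $ i) * g z)"
      unfolding toeplitz_def by (rule B.proj_inner_right[OF m that])
    also have "\<dots> = l2_inner (nu p) (coord_mult i f) g"
      by (simp add: l2_inner_def coord_mult_def mult_ac)
    finally show ?thesis by simp
  qed
  let ?A = "l2_adjoint (nu p) H (coord_mult i) g"
  have A: "?A \<in> H \<and> (\<forall>f\<in>H. l2_inner (nu p) (coord_mult i f) g = l2_inner (nu p) f ?A)"
    unfolding l2_adjoint_def by (rule someI[of _ "toeplitz p (\<lambda>z. cnj (z $ i)) g"]) (use T eq in blast)
  then show "?A \<in> H" by blast
  show "AE z in nu p. ?A z = toeplitz p (\<lambda>z. cnj (z $ i)) g z"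
  proof (rule B.eq_AE_if_inner_eq[OF _ T])
    fix h assume "h \<in> H"
    then have "cnj (l2_inner (nu p) h ?A) = cnj (l2_inner (nu p) h (toeplitz p (\<lambda>z. cnj (z $ i)) g))"
      using A eq by simp
    then show "l2_inner (nu p) ?A h = l2_inner (nu p) (toeplitz p (\<lambda>z. cnj (z $ i)) g) h"
      by (simp only: l2_inner_cnj)
  qed (use A in blast)
qed

text \<open>Since z_j P(conj(z_i) f) already lies in \<open>H\<close>, it may be put under the
  projection. The commutator then becomes the projection of z_j times the Hankel operator of
  conj(z_i), up to null sets, and \<open>cmod (z $ j)\<close> is at most 1. A single Hankel operator
  therefore dominates it.\<close>

lemma essentially_normal_coord_mult:
  assumes cnj: "\<And>j. hankel_compact (\<lambda>z. cnj (z $ j))"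
  shows "essentially_normal (nu p) H (coord_mult :: 'n \<Rightarrow> _)"
  unfolding essentially_normal_def
proof (intro conjI allI ballI)
  fix i j :: 'n
  show "l2_bounded_operator (nu p) H (coord_mult i)" by (rule bounded_operator_coord_mult)
  show "AE x in nu p. coord_mult i (coord_mult j f) x = coord_mult j (coord_mult i f) x" for f
    by (simp add: coord_mult_def mult.left_commute)
  let ?A = "l2_adjoint (nu p) H (coord_mult i)"
  note ci = continuous_on_coord(2)[of i]
  have A: "l2_bounded_operator (nu p) H ?A"
    by (rule B.bounded_operator_cong[OF bounded_operator_toeplitz[OF ci] adjoint_coord_mult_mem adjoint_coord_mult_AE])
  show "l2_compact_operator (nu p) H (op_commutator ?A (coord_mult j))"
  proof (rule B.compact_commutator_if_estimate[OF A bounded_operator_coord_mult])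
    have E: "compactness_estimate (nu p) H (hankel (\<lambda>z. cnj (z $ i)))"
      using cnj by (simp add: hankel_compact_def)
    show "compactness_estimate (nu p) H (op_commutator ?A (coord_mult j))"
    proof (rule compactness_estimate_scaled[OF E zero_le_one])
      fix f assume f: "f \<in> H"
      note f2 = B.mem_L2[OF f]
      let ?g = "\<lambda>z. cnj (z $ i) * f z"
      have g: "?g \<in> L2 (nu p)" by (rule continuous_mult_L2[OF ci f2])
      have zg: "(\<lambda>z. z $ j * ?g z) \<in> L2 (nu p)" by (rule continuous_mult_L2[OF continuous_on_coord(1) g])
      have zPg: "(\<lambda>z. z $ j * B.P ?g z) \<in> H" by (rule A_space_mult_mem_H[OF A_space_coord B.proj_mem[OF g]])
      have "AE z in nu p. ?A (coord_mult j f) z = B.P (\<lambda>z. z $ j * ?g z) z"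
        using adjoint_coord_mult_AE[OF coord_mult_mem_H[OF f], of i]
        by (simp add: toeplitz_def coord_mult_def mult.left_commute)
      moreover have "AE z in nu p. coord_mult j (?A f) z = z $ j * B.P ?g z"
        using adjoint_coord_mult_AE[OF f, of i]
        by eventually_elim (simp add: toeplitz_def coord_mult_def)
      moreover have "AE z in nu p. B.P (\<lambda>z. z $ j * B.P ?g z) z = z $ j * B.P ?g z"
        by (rule B.proj_ident[OF zPg])
      ultimately have eq: "AE z in nu p. op_commutator ?A (coord_mult j) f z
          = B.P (\<lambda>z. z $ j * ?g z) z - B.P (\<lambda>z. z $ j * B.P ?g z) z"
        by eventually_elim (simp add: op_commutator_def)
      have mem: "op_commutator ?A (coord_mult j) f \<in> H"
        unfolding op_commutator_def
        by (rule B.diff_mem[OF adjoint_coord_mult_mem[OF coord_mult_mem_H[OF f]]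
              coord_mult_mem_H[OF adjoint_coord_mult_mem[OF f]]])
      have "l2_norm (nu p) (op_commutator ?A (coord_mult j) f)
        = l2_norm (nu p) (\<lambda>z. B.P (\<lambda>z. z $ j * ?g z) z - B.P (\<lambda>z. z $ j * B.P ?g z) z)"
        by (rule l2_norm_cong_AE[OF B.mem_measurable[OF mem]
              B.mem_measurable[OF B.diff_mem[OF B.proj_mem[OF zg] B.proj_mem[OF B.mem_L2[OF zPg]]]] eq])
      also have "\<dots> \<le> l2_norm (nu p) (\<lambda>z. z $ j * ?g z - z $ j * B.P ?g z)"
        by (rule B.proj_dist_le[OF zg B.mem_L2[OF zPg]])
      also have "\<dots> = l2_norm (nu p) (\<lambda>z. z $ j * hankel (\<lambda>z. cnj (z $ i)) f z)"
        by (simp add: hankel_def right_diff_distrib)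
      also have "\<dots> \<le> l2_norm (nu p) (hankel (\<lambda>z. cnj (z $ i)) f)"
        by (rule coord_mult_norm_le[OF hankel_L2[OF ci f2]])
      finally show "l2_norm (nu p) (op_commutator ?A (coord_mult j) f)
        \<le> 1 * l2_norm (nu p) (hankel (\<lambda>z. cnj (z $ i)) f)" by simp
    qed
  qed
qed

end

section \<open>Density of the polynomials\<close>

abbreviation coord_scale :: "'n \<Rightarrow> complex \<Rightarrow> complex ^ 'n::finite \<Rightarrow> complex ^ 'n" where
  "coord_scale i l \<equiv> scale_coords ((\<lambda>_. 1)(i := l))"

lemma coord_scale_nth: "coord_scale i l z $ k = (if k = i then l * z $ k else z $ k)"
  by simp

lemma coord_scale_same: "coord_scale i l (coord_scale i m z) = coord_scale i (l * m) z"
  by (simp add: vec_eq_iff)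

lemma scale_coords_commute: "scale_coords v (scale_coords w z) = scale_coords w (scale_coords v z)"
  by (simp add: vec_eq_iff)

lemma coord_scale_has_derivative:
  "((\<lambda>l. coord_scale i l z) has_derivative (\<lambda>h. h *s axis i (z $ i))) (at l)"
proof -
  have "linear (\<lambda>h. h *s axis i (z $ i))"
    by (rule linearI) (auto simp: vec_eq_iff algebra_simps)
  then have bl: "bounded_linear (\<lambda>h. h *s axis i (z $ i))"
    by (simp add: linear_conv_bounded_linear)
  have eq: "(\<lambda>l. coord_scale i l z) = (\<lambda>l. coord_scale i 0 z + l *s axis i (z $ i))"
    by (auto simp: fun_eq_iff vec_eq_iff axis_def)
  have "((\<lambda>l. coord_scale i 0 z + l *s axis i (z $ i)) has_derivative (\<lambda>h. 0 + h *s axis i (z $ i))) (at l)"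
    by (intro has_derivative_add has_derivative_const bounded_linear_imp_has_derivative[OF bl])
  then show ?thesis unfolding eq by simp
qed

lemma continuous_on_coord_scale: "continuous_on S (\<lambda>l. coord_scale i l z)"
  by (intro continuous_at_imp_continuous_on ballI has_derivative_continuous[OF coord_scale_has_derivative])

lemma dist_coord_scale: "dist (coord_scale i l z) z = cmod (l - 1) * cmod (z $ i)"
proof -
  have "coord_scale i l z - z = axis i ((l - 1) * z $ i)"
    by (auto simp: vec_eq_iff axis_def algebra_simps)
  then have "dist (coord_scale i l z) z = norm (axis i ((l - 1) * z $ i))" by (simp add: dist_norm)
  also have "norm (axis i ((l - 1) * z $ i)) = L2_set (\<lambda>k. if k = i then cmod ((l - 1) * z $ i) else 0) UNIV"
    unfolding norm_vec_def by (rule L2_set_cong) (auto simp: axis_def)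
  also have "\<dots> = cmod ((l - 1) * z $ i)" by (simp add: L2_set_def if_distrib[of "\<lambda>x. x\<^sup>2"] cong: if_cong)
  finally show ?thesis by (simp add: norm_mult)
qed

definition monom_vec :: "('n \<Rightarrow> nat) \<Rightarrow> complex ^ 'n::finite \<Rightarrow> complex" where
  "monom_vec \<alpha> z = (\<Prod>i\<in>UNIV. z $ i ^ \<alpha> i)"

section \<open>Separate holomorphy and Taylor coefficients along coordinate scalings\<close>

context omega_domain
begin

lemma coord_scale_mem_K: "z \<in> K \<Longrightarrow> cmod l \<le> 1 \<Longrightarrow> coord_scale i l z \<in> K"
  by (rule scale_coords_mem_K) auto

text \<open>Holomorphy in the scaling variable makes sense at boundary points too, as the slices
  stay in \<open>K\<close>. The class is stable under uniform limits and under coordinate scalings,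
  hence under extracting Taylor coefficients, and it needs only one-variable function
  theory.\<close>

definition sep_holo :: "(complex ^ 'n \<Rightarrow> complex) \<Rightarrow> bool" where
  "sep_holo f \<longleftrightarrow> continuous_on K f \<and>
     (\<forall>z\<in>K. \<forall>i. (\<lambda>l. f (coord_scale i l z)) holomorphic_on ball 0 1)"

lemma sep_holo_slice_continuous:
  assumes "sep_holo f" "z \<in> K"
  shows "continuous_on (cball 0 1) (\<lambda>l. f (coord_scale i l z))"
proof (rule continuous_on_compose2[of K f])
  show "continuous_on K f" using assms by (simp add: sep_holo_def)
qed (use assms coord_scale_mem_K in \<open>auto intro: continuous_on_coord_scale\<close>)

lemma sep_holo_lin:
  assumes "sep_holo f" "sep_holo g" shows "sep_holo (\<lambda>z. a * f z + b * g z)"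
  using assms unfolding sep_holo_def by (auto intro!: continuous_intros holomorphic_intros)

lemma sep_holo_cmult: "sep_holo f \<Longrightarrow> sep_holo (\<lambda>z. a * f z)"
  using sep_holo_lin[of f f a 0] by simp

lemma sep_holo_sum: "(\<And>i. i \<in> A \<Longrightarrow> sep_holo (f i)) \<Longrightarrow> sep_holo (\<lambda>z. \<Sum>i\<in>A. f i z)"
proof (induction A rule: infinite_finite_induct)
  case (insert x A)
  then show ?case using sep_holo_lin[of "f x" "\<lambda>z. \<Sum>i\<in>A. f i z" 1 1] by simp
qed (auto simp: sep_holo_def)

lemma sep_holo_coord_scale:
  assumes f: "sep_holo f" and l: "cmod l \<le> 1"
  shows "sep_holo (\<lambda>z. f (coord_scale i l z))"
  unfolding sep_holo_def
proof (intro conjI ballI allI)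
  show "continuous_on K (\<lambda>z. f (coord_scale i l z))"
    using f l coord_scale_mem_K unfolding sep_holo_def
    by (intro continuous_on_compose2[of K f _ "coord_scale i l"] continuous_intros) auto
  fix z k assume "z \<in> K"
  then have "(\<lambda>m. f (coord_scale k m (coord_scale i l z))) holomorphic_on ball 0 1"
    using f l coord_scale_mem_K unfolding sep_holo_def by blast
  then show "(\<lambda>m. f (coord_scale i l (coord_scale k m z))) holomorphic_on ball 0 1"
    by (simp only: scale_coords_commute[of "(\<lambda>_. 1)(i := l)"])
qed

lemma sep_holo_limit:
  assumes ap: "\<And>e. e > 0 \<Longrightarrow> \<exists>g. sep_holo g \<and> (\<forall>z\<in>K. cmod (f z - g z) \<le> e)"
  shows "sep_holo f"
proof -
  have "\<forall>n. \<exists>g. sep_holo g \<and> (\<forall>z\<in>K. cmod (f z - g z) \<le> 1 / real (Suc n))"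
    by (intro allI ap) simp
  then obtain G where G: "\<And>n. sep_holo (G n)" "\<And>n z. z \<in> K \<Longrightarrow> cmod (f z - G n z) \<le> 1 / real (Suc n)"
    by metis
  have ul: "uniform_limit K G f sequentially"
  proof (rule uniform_limitI)
    fix e :: real assume "e > 0"
    then obtain N where N: "1 / real (Suc N) < e" using nat_approx_posE by blast
    show "\<forall>\<^sub>F n in sequentially. \<forall>z\<in>K. dist (G n z) (f z) < e"
      using eventually_ge_at_top[of N]
    proof eventually_elim
      case (elim n)
      have "1 / real (Suc n) \<le> 1 / real (Suc N)" using elim by (intro divide_left_mono) auto
      then show ?case
        using G(2)[of _ n] N by (fastforce simp: dist_norm norm_minus_commute)
    qed
  qed
  have "continuous_on K f"
    by (rule uniform_limit_theorem[OF _ ul]) (use G(1) in \<open>auto simp: sep_holo_def\<close>)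
  moreover have "(\<lambda>l. f (coord_scale i l z)) holomorphic_on ball 0 1" if z: "z \<in> K" for z i
  proof -
    have "uniform_limit (cball 0 1) (\<lambda>n l. G n (coord_scale i l z)) (\<lambda>l. f (coord_scale i l z)) sequentially"
      by (rule uniform_limit_compose'[OF ul]) (use coord_scale_mem_K[OF z] in auto)
    then show ?thesis
      by (rule holomorphic_uniform_limit[rotated])
         (use G(1) z sep_holo_slice_continuous[OF G(1) z] in \<open>auto simp: sep_holo_def\<close>)
  qed
  ultimately show ?thesis by (simp add: sep_holo_def)
qed

text \<open>Strictness moves boundary points into the open domain, where members of the algebra are
  differentiable.\<close>

lemma lev_coord_scale_less:
  assumes "z $ i \<noteq> 0" "cmod l < 1"
  shows "lev p (coord_scale i l z) < lev p z"
  unfolding lev_def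
proof (rule sum_strict_mono_ex1)
  let ?t = "\<lambda>z k j. cmod (z $ k) ^ (2 * (p k ! j))"
  have le: "?t (coord_scale i l z) k j \<le> ?t z k j" for k j
    using assms by (intro power_mono) (auto simp: norm_mult mult_left_le_one_le)
  then show "\<forall>k\<in>UNIV. (\<Sum>j<length (p k). ?t (coord_scale i l z) k j) \<le> (\<Sum>j<length (p k). ?t z k j)"
    by (intro ballI sum_mono)
  have "cmod (l * z $ i) < cmod (z $ i)" using assms by (simp add: norm_mult)
  then have "?t (coord_scale i l z) i j < ?t z i j" if "j < length (p i)" for j
    using exponent_pos[OF that] unfolding coord_scale_nth by (intro power_strict_mono) auto
  then have "(\<Sum>j<length (p i). ?t (coord_scale i l z) i j) < (\<Sum>j<length (p i). ?t z i j)"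
    using length_pos[of i] by (intro sum_strict_mono) auto
  then show "\<exists>k\<in>UNIV. (\<Sum>j<length (p k). ?t (coord_scale i l z) k j) < (\<Sum>j<length (p k). ?t z k j)"
    by blast
qed simp

lemma A_space_sep_holo:
  assumes f: "f \<in> A_space p" shows "sep_holo f"
  unfolding sep_holo_def
proof (intro conjI ballI allI)
  show "continuous_on K f" using f by (simp add: A_space_def)
  fix z i assume z: "z \<in> K"
  show "(\<lambda>l. f (coord_scale i l z)) holomorphic_on ball 0 1"
  \<comment> \<open>If the coordinate vanishes, the slice may stay on the boundary, but then it is
    constant.\<close>
  proof (cases "z $ i = 0")
    case True
    have "coord_scale i l z = z" for l using True by (simp add: vec_eq_iff)
    then show ?thesis by simp
  next
    case False
    show ?thesis unfolding holomorphic_on_def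
    proof
      fix l :: complex assume l: "l \<in> ball 0 1"
      have "coord_scale i l z \<in> Omega p"
        using lev_coord_scale_less[OF False, of l] l z by (simp add: Omega_iff K_iff)
      then obtain D where D: "(f has_derivative D) (at (coord_scale i l z))" "\<And>c v. D (c *s v) = c * D v"
        using f unfolding A_space_def holomorphic_vec_on_def by blast
      have "((\<lambda>l. f (coord_scale i l z)) has_derivative (\<lambda>h. D (h *s axis i (z $ i)))) (at l)"
        by (rule has_derivative_compose[OF coord_scale_has_derivative D(1)])
      then have "((\<lambda>l. f (coord_scale i l z)) has_field_derivative D (axis i (z $ i))) (at l)"
        unfolding has_field_derivative_def D(2) mult.commute[of _ "D (axis i (z $ i))"] .
      then show "(\<lambda>l. f (coord_scale i l z)) field_differentiable at l within ball 0 1"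
        using field_differentiable_at_within field_differentiable_def by blast
    qed
  qed
qed

text \<open>The component of \<open>f\<close> that is homogeneous of degree \<open>m\<close> in the
  i-th coordinate. Differentiation is in the scaling variable, so the power of that coordinate is
  contained in the coefficient.\<close>

definition tcoeff :: "'n \<Rightarrow> nat \<Rightarrow> (complex ^ 'n \<Rightarrow> complex) \<Rightarrow> complex ^ 'n \<Rightarrow> complex" where
  "tcoeff i m f z = (deriv ^^ m) (\<lambda>l. f (coord_scale i l z)) 0 / fact m"

text \<open>Cauchy's inequality on the unit circle itself, available because slices are continuous
  on the closed disc. The bound is thus the same for all degrees and all points.\<close>

lemma tcoeff_le:
  assumes f: "sep_holo f" and z: "z \<in> K" and B: "\<And>z. z \<in> K \<Longrightarrow> cmod (f z) \<le> B"
  shows "cmod (tcoeff i m f z) \<le> B"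
proof -
  have "norm ((deriv ^^ m) (\<lambda>l. f (coord_scale i l z)) 0) \<le> fact m * B / 1 ^ m"
  proof (rule Cauchy_inequality)
    show "(\<lambda>l. f (coord_scale i l z)) holomorphic_on ball 0 1" using f z by (simp add: sep_holo_def)
    show "continuous_on (cball 0 1) (\<lambda>l. f (coord_scale i l z))" by (rule sep_holo_slice_continuous[OF f z])
    show "norm (f (coord_scale i l z)) \<le> B" if "norm (0 - l) = 1" for l
      using that by (intro B coord_scale_mem_K[OF z]) simp
  qed simp
  then show ?thesis by (simp add: tcoeff_def norm_divide divide_le_eq mult.commute)
qed

lemma tcoeff_sums:
  assumes f: "sep_holo f" and z: "z \<in> K" and l: "cmod l < 1"
  shows "(\<lambda>m. tcoeff i m f z * l ^ m) sums f (coord_scale i l z)"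
proof -
  have "(\<lambda>l. f (coord_scale i l z)) holomorphic_on ball 0 1" using f z by (simp add: sep_holo_def)
  from holomorphic_power_series[OF this, of l] show ?thesis
    using l by (simp add: tcoeff_def)
qed

lemma tcoeff_tail:
  assumes f: "sep_holo f" and z: "z \<in> K" and B: "\<And>z. z \<in> K \<Longrightarrow> cmod (f z) \<le> B" and r: "0 < r" "r < 1"
  shows "cmod (f (coord_scale i (of_real r) z) - (\<Sum>m<N. tcoeff i m f z * of_real r ^ m)) \<le> B * r ^ N / (1 - r)"
proof -
  let ?t = "\<lambda>m. tcoeff i m f z * of_real r ^ m"
  have sums: "?t sums f (coord_scale i (of_real r) z)"
    using r by (intro tcoeff_sums[OF f z]) simp
  then have tail: "(\<lambda>m. ?t (m + N)) sums (f (coord_scale i (of_real r) z) - (\<Sum>m<N. ?t m))"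
    by (rule sums_split_initial_segment)
  have geo: "(\<lambda>m. B * r ^ N * r ^ m) sums (B * r ^ N * (1 / (1 - r)))"
    using r by (intro sums_mult geometric_sums) simp
  have le: "norm (?t (m + N)) \<le> B * r ^ N * r ^ m" for m
    using tcoeff_le[OF f z B, of i "m + N"] r
    by (simp add: norm_mult norm_power power_add mult_ac mult_left_mono)
  have "norm (\<Sum>m. ?t (m + N)) \<le> (\<Sum>m. B * r ^ N * r ^ m)"
    by (rule norm_suminf_le[OF le sums_summable[OF geo]])
  then show ?thesis using sums_unique[OF tail] sums_unique[OF geo] by simp
qed

lemma sep_holo_bounded:
  assumes "sep_holo f" obtains B where "B > 0" "\<And>z. z \<in> K \<Longrightarrow> cmod (f z) \<le> B"
  using assms continuous_bounded unfolding sep_holo_def by blast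

text \<open>Each Taylor coefficient is the uniform limit, as \<open>r\<close> tends to \<open>0\<close>, of the difference quotients
  formed with the lower coefficients.\<close>

lemma sep_holo_tcoeff:
  assumes f: "sep_holo f"
  shows "sep_holo (tcoeff i m f)"
proof (induction m rule: less_induct)
  case (less m)
  obtain B where B: "B > 0" "\<And>z. z \<in> K \<Longrightarrow> cmod (f z) \<le> B" using sep_holo_bounded[OF f] by blast
  show ?case
  proof (rule sep_holo_limit)
    fix e :: real assume e: "e > 0"
    \<comment> \<open>After removing the terms up to degree \<open>m\<close> and dividing by
      \<open>r ^ m\<close>, the remainder is at most B r / (1 - r). This \<open>r\<close> makes that
      bound equal to \<open>e\<close>.\<close>
    define r where "r = e / (B + e)"
    have r: "0 < r" "r < 1" "B * r / (1 - r) = e"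
    proof -
      have r1: "1 - r = B / (B + e)" using B(1) e by (simp add: r_def field_simps)
      show "B * r / (1 - r) = e" unfolding r1 using B(1) e by (simp add: r_def)
      show "0 < r" "r < 1" using B(1) e by (auto simp: r_def)
    qed
    let ?g = "\<lambda>z. 1 / of_real r ^ m * f (coord_scale i (of_real r) z) + (-1 / of_real r ^ m) * (\<Sum>l<m. of_real r ^ l * tcoeff i l f z)"
    have g: "sep_holo ?g"
      using r by (intro sep_holo_lin sep_holo_sum sep_holo_cmult less.IH sep_holo_coord_scale[OF f]) auto
    have "cmod (tcoeff i m f z - ?g z) \<le> e" if z: "z \<in> K" for z
    proof -
      let ?d = "f (coord_scale i (of_real r) z) - (\<Sum>l<Suc m. tcoeff i l f z * of_real r ^ l)"
      define S where "S = (\<Sum>l<m. tcoeff i l f z * of_real r ^ l)"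
      have "(\<Sum>l<m. of_real r ^ l * tcoeff i l f z) = S" by (simp add: S_def mult.commute)
      moreover have "(\<Sum>l<Suc m. tcoeff i l f z * of_real r ^ l) = S + tcoeff i m f z * of_real r ^ m"
        by (simp add: S_def)
      ultimately have "tcoeff i m f z - ?g z = - (?d / of_real r ^ m)"
        using r by (simp add: field_simps)
      then have "cmod (tcoeff i m f z - ?g z) = cmod ?d / r ^ m"
        using r by (simp add: norm_divide norm_power)
      also have "\<dots> \<le> (B * r ^ Suc m / (1 - r)) / r ^ m"
        using r by (intro divide_right_mono tcoeff_tail[OF f z B(2)]) auto
      also have "\<dots> = B * r / (1 - r)" using r by simp
      finally show ?thesis using r by simp
    qed
    then show "\<exists>g. sep_holo g \<and> (\<forall>z\<in>K. cmod (tcoeff i m f z - g z) \<le> e)" using g by blast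
  qed
qed

definition homog :: "'n \<Rightarrow> nat \<Rightarrow> (complex ^ 'n \<Rightarrow> complex) \<Rightarrow> bool" where
  "homog i m f \<longleftrightarrow> (\<forall>z\<in>K. \<forall>l. cmod l \<le> 1 \<longrightarrow> f (coord_scale i l z) = l ^ m * f z)"

text \<open>Scaling the point replaces the slice at \<open>x\<close> by the slice at
  \<open>l * x\<close>, which multiplies its m-th derivative at 0 by \<open>l ^ m\<close>.\<close>

lemma homog_tcoeff_same:
  assumes f: "sep_holo f" shows "homog i m (tcoeff i m f)"
  unfolding homog_def
proof (intro ballI allI impI)
  fix z l assume z: "z \<in> K" and l: "cmod l \<le> 1"
  have "(deriv ^^ m) (\<lambda>x. f (coord_scale i (l * x) z)) 0 = l ^ m * (deriv ^^ m) (\<lambda>x. f (coord_scale i x z)) (l * 0)"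
  proof (rule higher_deriv_compose_linear)
    show "(\<lambda>x. f (coord_scale i x z)) holomorphic_on ball 0 1" using f z by (simp add: sep_holo_def)
    show "l * w \<in> ball 0 1" if "w \<in> ball 0 1" for w
      using that l mult_left_le_one_le[of "cmod w" "cmod l"] by (simp add: norm_mult)
  qed auto
  then show "tcoeff i m f (coord_scale i l z) = l ^ m * tcoeff i m f z"
    by (simp add: tcoeff_def coord_scale_same mult.commute)
qed

text \<open>Scalings commute, so homogeneity obtained in earlier coordinates survives the extraction
  of coefficients in the next one.\<close>

lemma homog_tcoeff_other:
  assumes f: "sep_holo f" and h: "homog k d f" shows "homog k d (tcoeff i m f)"
  unfolding homog_def
proof (intro ballI allI impI)
  fix z l assume z: "z \<in> K" and l: "cmod l \<le> 1"
  let ?F = "\<lambda>x. f (coord_scale i x z)"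
  have F: "?F holomorphic_on ball 0 1" using f z by (simp add: sep_holo_def)
  have "(deriv ^^ m) (\<lambda>x. f (coord_scale i x (coord_scale k l z))) 0 = (deriv ^^ m) (\<lambda>x. l ^ d * ?F x) 0"
  proof (rule higher_deriv_transform_within_open)
    show "(\<lambda>x. f (coord_scale i x (coord_scale k l z))) holomorphic_on ball 0 1"
      using f coord_scale_mem_K[OF z l] by (simp add: sep_holo_def)
    show "(\<lambda>x. l ^ d * ?F x) holomorphic_on ball 0 1" using F by (intro holomorphic_intros)
    fix x :: complex assume x: "x \<in> ball 0 1"
    have "f (coord_scale k l (coord_scale i x z)) = l ^ d * ?F x"
      using h l coord_scale_mem_K[OF z, of x i] x unfolding homog_def by simp
    then show "f (coord_scale i x (coord_scale k l z)) = l ^ d * ?F x"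
      by (simp only: scale_coords_commute[of "(\<lambda>_. 1)(i := x)"])
  qed auto
  also have "\<dots> = l ^ d * (deriv ^^ m) ?F 0"
    by (rule higher_deriv_cmult[OF F]) auto
  finally show "tcoeff i m f (coord_scale k l z) = l ^ d * tcoeff i m f z"
    by (simp add: tcoeff_def)
qed

lemma homog_cmult: "homog i m f \<Longrightarrow> homog i m (\<lambda>z. a * f z)"
  by (simp add: homog_def)

text \<open>The Taylor series of a slice need not converge on the unit circle. Shrinking the
  coordinate slightly changes \<open>f\<close> uniformly little and makes the series converge
  geometrically.\<close>

lemma coord_scale_uniform:
  assumes f: "continuous_on K f" and e: "e > 0"
  obtains r :: real where "0 < r" "r < 1" "\<And>z. z \<in> K \<Longrightarrow> cmod (f z - f (coord_scale i (of_real r) z)) \<le> e"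
proof -
  have "uniformly_continuous_on K f" by (rule compact_uniformly_continuous[OF f compact_K])
  then obtain d where d: "d > 0" "\<And>x y. x \<in> K \<Longrightarrow> y \<in> K \<Longrightarrow> dist y x < d \<Longrightarrow> dist (f y) (f x) < e"
    using e unfolding uniformly_continuous_on_def by metis
  define r where "r = 1 - min (1/2) (d / 2)"
  have r: "0 < r" "r < 1" "1 - r < d" using d(1) by (auto simp: r_def)
  have "cmod (f z - f (coord_scale i (of_real r) z)) \<le> e" if z: "z \<in> K" for z
  proof -
    have "dist (coord_scale i (of_real r) z) z = (1 - r) * cmod (z $ i)"
      using r norm_of_real[of "r - 1", where 'a = complex] unfolding dist_coord_scale by simp
    also have "\<dots> \<le> (1 - r) * 1" using r K_nth_le[OF z] by (intro mult_left_mono) auto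
    finally have "dist (coord_scale i (of_real r) z) z < d" using r by simp
    then have "dist (f (coord_scale i (of_real r) z)) (f z) < e"
      using r by (intro d(2)[OF z coord_scale_mem_K[OF z]]) auto
    then show ?thesis by (simp add: dist_norm norm_minus_commute)
  qed
  then show thesis using that r by blast
qed

section \<open>Approximation by sums of functions homogeneous in each coordinate\<close>

abbreviation (input) homog_list :: "'n set \<Rightarrow> (complex ^ 'n \<Rightarrow> complex) list \<Rightarrow> bool" where
  "homog_list I gs \<equiv> \<forall>g\<in>set gs. sep_holo g \<and> (\<forall>i\<in>I. \<exists>m. homog i m g)"

definition approx_homog :: "'n set \<Rightarrow> (complex ^ 'n \<Rightarrow> complex) \<Rightarrow> bool" where
  "approx_homog I f \<longleftrightarrow> (\<forall>e>0. \<exists>gs. homog_list I gs \<and>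
     (\<forall>z\<in>K. cmod (f z - (\<Sum>g\<leftarrow>gs. g z)) \<le> e))"

lemma approx_homog_add:
  assumes "approx_homog I f" "approx_homog I g"
  shows "approx_homog I (\<lambda>z. f z + g z)"
  unfolding approx_homog_def
proof (intro allI impI)
  fix e :: real assume "e > 0"
  then have e: "e / 2 > 0" by simp
  obtain fs where fs: "homog_list I fs"
    "\<And>z. z \<in> K \<Longrightarrow> cmod (f z - (\<Sum>g\<leftarrow>fs. g z)) \<le> e / 2"
    using assms(1) e unfolding approx_homog_def by blast
  obtain gs where gs: "homog_list I gs"
    "\<And>z. z \<in> K \<Longrightarrow> cmod (g z - (\<Sum>g\<leftarrow>gs. g z)) \<le> e / 2"
    using assms(2) e unfolding approx_homog_def by blast
  have "cmod (f z + g z - (\<Sum>g\<leftarrow>fs @ gs. g z)) \<le> e" if "z \<in> K" for z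
    using norm_triangle_mono[OF fs(2)[OF that] gs(2)[OF that]] by (simp add: algebra_simps)
  then show "\<exists>gs. homog_list I gs \<and>
     (\<forall>z\<in>K. cmod (f z + g z - (\<Sum>g\<leftarrow>gs. g z)) \<le> e)"
    using fs(1) gs(1) by (intro exI[of _ "fs @ gs"]) auto
qed

lemma approx_homog_sum_list:
  "(\<And>g. g \<in> set gs \<Longrightarrow> approx_homog I g) \<Longrightarrow> approx_homog I (\<lambda>z. \<Sum>g\<leftarrow>gs. g z)"
proof (induction gs)
  case Nil
  show ?case unfolding approx_homog_def by (intro allI impI exI[of _ "[]"]) auto
next
  case (Cons g gs)
  then show ?case using approx_homog_add[of I g "\<lambda>z. \<Sum>g\<leftarrow>gs. g z"] by simp
qed

lemma approx_homog_limit: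
  assumes "\<And>e. e > 0 \<Longrightarrow> \<exists>h. approx_homog I h \<and> (\<forall>z\<in>K. cmod (f z - h z) \<le> e)"
  shows "approx_homog I f"
  unfolding approx_homog_def
proof (intro allI impI)
  fix e :: real assume "e > 0"
  then have e: "e / 2 > 0" by simp
  obtain h where h: "approx_homog I h" "\<And>z. z \<in> K \<Longrightarrow> cmod (f z - h z) \<le> e / 2"
    using assms[OF e] by blast
  obtain gs where gs: "homog_list I gs"
    "\<And>z. z \<in> K \<Longrightarrow> cmod (h z - (\<Sum>g\<leftarrow>gs. g z)) \<le> e / 2"
    using h(1) e unfolding approx_homog_def by blast
  have "cmod (f z - (\<Sum>g\<leftarrow>gs. g z)) \<le> e" if "z \<in> K" for z
    using norm_triangle_mono[OF h(2)[OF that] gs(2)[OF that]] by simp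
  then show "\<exists>gs. homog_list I gs \<and>
     (\<forall>z\<in>K. cmod (f z - (\<Sum>g\<leftarrow>gs. g z)) \<le> e)"
    using gs(1) by blast
qed

text \<open>Induction on the set of coordinates: each summand produced so far is dilated in the new
  coordinate and replaced by a Taylor polynomial there, whose terms keep the earlier
  homogeneities.\<close>

lemma sep_holo_approx_homog:
  assumes "finite I" shows "sep_holo f \<Longrightarrow> approx_homog I f"
  using assms
proof (induction I arbitrary: f rule: finite_induct)
  case empty
  then show ?case unfolding approx_homog_def by (intro allI impI exI[of _ "[f]"]) auto
next
  case (insert i I)
  have step: "approx_homog (insert i I) g" if g: "sep_holo g" and hg: "\<And>k. k \<in> I \<Longrightarrow> \<exists>m. homog k m g" for g
    unfolding approx_homog_def
  proof (intro allI impI)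
    fix e :: real assume "e > 0"
    then have e: "e / 2 > 0" by simp
    have cg: "continuous_on K g" using g by (simp add: sep_holo_def)
    obtain B where B: "B > 0" "\<And>z. z \<in> K \<Longrightarrow> cmod (g z) \<le> B" using sep_holo_bounded[OF g] by blast
    obtain r :: real where r: "0 < r" "r < 1"
      "\<And>z. z \<in> K \<Longrightarrow> cmod (g z - g (coord_scale i (of_real r) z)) \<le> e / 2"
      using coord_scale_uniform[OF cg e, of i] by blast
    \<comment> \<open>Half of the tolerance pays for the dilation, half for the tail of the
      series.\<close>
    obtain N where N: "r ^ N < e / 2 * (1 - r) / B"
      using real_arch_pow_inv[of "e / 2 * (1 - r) / B" r] e r B(1) by auto
    then have N': "B * r ^ N / (1 - r) \<le> e / 2"
      using r B(1) by (simp add: field_simps)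
    let ?gs = "map (\<lambda>m z. of_real r ^ m * tcoeff i m g z) [0..<N]"
    have close: "cmod (g z - (\<Sum>h\<leftarrow>?gs. h z)) \<le> e" if z: "z \<in> K" for z
    proof -
      have "(\<Sum>h\<leftarrow>?gs. h z) = (\<Sum>m<N. tcoeff i m g z * of_real r ^ m)"
        by (simp add: o_def interv_sum_list_conv_sum_set_nat lessThan_atLeast0 mult.commute)
      then have "cmod (g (coord_scale i (of_real r) z) - (\<Sum>h\<leftarrow>?gs. h z)) \<le> e / 2"
        using order_trans[OF tcoeff_tail[OF g z B(2) r(1,2), of i N] N'] by simp
      from norm_triangle_mono[OF r(3)[OF z] this] show ?thesis by simp
    qed
    have good: "sep_holo h \<and> (\<forall>k\<in>insert i I. \<exists>m. homog k m h)" if hm: "h \<in> set ?gs" for h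
    proof -
      obtain m where h: "h = (\<lambda>z. of_real r ^ m * tcoeff i m g z)" using hm by auto
      have "\<exists>d. homog k d h" if k: "k \<in> insert i I" for k
      proof (cases "k = i")
        case True
        then show ?thesis
          unfolding h using homog_cmult[OF homog_tcoeff_same[OF g]] by (intro exI[of _ m]) simp
      next
        case False
        then obtain d where "homog k d g" using k hg by auto
        then show ?thesis
          unfolding h by (intro exI[of _ d] homog_cmult homog_tcoeff_other[OF g])
      qed
      moreover have "sep_holo h" unfolding h by (rule sep_holo_cmult[OF sep_holo_tcoeff[OF g]])
      ultimately show ?thesis by simp
    qed
    show "\<exists>gs. homog_list (insert i I) gs \<and>
     (\<forall>z\<in>K. cmod (g z - (\<Sum>g\<leftarrow>gs. g z)) \<le> e)"
      by (rule exI[of _ ?gs], rule conjI, rule ballI, erule good, rule ballI, erule close)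
  qed
  show ?case
  proof (rule approx_homog_limit)
    fix e :: real assume "e > 0"
    then obtain gs where gs: "homog_list I gs"
      "\<forall>z\<in>K. cmod (f z - (\<Sum>g\<leftarrow>gs. g z)) \<le> e"
      using insert.IH[OF insert.prems] unfolding approx_homog_def by blast
    have "approx_homog (insert i I) (\<lambda>z. \<Sum>g\<leftarrow>gs. g z)"
      using gs(1) by (intro approx_homog_sum_list step) auto
    then show "\<exists>h. approx_homog (insert i I) h \<and> (\<forall>z\<in>K. cmod (f z - h z) \<le> e)"
      using gs(2) by blast
  qed
qed

section \<open>Multihomogeneous functions are monomials\<close>

lemma homog_scale_coords:
  assumes h: "\<And>i. homog i (\<alpha> i) g" and z: "z \<in> K" and w: "\<And>i. cmod (w i) \<le> 1"
  shows "g (scale_coords w z) = (\<Prod>i\<in>UNIV. w i ^ \<alpha> i) * g z"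
proof -
  have "g (scale_coords (\<lambda>i. if i \<in> A then w i else 1) z) = (\<Prod>i\<in>A. w i ^ \<alpha> i) * g z" if "finite A" for A
    using that
  proof (induction A rule: finite_induct)
    case empty
    have "scale_coords (\<lambda>i. 1) z = z" by (simp add: vec_eq_iff)
    then show ?case by simp
  next
    case (insert k A)
    have eq: "scale_coords (\<lambda>i. if i \<in> insert k A then w i else 1) z
      = coord_scale k (w k) (scale_coords (\<lambda>i. if i \<in> A then w i else 1) z)"
      using insert.hyps by (auto simp: vec_eq_iff)
    have "scale_coords (\<lambda>i. if i \<in> A then w i else 1) z \<in> K"
      by (rule scale_coords_mem_K[OF z]) (simp add: w)
    then have "g (coord_scale k (w k) (scale_coords (\<lambda>i. if i \<in> A then w i else 1) z))
      = w k ^ \<alpha> k * g (scale_coords (\<lambda>i. if i \<in> A then w i else 1) z)"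
      using h w unfolding homog_def by blast
    then show ?case unfolding eq insert.IH using insert.hyps by (simp add: mult.assoc)
  qed
  from this[of UNIV] show ?thesis by simp
qed

text \<open>The point with coordinates d z_i arises in two ways: from z by scaling all coordinates
  with d, and from b = (d, ..., d) by scaling with the numbers z_i, whose moduli are at most 1.
  Comparing the two values of \<open>g\<close> gives the monomial.\<close>

lemma homog_monomial:
  assumes h: "\<And>i. \<exists>m. homog i m g"
  shows "\<exists>\<alpha> c. \<forall>z\<in>K. g z = c * monom_vec \<alpha> z"
proof -
  obtain \<alpha> where \<alpha>: "\<And>i. homog i (\<alpha> i) g" using h by metis
  obtain r where r: "r > 0" "ball 0 r \<subseteq> Omega p"
    using open_Omega zero_mem_Omega open_contains_ball by blast
  \<comment> \<open>Small enough that the norm of \<open>b\<close> is below \<open>r\<close>, and at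
    most 1 so that d is a legitimate scaling factor.\<close>
  define d where "d = min 1 (r / (2 * real CARD('n)))"
  have d: "0 < d" "d \<le> 1" using r(1) by (auto simp: d_def)
  define b :: "complex ^ 'n" where "b = (\<chi> i. of_real d)"
  have "norm b \<le> (\<Sum>i\<in>UNIV. norm (b $ i))" unfolding norm_vec_def by (rule L2_set_le_sum) auto
  also have "\<dots> = real CARD('n) * d" using d by (simp add: b_def)
  also have "\<dots> \<le> real CARD('n) * (r / (2 * real CARD('n)))" by (intro mult_left_mono) (auto simp: d_def)
  also have "\<dots> < r" using r(1) by simp
  finally have bK: "b \<in> K" using r(2) closure_subset[of "Omega p"] by auto
  define N where "N = (\<Prod>i\<in>UNIV. complex_of_real d ^ \<alpha> i)"
  have N: "N \<noteq> 0" using d by (simp add: N_def)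
  have "g z = g b / N * monom_vec \<alpha> z" if z: "z \<in> K" for z
  proof -
    have "scale_coords (\<lambda>_. of_real d) z = scale_coords (\<lambda>i. z $ i) b"
      by (simp add: vec_eq_iff b_def mult.commute)
    moreover have "g (scale_coords (\<lambda>_. of_real d) z) = N * g z"
      unfolding N_def using d by (intro homog_scale_coords[OF \<alpha> z]) simp
    moreover have "g (scale_coords (\<lambda>i. z $ i) b) = monom_vec \<alpha> z * g b"
      unfolding monom_vec_def by (rule homog_scale_coords[OF \<alpha> bK K_nth_le[OF z]])
    ultimately show ?thesis using N by (simp add: field_simps)
  qed
  then show ?thesis by blast
qed

definition is_poly :: "(complex ^ 'n \<Rightarrow> complex) \<Rightarrow> bool" where
  "is_poly q \<longleftrightarrow> (\<exists>A c. finite A \<and> q = (\<lambda>z. \<Sum>\<alpha>\<in>A. c \<alpha> * monom_vec \<alpha> z))"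

lemma is_poly_add:
  assumes "is_poly q" "is_poly q'" shows "is_poly (\<lambda>z. q z + q' z)"
proof -
  obtain A c where A: "finite A" "q = (\<lambda>z. \<Sum>\<alpha>\<in>A. c \<alpha> * monom_vec \<alpha> z)" using assms(1) unfolding is_poly_def by (elim exE conjE)
  obtain A' c' where A': "finite A'" "q' = (\<lambda>z. \<Sum>\<alpha>\<in>A'. c' \<alpha> * monom_vec \<alpha> z)" using assms(2) unfolding is_poly_def by (elim exE conjE)
  let ?d = "\<lambda>\<alpha>. (if \<alpha> \<in> A then c \<alpha> else 0) + (if \<alpha> \<in> A' then c' \<alpha> else 0)"
  have "q z + q' z = (\<Sum>\<alpha>\<in>A \<union> A'. ?d \<alpha> * monom_vec \<alpha> z)" for z
  proof -
    have "q z = (\<Sum>\<alpha>\<in>A \<union> A'. (if \<alpha> \<in> A then c \<alpha> else 0) * monom_vec \<alpha> z)"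
      unfolding A(2) using A(1) A'(1) by (intro sum.mono_neutral_cong_left) auto
    moreover have "q' z = (\<Sum>\<alpha>\<in>A \<union> A'. (if \<alpha> \<in> A' then c' \<alpha> else 0) * monom_vec \<alpha> z)"
      unfolding A'(2) using A(1) A'(1) by (intro sum.mono_neutral_cong_left) auto
    ultimately have "q z + q' z = (\<Sum>\<alpha>\<in>A \<union> A'. (if \<alpha> \<in> A then c \<alpha> else 0) * monom_vec \<alpha> z)
      + (\<Sum>\<alpha>\<in>A \<union> A'. (if \<alpha> \<in> A' then c' \<alpha> else 0) * monom_vec \<alpha> z)" by (rule arg_cong2)
    also have "\<dots> = (\<Sum>\<alpha>\<in>A \<union> A'. ?d \<alpha> * monom_vec \<alpha> z)"
      unfolding distrib_right by (rule sum.distrib[symmetric])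
    finally show ?thesis .
  qed
  then have "(\<lambda>z. q z + q' z) = (\<lambda>z. \<Sum>\<alpha>\<in>A \<union> A'. ?d \<alpha> * monom_vec \<alpha> z)" by (rule ext)
  then show ?thesis
    unfolding is_poly_def using A(1) A'(1) by (intro exI[of _ "A \<union> A'"] exI[of _ ?d] conjI finite_UnI)
qed

lemma sum_list_homog_poly:
  assumes "\<forall>g\<in>set gs. \<forall>i. \<exists>m. homog i m g"
  shows "\<exists>q. is_poly q \<and> (\<forall>z\<in>K. (\<Sum>g\<leftarrow>gs. g z) = q z)"
  using assms
proof (induction gs)
  case Nil
  have "is_poly (\<lambda>z. 0)" unfolding is_poly_def by (intro exI[of _ "{}"]) simp
  then show ?case by (intro exI[of _ "\<lambda>z. 0"]) simp
next
  case (Cons g gs)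
  have "\<exists>q. is_poly q \<and> (\<forall>z\<in>K. (\<Sum>g\<leftarrow>gs. g z) = q z)"
    by (rule Cons.IH) (use Cons.prems in simp)
  then obtain q where q: "is_poly q" "\<forall>z\<in>K. (\<Sum>g\<leftarrow>gs. g z) = q z" by blast
  have "\<exists>\<alpha> c. \<forall>z\<in>K. g z = c * monom_vec \<alpha> z"
    by (rule homog_monomial) (use Cons.prems in simp)
  then obtain \<alpha> c where \<alpha>: "\<forall>z\<in>K. g z = c * monom_vec \<alpha> z" by blast
  have "is_poly (\<lambda>z. c * monom_vec \<alpha> z)"
    unfolding is_poly_def by (intro exI[of _ "{\<alpha>}"] exI[of _ "\<lambda>_. c"]) simp
  then have "is_poly (\<lambda>z. c * monom_vec \<alpha> z + q z)" by (rule is_poly_add[OF _ q(1)])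
  moreover have "\<forall>z\<in>K. (\<Sum>g\<leftarrow>g # gs. g z) = c * monom_vec \<alpha> z + q z" using \<alpha> q(2) by simp
  ultimately show ?case by (intro exI[of _ "\<lambda>z. c * monom_vec \<alpha> z + q z"] conjI)
qed

lemma A_space_approx_poly:
  assumes f: "f \<in> A_space p" and e: "e > 0"
  shows "\<exists>q. is_poly q \<and> (\<forall>z\<in>K. cmod (f z - q z) \<le> e)"
proof -
  have "approx_homog UNIV f" by (rule sep_holo_approx_homog[OF finite A_space_sep_holo[OF f]])
  from this[unfolded approx_homog_def, rule_format, OF e]
  obtain gs where gs: "homog_list UNIV gs"
    "\<forall>z\<in>K. cmod (f z - (\<Sum>g\<leftarrow>gs. g z)) \<le> e" by blast
  have "\<forall>g\<in>set gs. \<forall>i. \<exists>m. homog i m g" using gs(1) by simp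
  then obtain q where "is_poly q" "\<forall>z\<in>K. (\<Sum>g\<leftarrow>gs. g z) = q z" using sum_list_homog_poly by blast
  then show ?thesis using gs(2) by (intro exI[of _ q]) simp
qed

end

section \<open>Concentration of monomials\<close>

lemma power_add_le_add_power:
  fixes x y :: real
  assumes "0 \<le> x" "0 \<le> y" "n > 0"
  shows "x ^ n + y ^ n \<le> (x + y) ^ n"
  using assms(3)
proof (induction n rule: nat_induct_non_zero)
  case (Suc n)
  have "x ^ Suc n + y ^ Suc n \<le> (x ^ n + y ^ n) * (x + y)"
    using assms by (simp add: algebra_simps)
  also have "\<dots> \<le> (x + y) ^ n * (x + y)"
    using assms Suc by (intro mult_right_mono) auto
  finally show ?case by (simp add: mult.commute)
qed simp

text \<open>Turns a gap between moduli into a gap between powers of them, with no lower bound on the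
  moduli.\<close>

lemma power_diff_ge:
  fixes a b :: real
  assumes "0 \<le> a" "0 \<le> b" "n > 0"
  shows "\<bar>a - b\<bar> ^ n \<le> \<bar>a ^ n - b ^ n\<bar>"
proof -
  have *: "(a - b) ^ n \<le> a ^ n - b ^ n" if "0 \<le> b" "b \<le> a" for a b :: real
    using power_add_le_add_power[of "a - b" b n] that assms(3) by simp
  show ?thesis
  proof (cases "b \<le> a")
    case True
    then show ?thesis using *[OF assms(2) True] power_mono[OF True assms(2), of n] by simp
  next
    case False
    then show ?thesis using *[OF assms(1), of b] power_mono[of a b n] assms(1) by simp
  qed
qed

definition mdeg :: "('n::finite \<Rightarrow> nat) \<Rightarrow> nat" where
  "mdeg \<alpha> = (\<Sum>i\<in>UNIV. \<alpha> i)"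

text \<open>Finiteness of the low-degree exponents is what allows the corresponding monomials to go
  into the finite pairing list.\<close>

lemma finite_mdeg_less: "finite {\<alpha> :: 'n::finite \<Rightarrow> nat. mdeg \<alpha> < N}"
proof -
  have "\<alpha> i < N" if "mdeg \<alpha> < N" for \<alpha> :: "'n \<Rightarrow> nat" and i
    using member_le_sum[of i UNIV \<alpha>] that by (simp add: mdeg_def)
  then have "{\<alpha> :: 'n \<Rightarrow> nat. mdeg \<alpha> < N} \<subseteq> PiE UNIV (\<lambda>_. {..<N})" by (auto simp: PiE_UNIV_domain)
  then show ?thesis by (rule finite_subset) (intro finite_PiE finite_lessThan finite)
qed

lemma continuous_on_monom_vec [continuous_intros]: "continuous_on S (monom_vec \<alpha>)"
  unfolding monom_vec_def by (intro continuous_intros)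

lemma monom_vec_scale_coords:
  "monom_vec \<alpha> (scale_coords w z) = (\<Prod>i\<in>UNIV. w i ^ \<alpha> i) * monom_vec \<alpha> z"
  by (simp add: monom_vec_def power_mult_distrib prod.distrib)

lemma monom_vec_add_coord: "monom_vec (\<alpha>(j := Suc (\<alpha> j))) z = z $ j * monom_vec \<alpha> z"
proof -
  have "monom_vec (\<alpha>(j := Suc (\<alpha> j))) z = (\<Prod>i\<in>UNIV. (if i = j then z $ j else 1) * z $ i ^ \<alpha> i)"
    unfolding monom_vec_def by (intro prod.cong) auto
  also have "\<dots> = z $ j * monom_vec \<alpha> z"
    by (simp add: prod.distrib monom_vec_def)
  finally show ?thesis .
qed

lemma mdeg_add_coord: "mdeg (\<alpha>(j := Suc (\<alpha> j))) = Suc (mdeg \<alpha>)"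
proof -
  have "mdeg (\<alpha>(j := Suc (\<alpha> j))) = (\<Sum>i\<in>UNIV. (if i = j then 1 else 0) + \<alpha> i)"
    unfolding mdeg_def by (intro sum.cong) auto
  also have "\<dots> = Suc (mdeg \<alpha>)" by (simp add: sum.distrib mdeg_def)
  finally show ?thesis .
qed

lemma norm_monom_vec_ge:
  assumes "\<And>i. t * cmod (y $ i) \<le> cmod (u $ i)" "0 \<le> t"
  shows "t ^ mdeg \<alpha> * cmod (monom_vec \<alpha> y) \<le> cmod (monom_vec \<alpha> u)"
proof -
  have "t ^ mdeg \<alpha> * cmod (monom_vec \<alpha> y) = (\<Prod>i\<in>UNIV. (t * cmod (y $ i)) ^ \<alpha> i)"
    by (simp add: mdeg_def power_sum monom_vec_def norm_power power_mult_distrib prod.distrib flip: prod_norm)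
  also have "\<dots> \<le> (\<Prod>i\<in>UNIV. cmod (u $ i) ^ \<alpha> i)"
    using assms by (intro prod_mono conjI power_mono zero_le_power) auto
  finally show ?thesis by (simp add: monom_vec_def norm_power flip: prod_norm)
qed

section \<open>Peak points and decay away from them\<close>

context omega_domain
begin

lemma monom_vec_A_space: "monom_vec \<alpha> \<in> A_space p"
proof -
  have pow: "(\<lambda>z. z $ i ^ m) \<in> A_space p" for i m
    by (induction m) (auto intro: A_space_const A_space_mult A_space_coord)
  have "(\<lambda>z. \<Prod>i\<in>A. z $ i ^ \<alpha> i) \<in> A_space p" if "finite A" for A
    using that
  proof (induction A rule: finite_induct)
    case (insert x A)
    then show ?case using A_space_mult[OF pow[of x "\<alpha> x"] insert.IH] by simp
  qed (simp add: A_space_const)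
  from this[of UNIV] show ?thesis by (simp add: monom_vec_def[abs_def])
qed

lemma integrable_nu_continuous:
  fixes f :: "complex ^ 'n \<Rightarrow> real"
  assumes f: "continuous_on K f" shows "integrable (nu p) f"
proof -
  obtain B where B: "\<And>z. z \<in> K \<Longrightarrow> norm (f z) \<le> B"
    using compact_imp_bounded[OF compact_continuous_image[OF f compact_K]] unfolding bounded_iff by auto
  show ?thesis
  proof (rule nu.integrable_const_bound)
    show "AE z in nu p. norm (f z) \<le> B" by (rule AE_I2) (use B in simp)
    show "f \<in> borel_measurable (nu p)"
      using borel_measurable_continuous_on_restrict[OF f] measurable_cong_sets[OF sets_nu refl] by blast
  qed
qed

text \<open>A predicate rather than a chosen maximiser: the estimates hold for every peak, so one
  with a vanishing coordinate can be selected when the exponent there is 0.\<close>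

definition is_peak :: "('n \<Rightarrow> nat) \<Rightarrow> complex ^ 'n \<Rightarrow> bool" where
  "is_peak \<alpha> y \<longleftrightarrow> y \<in> K \<and> (\<forall>z\<in>K. cmod (monom_vec \<alpha> z) \<le> cmod (monom_vec \<alpha> y))"

lemma ex_peak: "\<exists>y. is_peak \<alpha> y"
proof -
  have "K \<noteq> {}" using zero_mem_Omega closure_subset by blast
  moreover have "continuous_on K (\<lambda>z. cmod (monom_vec \<alpha> z))" by (intro continuous_intros)
  ultimately show ?thesis
    using continuous_attains_sup[OF compact_K] unfolding is_peak_def by blast
qed

text \<open>With a and b the \<open>p i ! k\<close>-th powers of the two moduli, the term of the
  geometric mean is a b = (a^2 + b^2)/2 - (a - b)^2/2. Summing shows logarithmic convexity, and
  keeping one of the subtracted squares makes it strict.\<close>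

lemma lev_geometric_mean:
  assumes z: "z \<in> K" and y: "y \<in> K" and l: "l < length (p j)"
  shows "lev p (\<chi> i. of_real (sqrt (cmod (z $ i) * cmod (y $ i))))
    \<le> 1 - (cmod (z $ j) ^ (p j ! l) - cmod (y $ j) ^ (p j ! l))\<^sup>2 / 2"
proof -
  let ?v = "(\<chi> i. of_real (sqrt (cmod (z $ i) * cmod (y $ i)))) :: complex ^ 'n"
  let ?d = "\<lambda>i k. (cmod (z $ i) ^ (p i ! k) - cmod (y $ i) ^ (p i ! k))\<^sup>2 / 2"
  have term_eq: "cmod (?v $ i) ^ (2 * (p i ! k))
    = (cmod (z $ i) ^ (2 * (p i ! k)) + cmod (y $ i) ^ (2 * (p i ! k))) / 2 - ?d i k" for i k
  proof -
    have "cmod (?v $ i) ^ (2 * (p i ! k)) = (cmod (z $ i) * cmod (y $ i)) ^ (p i ! k)"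
      by (simp add: power_mult norm_power)
    also have "\<dots> = cmod (z $ i) ^ (p i ! k) * cmod (y $ i) ^ (p i ! k)" by (rule power_mult_distrib)
    also have "\<dots> = ((cmod (z $ i) ^ (p i ! k))\<^sup>2 + (cmod (y $ i) ^ (p i ! k))\<^sup>2) / 2 - ?d i k"
      by (simp add: power2_diff field_simps)
    finally show ?thesis by (simp add: power_mult mult.commute[of 2] power_even_eq flip: power_mult)
  qed
  have "lev p ?v = (\<Sum>i\<in>UNIV. \<Sum>k<length (p i).
      (cmod (z $ i) ^ (2 * (p i ! k)) + cmod (y $ i) ^ (2 * (p i ! k))) / 2 - ?d i k)"
    unfolding lev_def term_eq by (rule refl)
  also have "\<dots> = (lev p z + lev p y) / 2 - (\<Sum>i\<in>UNIV. \<Sum>k<length (p i). ?d i k)"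
    by (simp add: lev_def sum_subtractf sum.distrib sum_divide_distrib add_divide_distrib)
  finally have "lev p ?v = (lev p z + lev p y) / 2 - (\<Sum>i\<in>UNIV. \<Sum>k<length (p i). ?d i k)" .
  moreover have "(lev p z + lev p y) / 2 \<le> 1" using z y by (simp add: K_iff)
  moreover have "?d j l \<le> (\<Sum>k<length (p j). ?d j k)" by (rule member_le_sum) (use l in auto)
  moreover have "\<dots> \<le> (\<Sum>i\<in>UNIV. \<Sum>k<length (p i). ?d i k)"
    by (rule member_le_sum[of j]) (auto intro: sum_nonneg)
  ultimately show ?thesis by linarith
qed

text \<open>If the modulus of \<open>z\<^sub>j\<close> differs from that of the peak point \<open>y\<close>, strict convexity leaves room to dilate
  the coordinatewise geometric mean of \<open>z\<close> and \<open>y\<close> inside the domain; comparing the monomial there with its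
  maximum gives exponential decay.\<close>

lemma peak_decay:
  assumes \<eta>: "\<eta> > 0"
  shows "\<exists>s. 0 < s \<and> s < 1 \<and> (\<forall>\<alpha> y z. is_peak \<alpha> y \<longrightarrow> z \<in> K \<longrightarrow> \<eta> \<le> \<bar>(cmod (z $ j))\<^sup>2 - (cmod (y $ j))\<^sup>2\<bar> \<longrightarrow>
    cmod (monom_vec \<alpha> z) \<le> s ^ (2 * mdeg \<alpha>) * cmod (monom_vec \<alpha> y))"
proof -
  define n where "n = p j ! 0"
  have n: "n > 0" unfolding n_def by (rule exponent_pos[OF length_pos])
  \<comment> \<open>The sum of the exponents bounds each of them, so a dilation by
    \<open>1 / s\<close> multiplies \<open>lev\<close> by at most
    \<open>(1 / s) ^ (2 * P)\<close>.\<close>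
  define P where "P = (\<Sum>i\<in>UNIV. \<Sum>k<length (p i). p i ! k)"
  have le_P: "p i ! k \<le> P" if "k < length (p i)" for i k
  proof -
    have "p i ! k \<le> (\<Sum>k<length (p i). p i ! k)" by (rule member_le_sum) (use that in auto)
    also have "\<dots> \<le> P" unfolding P_def by (rule member_le_sum[of i]) auto
    finally show ?thesis .
  qed
  have P: "P > 0" using le_P[OF length_pos, of j] n by (simp add: n_def)
  \<comment> \<open>The moduli are at most 1, so a gap \<eta> in the squares gives a gap \<eta> / 2
    in the moduli and \<open>(\<eta> / 2) ^ n\<close> in their n-th powers. Half its square is the
    room left by the geometric mean. By Bernoulli's inequality the next constant \<open>s\<close>
    satisfies \<open>1 - \<delta> \<le> s ^ (2 * P)\<close>.\<close>
  define \<delta> where "\<delta> = min (1 / 2) ((\<eta> / 2) ^ (2 * n) / 2)"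
  have \<delta>: "0 < \<delta>" "\<delta> \<le> 1 / 2" using \<eta> by (auto simp: \<delta>_def)
  define s where "s = 1 - \<delta> / (2 * real P)"
  have x: "0 < \<delta> / (2 * real P)" "\<delta> / (2 * real P) \<le> \<delta>"
    using \<delta> P by (auto simp: field_simps)
  have s: "0 < s" "s < 1" using x \<delta> by (auto simp: s_def)
  have bern: "1 - \<delta> \<le> s ^ (2 * P)"
    using Bernoulli_inequality[of "- (\<delta> / (2 * real P))" "2 * P"] x \<delta> P by (simp add: s_def)
  have "cmod (monom_vec \<alpha> z) \<le> s ^ (2 * mdeg \<alpha>) * cmod (monom_vec \<alpha> y)"
    if pk: "is_peak \<alpha> y" and z: "z \<in> K" and far: "\<eta> \<le> \<bar>(cmod (z $ j))\<^sup>2 - (cmod (y $ j))\<^sup>2\<bar>" for \<alpha> y z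
  proof -
    have y: "y \<in> K" using pk by (simp add: is_peak_def)
    let ?a = "cmod (z $ j)" and ?b = "cmod (y $ j)"
    have "\<eta> \<le> \<bar>?a - ?b\<bar> * (?a + ?b)"
      using far by (simp add: power2_eq_square square_diff_square_factored abs_mult mult.commute)
    also have "\<dots> \<le> \<bar>?a - ?b\<bar> * 2"
      using K_nth_le[OF z, of j] K_nth_le[OF y, of j] by (intro mult_left_mono) auto
    finally have "\<eta> / 2 \<le> \<bar>?a - ?b\<bar>" by simp
    then have "(\<eta> / 2) ^ n \<le> \<bar>?a - ?b\<bar> ^ n" using \<eta> by (intro power_mono) auto
    also have "\<dots> \<le> \<bar>?a ^ n - ?b ^ n\<bar>" using n by (intro power_diff_ge) auto
    finally have "((\<eta> / 2) ^ n)\<^sup>2 \<le> (?a ^ n - ?b ^ n)\<^sup>2"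
      using \<eta> by (simp add: abs_le_square_iff[symmetric])
    moreover have "((\<eta> / 2) ^ n)\<^sup>2 = (\<eta> / 2) ^ (2 * n)" by (simp add: mult.commute flip: power_mult)
    ultimately have room: "\<delta> \<le> (?a ^ n - ?b ^ n)\<^sup>2 / 2" unfolding \<delta>_def by linarith
    define v :: "complex ^ 'n" where "v = (\<chi> i. of_real (sqrt (cmod (z $ i) * cmod (y $ i))))"
    have lev_v: "lev p v \<le> s ^ (2 * P)"
      using lev_geometric_mean[OF z y length_pos, of j] room bern unfolding v_def n_def by linarith
    define u where "u = scale_coords (\<lambda>_. of_real (1 / s)) v"
    have "lev p u \<le> (1 / s) ^ (2 * P) * lev p v"
      unfolding lev_def sum_distrib_left
    proof (intro sum_mono)
      fix i k assume "k \<in> {..<length (p i)}"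
      then have "p i ! k \<le> P" using le_P by simp
      then have "(1 / s) ^ (2 * (p i ! k)) \<le> (1 / s) ^ (2 * P)"
        using s by (intro power_increasing) auto
      then have "(1 / s) ^ (2 * (p i ! k)) * cmod (v $ i) ^ (2 * (p i ! k)) \<le> (1 / s) ^ (2 * P) * cmod (v $ i) ^ (2 * (p i ! k))"
        by (rule mult_right_mono) simp
      moreover have "cmod (u $ i) = 1 / s * cmod (v $ i)" using s by (simp add: u_def norm_mult norm_divide)
      ultimately show "cmod (u $ i) ^ (2 * (p i ! k)) \<le> (1 / s) ^ (2 * P) * cmod (v $ i) ^ (2 * (p i ! k))"
        by (simp only: power_mult_distrib)
    qed
    also have "\<dots> \<le> (1 / s) ^ (2 * P) * s ^ (2 * P)" using lev_v s by (intro mult_left_mono) auto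
    also have "\<dots> = 1" using s by (simp add: power_divide)
    finally have "u \<in> K" by (simp add: K_iff)
    then have "cmod (monom_vec \<alpha> u) \<le> cmod (monom_vec \<alpha> y)" using pk by (simp add: is_peak_def)
    then have "s ^ mdeg \<alpha> * cmod (monom_vec \<alpha> u) \<le> s ^ mdeg \<alpha> * cmod (monom_vec \<alpha> y)"
      using s by (intro mult_left_mono) auto
    moreover have "cmod (monom_vec \<alpha> v) = s ^ mdeg \<alpha> * cmod (monom_vec \<alpha> u)"
      using s unfolding u_def monom_vec_scale_coords
      by (simp add: norm_mult norm_power norm_divide mdeg_def power_sum power_divide prod_dividef flip: prod_norm)
    ultimately have v_le: "cmod (monom_vec \<alpha> v) \<le> s ^ mdeg \<alpha> * cmod (monom_vec \<alpha> y)" by simp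
    \<comment> \<open>The monomial is multiplicative on geometric means. The bound for
      \<open>v\<close> is therefore a bound for the product of the values at \<open>z\<close> and
      \<open>y\<close>, and dividing by the value at the peak squares the decay factor.\<close>
    have "(cmod (monom_vec \<alpha> v))\<^sup>2 = cmod (monom_vec \<alpha> z) * cmod (monom_vec \<alpha> y)"
    proof -
      have sq: "(sqrt x ^ a)\<^sup>2 = x ^ a" if "x \<ge> 0" for x :: real and a
        using that by (simp only: power_mult[symmetric] mult.commute[of a 2]) (simp add: power_mult)
      have "cmod (monom_vec \<alpha> v) = (\<Prod>i\<in>UNIV. sqrt (cmod (z $ i) * cmod (y $ i)) ^ \<alpha> i)"
        by (simp add: monom_vec_def v_def norm_power flip: prod_norm)
      then have "(cmod (monom_vec \<alpha> v))\<^sup>2 = (\<Prod>i\<in>UNIV. (sqrt (cmod (z $ i) * cmod (y $ i)) ^ \<alpha> i)\<^sup>2)"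
        by (simp only: prod_power_distrib)
      also have "\<dots> = (\<Prod>i\<in>UNIV. (cmod (z $ i) * cmod (y $ i)) ^ \<alpha> i)"
        by (intro prod.cong refl sq) simp
      finally show ?thesis
        by (simp add: monom_vec_def norm_power power_mult_distrib prod.distrib flip: prod_norm)
    qed
    then have "cmod (monom_vec \<alpha> z) * cmod (monom_vec \<alpha> y) \<le> (s ^ mdeg \<alpha> * cmod (monom_vec \<alpha> y))\<^sup>2"
      using power_mono[OF v_le norm_ge_zero, of 2] by simp
    then have le: "cmod (monom_vec \<alpha> z) * cmod (monom_vec \<alpha> y)
        \<le> (s ^ (2 * mdeg \<alpha>) * cmod (monom_vec \<alpha> y)) * cmod (monom_vec \<alpha> y)"
      by (simp add: power_mult_distrib power2_eq_square[of "cmod _"] mult.commute[of 2] power_mult mult.assoc)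
    show ?thesis
    proof (cases "cmod (monom_vec \<alpha> y) = 0")
      case True
      moreover have "cmod (monom_vec \<alpha> z) \<le> cmod (monom_vec \<alpha> y)" using pk z by (simp add: is_peak_def)
      ultimately show ?thesis by simp
    next
      case False
      then show ?thesis using mult_right_le_imp_le[OF le] by simp
    qed
  qed
  then show ?thesis using s by blast
qed

text \<open>A ball around a small point with equal positive coordinates. Positive real parts exclude
  cancellation when such points are added to a point with nonnegative coordinates.\<close>

lemma corner_ball:
  obtains b \<rho> d where "\<rho> > 0" "d > 0" "\<And>w. w \<in> ball b \<rho> \<Longrightarrow> w \<in> K"
    "\<And>w i. w \<in> ball b \<rho> \<Longrightarrow> d \<le> Re (w $ i)"
proof -
  obtain r where r: "r > 0" "ball 0 r \<subseteq> Omega p"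
    using open_Omega zero_mem_Omega open_contains_ball by blast
  define d where "d = r / (4 * real CARD('n))"
  have d: "d > 0" using r(1) by (simp add: d_def)
  define b :: "complex ^ 'n" where "b = (\<chi> i. of_real (2 * d))"
  have "norm b \<le> (\<Sum>i\<in>UNIV. norm (b $ i))" unfolding norm_vec_def by (rule L2_set_le_sum) auto
  also have "\<dots> = real CARD('n) * (2 * d)" using d by (simp add: b_def norm_mult)
  also have "\<dots> = r / 2" by (simp add: d_def)
  finally have nb: "norm b \<le> r / 2" .
  define \<rho> where "\<rho> = min d (r / 2)"
  show thesis
  proof (rule that[of \<rho> d b])
    fix w assume w: "w \<in> ball b \<rho>"
    have "norm w \<le> norm b + dist b w"
      using norm_triangle_ineq[of b "w - b"] by (simp add: dist_norm norm_minus_commute)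
    also have "\<dots> < r" using nb w by (simp add: \<rho>_def)
    finally have "w \<in> ball 0 r" by simp
    then show "w \<in> K" using r(2) closure_subset[of "Omega p"] by blast
    fix i
    have "\<bar>Re ((b - w) $ i)\<bar> \<le> norm (b - w)"
      by (rule order_trans[OF abs_Re_le_cmod Finite_Cartesian_Product.norm_nth_le])
    also have "\<dots> < d" using w by (simp add: dist_norm \<rho>_def)
    finally show "d \<le> Re (w $ i)" by (simp add: b_def)
  qed (use d r in \<open>auto simp: \<rho>_def\<close>)
qed

text \<open>The set is t y' + (1 - t) B, with B the corner ball and y' the point of moduli of y. It
  lies in \<open>K\<close> by convexity, and its volume does not depend on y, which makes
  \<open>c\<close> uniform.\<close>

lemma large_near_peak:
  assumes t: "0 < t" "t < 1"
  shows "\<exists>c \<kappa>. 0 < c \<and> 0 < \<kappa> \<and> (\<forall>y\<in>K. \<exists>S. S \<in> sets (nu p) \<and> c \<le> measure (nu p) S \<and>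
    (\<forall>u\<in>S. \<forall>i. t * cmod (y $ i) \<le> cmod (u $ i) \<and> \<kappa> \<le> cmod (u $ i)))"
proof -
  obtain b \<rho> d where b: "\<rho> > 0" "d > 0" "\<And>w. w \<in> ball b \<rho> \<Longrightarrow> w \<in> K"
    "\<And>w i. w \<in> ball b \<rho> \<Longrightarrow> d \<le> Re (w $ i)" by (rule corner_ball) blast
  define c where "c = measure lborel (ball (0 :: complex ^ 'n) ((1 - t) * \<rho>)) / measure lborel K"
  have mK: "measure lborel K > 0"
    using emeasure_K_pos emeasure_compact_finite[OF compact_K]
    by (simp add: measure_def enn2real_positive_iff zero_less_iff_neq_zero)
  have c: "c > 0" using t b(1) mK by (simp add: c_def)
  have "\<exists>S. S \<in> sets (nu p) \<and> c \<le> measure (nu p) S \<and>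
    (\<forall>u\<in>S. \<forall>i. t * cmod (y $ i) \<le> cmod (u $ i) \<and> (1 - t) * d \<le> cmod (u $ i))" if y: "y \<in> K" for y
  proof -
    \<comment> \<open>Passing to moduli stays in the domain and makes all coordinates nonnegative,
      so real parts add up.\<close>
    define y' :: "complex ^ 'n" where "y' = (\<chi> i. of_real (cmod (y $ i)))"
    have y'K: "y' \<in> K" by (rule K_mono[OF y]) (simp add: y'_def)
    define S where "S = ball (t *\<^sub>R y' + (1 - t) *\<^sub>R b) ((1 - t) * \<rho>)"
    have rep: "u \<in> K \<and> (\<forall>i. t * cmod (y $ i) + (1 - t) * d \<le> cmod (u $ i))" if u: "u \<in> S" for u
    proof -
      define w where "w = (1 / (1 - t)) *\<^sub>R (u - t *\<^sub>R y')"
      have "(1 - t) *\<^sub>R w = u - t *\<^sub>R y'" using t by (simp add: w_def)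
      then have uw: "u = t *\<^sub>R y' + (1 - t) *\<^sub>R w" by simp
      have "dist (t *\<^sub>R y' + (1 - t) *\<^sub>R b) u = (1 - t) * dist b w"
      proof -
        have "(t *\<^sub>R y' + (1 - t) *\<^sub>R b) - u = (1 - t) *\<^sub>R (b - w)"
          unfolding uw by (simp add: scaleR_diff_right)
        then show ?thesis using t by (simp add: dist_norm)
      qed
      then have "(1 - t) * dist b w < (1 - t) * \<rho>" using u by (simp add: S_def)
      then have w: "w \<in> ball b \<rho>" using t by simp
      have "u \<in> K" unfolding uw using convex_K y'K b(3)[OF w] t by (intro convexD) auto
      moreover have "t * cmod (y $ i) + (1 - t) * d \<le> cmod (u $ i)" for i
      proof -
        have "t * cmod (y $ i) + (1 - t) * d \<le> t * cmod (y $ i) + (1 - t) * Re (w $ i)"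
          using b(4)[OF w] t by (intro add_left_mono mult_left_mono) auto
        also have "\<dots> = Re (u $ i)" unfolding uw by (simp add: y'_def)
        also have "\<dots> \<le> cmod (u $ i)" by (rule complex_Re_le_cmod)
        finally show ?thesis .
      qed
      ultimately show ?thesis by blast
    qed
    have SK: "S \<subseteq> K" using rep by blast
    have Sborel: "S \<in> sets borel" by (simp add: S_def)
    have Ssets: "S \<in> sets (nu p)" using SK by (auto simp: sets_nu sets_restrict_space S_def)
    have "measure (nu p) S = c"
    proof -
      have eS: "emeasure lborel S = emeasure lborel (ball (0 :: complex ^ 'n) ((1 - t) * \<rho>))"
        using t b(1) by (simp add: S_def emeasure_ball)
      also have "\<dots> = ennreal (measure lborel (ball (0 :: complex ^ 'n) ((1 - t) * \<rho>)))"
        using emeasure_lborel_ball_finite[of "0 :: complex ^ 'n" "(1 - t) * \<rho>"]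
        by (intro emeasure_eq_ennreal_measure) auto
      finally have "emeasure (nu p) S = ennreal c"
        using emeasure_nu[OF Sborel SK] emeasure_eq_ennreal_measure[of lborel K] emeasure_K_finite mK
        by (simp add: c_def divide_ennreal)
      then show ?thesis using c by (simp add: measure_def)
    qed
    moreover have "t * cmod (y $ i) \<le> cmod (u $ i) \<and> (1 - t) * d \<le> cmod (u $ i)" if "u \<in> S" for u i
    proof -
      have "0 \<le> t * cmod (y $ i)" "0 \<le> (1 - t) * d" using t b(2) by auto
      moreover have "t * cmod (y $ i) + (1 - t) * d \<le> cmod (u $ i)" using rep[OF that] by blast
      ultimately show ?thesis by linarith
    qed
    ultimately show ?thesis using Ssets by (intro exI[of _ S] conjI ballI allI) simp_all
  qed
  moreover have "0 < (1 - t) * d" using t b(2) by simp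
  ultimately show ?thesis using c by (intro exI[of _ c] exI[of _ "(1 - t) * d"] conjI ballI)
qed

section \<open>Uniform concentration of the monomial measures\<close>

abbreviation (input) mass :: "('n \<Rightarrow> nat) \<Rightarrow> real" where
  "mass \<alpha> \<equiv> LINT z|nu p. (cmod (monom_vec \<alpha> z))\<^sup>2"

abbreviation (input) coord_mass :: "'n \<Rightarrow> ('n \<Rightarrow> nat) \<Rightarrow> real" where
  "coord_mass j \<alpha> \<equiv> LINT z|nu p. (cmod (monom_vec \<alpha> z))\<^sup>2 * (cmod (z $ j))\<^sup>2"

text \<open>The bad region costs at most \<open>b * measure (nu p) K\<close>. This is compared with
  both denominators that occur later: \<open>coord_mass\<close> for the variance and
  \<open>mass\<close> for exponents that vanish at \<open>j\<close>.\<close>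

abbreviation (input) off_peak_bound :: "'n \<Rightarrow> real \<Rightarrow> real \<Rightarrow> ('n \<Rightarrow> nat) \<Rightarrow> complex ^ 'n \<Rightarrow> bool" where
  "off_peak_bound j \<theta> \<epsilon> \<alpha> y \<equiv> \<exists>b.
    (\<forall>z\<in>K. \<theta> \<le> \<bar>(cmod (z $ j))\<^sup>2 - (cmod (y $ j))\<^sup>2\<bar> \<longrightarrow> (cmod (monom_vec \<alpha> z))\<^sup>2 \<le> b) \<and> 0 \<le> b \<and>
    b * measure (nu p) K \<le> \<epsilon> * mass \<alpha> \<and> b * measure (nu p) K \<le> \<epsilon> * coord_mass j \<alpha>"

text \<open>On the set of \<open>large_near_peak\<close> the monomial is at least
  \<open>t ^ mdeg \<alpha>\<close> times its value at \<open>y\<close>. The loss is exponential in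
  the degree, but its rate \<open>t\<close> can be prescribed, while \<open>c\<close> depends
  neither on the exponent nor on the point.\<close>

lemma integral_ge_near_peak:
  assumes t: "0 < t" "t < 1"
  shows "\<exists>c. c > 0 \<and> (\<forall>\<alpha>. \<forall>y\<in>K.
    c * t ^ (2 * mdeg \<alpha>) * (cmod (monom_vec \<alpha> y))\<^sup>2 \<le> mass \<alpha> \<and>
    c * t ^ (2 * mdeg \<alpha>) * (cmod (monom_vec \<alpha> y))\<^sup>2 \<le> coord_mass j \<alpha>)"
proof -
  obtain c \<kappa> where c: "0 < c" "0 < \<kappa>" and near: "\<forall>y\<in>K. \<exists>S. S \<in> sets (nu p) \<and> c \<le> measure (nu p) S \<and>
    (\<forall>u\<in>S. \<forall>i. t * cmod (y $ i) \<le> cmod (u $ i) \<and> \<kappa> \<le> cmod (u $ i))"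
    using large_near_peak[OF t] by (elim exE conjE)
  \<comment> \<open>A lower bound on that set for both weights used below, the constant 1 and
    \<open>(cmod (z $ j))\<^sup>2\<close>.\<close>
  define m where "m = min 1 (\<kappa>\<^sup>2)"
  have m: "0 < m" "m \<le> 1" "m \<le> \<kappa>\<^sup>2" using c(2) by (auto simp: m_def)
  have ge: "(c * m) * t ^ (2 * mdeg \<alpha>) * (cmod (monom_vec \<alpha> y))\<^sup>2 \<le> (LINT z|nu p. (cmod (monom_vec \<alpha> z))\<^sup>2 * h z)"
    if y: "y \<in> K" and h: "continuous_on K h" "\<And>z. z \<in> K \<Longrightarrow> 0 \<le> h z" "\<And>z. z \<in> K \<Longrightarrow> (\<And>i. \<kappa> \<le> cmod (z $ i)) \<Longrightarrow> m \<le> h z"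
    for \<alpha> y and h :: "complex ^ 'n \<Rightarrow> real"
  proof -
    from bspec[OF near y] obtain S where S: "S \<in> sets (nu p)" "c \<le> measure (nu p) S"
      and S_near: "\<forall>u\<in>S. \<forall>i. t * cmod (y $ i) \<le> cmod (u $ i) \<and> \<kappa> \<le> cmod (u $ i)" by (elim exE conjE)
    have finS: "emeasure (nu p) S < \<infinity>"
      unfolding infinity_ennreal_def
      by (rule top.not_eq_extremum[THEN iffD1, OF nu.emeasure_finite[unfolded infinity_ennreal_def]])
    let ?b = "t ^ (2 * mdeg \<alpha>) * (cmod (monom_vec \<alpha> y))\<^sup>2 * m"
    have b0: "?b \<ge> 0" using t m by simp
    have le: "?b * indicator S z \<le> (cmod (monom_vec \<alpha> z))\<^sup>2 * h z" if z: "z \<in> K" for z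
    proof (cases "z \<in> S")
      case True
      have "t ^ mdeg \<alpha> * cmod (monom_vec \<alpha> y) \<le> cmod (monom_vec \<alpha> z)"
        using S_near True t by (intro norm_monom_vec_ge) auto
      then have "(t ^ mdeg \<alpha> * cmod (monom_vec \<alpha> y))\<^sup>2 \<le> (cmod (monom_vec \<alpha> z))\<^sup>2"
        using t by (intro power_mono) auto
      moreover have "(t ^ mdeg \<alpha> * cmod (monom_vec \<alpha> y))\<^sup>2 = t ^ (2 * mdeg \<alpha>) * (cmod (monom_vec \<alpha> y))\<^sup>2"
        by (simp only: power_mult_distrib power_mult[symmetric] mult.commute[of 2])
      ultimately have "?b \<le> (cmod (monom_vec \<alpha> z))\<^sup>2 * h z"
        using h(3)[OF z] S_near True m(1) by (intro mult_mono) auto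
      then show ?thesis using True by simp
    next
      case False
      then show ?thesis using h(2)[OF z] by simp
    qed
    have "?b * c \<le> ?b * measure (nu p) S" using S(2) b0 by (rule mult_left_mono)
    also have "\<dots> = (LINT z|nu p. ?b * indicator S z)"
      using S(1) sets.sets_into_space[OF S(1)] by (simp add: Int_absorb2)
    also have "\<dots> \<le> (LINT z|nu p. (cmod (monom_vec \<alpha> z))\<^sup>2 * h z)"
    proof (rule integral_mono)
      show "integrable (nu p) (\<lambda>z. ?b * indicator S z)"
        by (intro integrable_mult_right integrable_real_indicator[OF S(1) finS])
      show "integrable (nu p) (\<lambda>z. (cmod (monom_vec \<alpha> z))\<^sup>2 * h z)"
        using h(1) by (intro integrable_nu_continuous continuous_intros)
    qed (use le in simp)
    finally show ?thesis by (simp add: mult_ac)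
  qed
  have "(c * m) * t ^ (2 * mdeg \<alpha>) * (cmod (monom_vec \<alpha> y))\<^sup>2 \<le> (LINT z|nu p. (cmod (monom_vec \<alpha> z))\<^sup>2 * 1)"
    if "y \<in> K" for \<alpha> y
    using m by (intro ge[OF that] continuous_intros) auto
  moreover have "(c * m) * t ^ (2 * mdeg \<alpha>) * (cmod (monom_vec \<alpha> y))\<^sup>2 \<le> coord_mass j \<alpha>"
    if "y \<in> K" for \<alpha> y
  proof (intro ge[OF that] continuous_intros)
    show "m \<le> (cmod (z $ j))\<^sup>2" if "\<And>i. \<kappa> \<le> cmod (z $ i)" for z :: "complex ^ 'n"
    proof -
      have "\<kappa>\<^sup>2 \<le> (cmod (z $ j))\<^sup>2" using that[of j] c(2) by (intro power_mono) auto
      then show ?thesis using m(3) by simp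
    qed
  qed simp
  ultimately show ?thesis using c m by (intro exI[of _ "c * m"]) simp
qed

text \<open>The rate \<open>s\<close> of \<open>peak_decay\<close> is also used as \<open>t\<close>
  in \<open>integral_ge_near_peak\<close>. Off the peak the squared monomial is at most
  \<open>s ^ (4 * mdeg \<alpha>)\<close> times its maximum, while the masses are at least
  \<open>c * s ^ (2 * mdeg \<alpha>)\<close> times it, so the quotient tends to 0 uniformly.\<close>

lemma off_peak_mass_small:
  assumes \<theta>: "\<theta> > 0" "\<epsilon> > 0"
  shows "\<exists>N. \<forall>\<alpha> y. N \<le> mdeg \<alpha> \<longrightarrow> is_peak \<alpha> y \<longrightarrow> off_peak_bound j \<theta> \<epsilon> \<alpha> y"
proof -
  obtain s where s: "0 < s" "s < 1" and decay: "\<forall>\<alpha> y z. is_peak \<alpha> y \<longrightarrow> z \<in> K \<longrightarrow> \<theta> \<le> \<bar>(cmod (z $ j))\<^sup>2 - (cmod (y $ j))\<^sup>2\<bar> \<longrightarrow>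
    cmod (monom_vec \<alpha> z) \<le> s ^ (2 * mdeg \<alpha>) * cmod (monom_vec \<alpha> y)"
    using peak_decay[OF \<theta>(1), of j] by (elim exE conjE)
  obtain c where c: "c > 0" and low: "\<forall>\<alpha>. \<forall>y\<in>K.
    c * s ^ (2 * mdeg \<alpha>) * (cmod (monom_vec \<alpha> y))\<^sup>2 \<le> mass \<alpha> \<and>
    c * s ^ (2 * mdeg \<alpha>) * (cmod (monom_vec \<alpha> y))\<^sup>2 \<le> coord_mass j \<alpha>"
    using integral_ge_near_peak[OF s, of j] by (elim exE conjE)
  have mu: "measure (nu p) K \<ge> 0" by simp
  obtain N where N: "s ^ N < \<epsilon> * c / (measure (nu p) K + 1)"
    using real_arch_pow_inv[of "\<epsilon> * c / (measure (nu p) K + 1)" s] s c \<theta>(2) mu by auto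
  have "\<exists>b. (\<forall>z\<in>K. \<theta> \<le> \<bar>(cmod (z $ j))\<^sup>2 - (cmod (y $ j))\<^sup>2\<bar> \<longrightarrow> (cmod (monom_vec \<alpha> z))\<^sup>2 \<le> b) \<and> 0 \<le> b \<and>
    b * measure (nu p) K \<le> \<epsilon> * mass \<alpha> \<and>
    b * measure (nu p) K \<le> \<epsilon> * coord_mass j \<alpha>"
    if deg: "N \<le> mdeg \<alpha>" and pk: "is_peak \<alpha> y" for \<alpha> y
  proof -
    have y: "y \<in> K" using pk by (simp add: is_peak_def)
    let ?M = "(cmod (monom_vec \<alpha> y))\<^sup>2"
    define b where "b = (s ^ (2 * mdeg \<alpha>))\<^sup>2 * ?M"
    have b0: "b \<ge> 0" by (simp add: b_def)
    have "(cmod (monom_vec \<alpha> z))\<^sup>2 \<le> b" if "z \<in> K" "\<theta> \<le> \<bar>(cmod (z $ j))\<^sup>2 - (cmod (y $ j))\<^sup>2\<bar>" for z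
    proof -
      have "cmod (monom_vec \<alpha> z) \<le> s ^ (2 * mdeg \<alpha>) * cmod (monom_vec \<alpha> y)"
        by (rule decay[rule_format, OF pk that])
      then have "(cmod (monom_vec \<alpha> z))\<^sup>2 \<le> (s ^ (2 * mdeg \<alpha>) * cmod (monom_vec \<alpha> y))\<^sup>2"
        by (intro power_mono) auto
      then show ?thesis by (simp only: b_def power_mult_distrib)
    qed
    moreover have small: "b * measure (nu p) K \<le> \<epsilon> * (c * s ^ (2 * mdeg \<alpha>) * ?M)"
    proof -
      have "s ^ (2 * mdeg \<alpha>) \<le> s ^ N" using s deg by (intro power_decreasing) auto
      then have "s ^ (2 * mdeg \<alpha>) \<le> \<epsilon> * c / (measure (nu p) K + 1)" using N by simp
      then have "s ^ (2 * mdeg \<alpha>) * (measure (nu p) K + 1) \<le> \<epsilon> * c"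
        using mu by (simp add: pos_le_divide_eq)
      moreover have "s ^ (2 * mdeg \<alpha>) * measure (nu p) K \<le> s ^ (2 * mdeg \<alpha>) * (measure (nu p) K + 1)"
        using s by (intro mult_left_mono) auto
      ultimately have "s ^ (2 * mdeg \<alpha>) * measure (nu p) K \<le> \<epsilon> * c" by linarith
      then have "(s ^ (2 * mdeg \<alpha>) * measure (nu p) K) * (s ^ (2 * mdeg \<alpha>) * ?M) \<le> (\<epsilon> * c) * (s ^ (2 * mdeg \<alpha>) * ?M)"
        using s by (intro mult_right_mono) auto
      then show ?thesis by (simp add: b_def power2_eq_square[of "s ^ _"] mult_ac)
    qed
    moreover have "\<epsilon> * (c * s ^ (2 * mdeg \<alpha>) * ?M) \<le> \<epsilon> * mass \<alpha>"
      using low y \<theta>(2) by (intro mult_left_mono) auto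
    moreover have "\<epsilon> * (c * s ^ (2 * mdeg \<alpha>) * ?M) \<le> \<epsilon> * coord_mass j \<alpha>"
      using low y \<theta>(2) by (intro mult_left_mono) auto
    ultimately show ?thesis using b0 by (intro exI[of _ b] conjI) auto
  qed
  then show ?thesis by blast
qed

text \<open>Centring at the peak value \<open>\<tau>\<close> of \<open>|z\<^sub>j|\<^sup>2\<close> works when \<open>\<tau>\<close> is not too small, and centring at \<open>0\<close> otherwise.\<close>

lemma monom_variance_small:
  assumes \<epsilon>: "\<epsilon> > 0"
  shows "\<exists>N. \<forall>\<beta>. N \<le> mdeg \<beta> \<longrightarrow> (\<exists>c. (LINT z|nu p. (cmod (monom_vec \<beta> z))\<^sup>2 * ((cmod (z $ j))\<^sup>2 - c)\<^sup>2)
    \<le> \<epsilon> * coord_mass j \<beta>)"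
proof -
  \<comment> \<open>Let t be \<open>(cmod (z $ j))\<^sup>2\<close>, within \<theta>^2 of \<tau>. If
    \<theta> \<le> \<tau>, then t is at least \<theta>/2 and (t - \<tau>)^2 is at most 2 \<theta> t;
    if \<tau> < \<theta>, then t is at most 2 \<theta>, and t^2 is at most 2 \<theta> t. In both
    cases 2 \<theta> \<le> \<epsilon>/2 leaves the other half of \<epsilon> for the points off the
    peak.\<close>
  define \<theta> where "\<theta> = min (1/2) (\<epsilon> / 4)"
  have \<theta>: "0 < \<theta>" "\<theta> \<le> 1/2" "2 * \<theta> \<le> \<epsilon> / 2" using \<epsilon> by (auto simp: \<theta>_def)
  have \<theta>2: "\<theta>\<^sup>2 > 0" "\<theta>\<^sup>2 \<le> \<theta> / 2" using \<theta> by (auto simp: power2_eq_square)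
  obtain N where N: "\<forall>\<alpha> y. N \<le> mdeg \<alpha> \<longrightarrow> is_peak \<alpha> y \<longrightarrow> off_peak_bound j (\<theta>\<^sup>2) (\<epsilon> / 2) \<alpha> y"
    using off_peak_mass_small[OF \<theta>2(1) half_gt_zero[OF \<epsilon>], of j] by (elim exE)
  have "\<exists>c. (LINT z|nu p. (cmod (monom_vec \<beta> z))\<^sup>2 * ((cmod (z $ j))\<^sup>2 - c)\<^sup>2)
    \<le> \<epsilon> * coord_mass j \<beta>" if deg: "N \<le> mdeg \<beta>" for \<beta>
  proof -
    obtain y where pk: "is_peak \<beta> y" using ex_peak by blast
    define \<tau> where "\<tau> = (cmod (y $ j))\<^sup>2"
    have \<tau>: "0 \<le> \<tau>" "\<tau> \<le> 1"
      using pk K_nth_le[of y j] by (auto simp: \<tau>_def is_peak_def power_le_one)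
    obtain b where b: "\<forall>z\<in>K. \<theta>\<^sup>2 \<le> \<bar>(cmod (z $ j))\<^sup>2 - \<tau>\<bar> \<longrightarrow> (cmod (monom_vec \<beta> z))\<^sup>2 \<le> b" "0 \<le> b"
      "b * measure (nu p) K \<le> \<epsilon> / 2 * coord_mass j \<beta>"
      using N[rule_format, OF deg pk] unfolding \<tau>_def[symmetric] by (elim exE conjE)
    define c where "c = (if \<theta> \<le> \<tau> then \<tau> else 0)"
    have c: "0 \<le> c" "c \<le> 1" using \<tau> by (auto simp: c_def)
    have pt: "(cmod (monom_vec \<beta> z))\<^sup>2 * ((cmod (z $ j))\<^sup>2 - c)\<^sup>2
      \<le> \<epsilon> / 2 * ((cmod (monom_vec \<beta> z))\<^sup>2 * (cmod (z $ j))\<^sup>2) + b" if z: "z \<in> K" for z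
    proof -
      let ?t = "(cmod (z $ j))\<^sup>2" and ?m = "(cmod (monom_vec \<beta> z))\<^sup>2"
      have t: "0 \<le> ?t" "?t \<le> 1" using K_nth_le[OF z, of j] by (auto simp: power_le_one)
      show ?thesis
      proof (cases "\<theta>\<^sup>2 \<le> \<bar>?t - \<tau>\<bar>")
        case True
        have "\<bar>?t - c\<bar> \<le> 1" using t c by linarith
        then have "(?t - c)\<^sup>2 \<le> 1" using abs_square_le_1 by blast
        then have "?m * (?t - c)\<^sup>2 \<le> ?m * 1" by (intro mult_left_mono) auto
        also have "\<dots> \<le> b" using b(1) z True by simp
        also have "\<dots> \<le> \<epsilon> / 2 * (?m * ?t) + b" using \<epsilon> by simp
        finally show ?thesis .
      next
        case False
        have "(?t - c)\<^sup>2 \<le> 2 * \<theta> * ?t"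
        proof (cases "\<theta> \<le> \<tau>")
          case True
          have ab: "\<bar>?t - \<tau>\<bar> \<le> \<theta>\<^sup>2" using False by simp
          then have tge: "\<theta> / 2 \<le> ?t" using True \<theta>2 by linarith
          have "(?t - \<tau>)\<^sup>2 \<le> \<theta>\<^sup>2 * \<theta>\<^sup>2"
            using abs_le_square_iff[of "?t - \<tau>" "\<theta>\<^sup>2"] ab by (simp add: power2_eq_square[of "\<theta>\<^sup>2"])
          also have "\<dots> \<le> 1 * (\<theta> * (\<theta> / 2 * 2))"
            using \<theta> by (intro mult_mono) (auto simp: power2_eq_square mult_le_one)
          also have "\<dots> \<le> 2 * \<theta> * ?t" using tge \<theta>(1) by (simp add: mult_left_mono)
          finally show ?thesis using True by (simp add: c_def)
        next
          case F: False
          have "?t \<le> \<tau> + \<theta>\<^sup>2" using False by linarith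
          then have "?t \<le> 2 * \<theta>" using F \<theta>2 \<theta>(1) by linarith
          then have "?t * ?t \<le> 2 * \<theta> * ?t" using t by (intro mult_right_mono) auto
          then show ?thesis using F by (simp add: c_def power2_eq_square[of ?t])
        qed
        also have "\<dots> \<le> \<epsilon> / 2 * ?t" using \<theta>(3) t by (intro mult_right_mono) auto
        finally have "?m * (?t - c)\<^sup>2 \<le> ?m * (\<epsilon> / 2 * ?t)" by (intro mult_left_mono) auto
        then show ?thesis using b(2) by (simp add: mult_ac)
      qed
    qed
    have int: "integrable (nu p) (\<lambda>z. (cmod (monom_vec \<beta> z))\<^sup>2 * (cmod (z $ j))\<^sup>2)"
      "integrable (nu p) (\<lambda>z. (cmod (monom_vec \<beta> z))\<^sup>2 * ((cmod (z $ j))\<^sup>2 - c)\<^sup>2)"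
      by (intro integrable_nu_continuous continuous_intros)+
    have "(LINT z|nu p. (cmod (monom_vec \<beta> z))\<^sup>2 * ((cmod (z $ j))\<^sup>2 - c)\<^sup>2)
      \<le> (LINT z|nu p. \<epsilon> / 2 * ((cmod (monom_vec \<beta> z))\<^sup>2 * (cmod (z $ j))\<^sup>2) + b)"
      using pt int by (intro integral_mono Bochner_Integration.integrable_add integrable_mult_right nu.integrable_const) auto
    also have "\<dots> = \<epsilon> / 2 * coord_mass j \<beta> + b * measure (nu p) K"
      using int(1) nu.integrable_const by (subst Bochner_Integration.integral_add) (auto simp: mult.commute)
    also have "\<dots> \<le> \<epsilon> * coord_mass j \<beta>"
      using b(3) by (simp add: field_simps)
    finally show ?thesis by blast
  qed
  then show ?thesis by blast
qed

text \<open>The monomial does not involve \<open>z $ j\<close>, so setting this coordinate of a peak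
  to 0 gives another peak. The mass then concentrates where \<open>z $ j\<close> is small.\<close>

lemma monom_missing_coord_small:
  assumes \<epsilon>: "\<epsilon> > 0"
  shows "\<exists>N. \<forall>\<alpha>. N \<le> mdeg \<alpha> \<longrightarrow> \<alpha> j = 0 \<longrightarrow>
    coord_mass j \<alpha> \<le> \<epsilon> * mass \<alpha>"
proof -
  have e2: "\<epsilon> / 2 > 0" using \<epsilon> by simp
  obtain N where N: "\<forall>\<alpha> y. N \<le> mdeg \<alpha> \<longrightarrow> is_peak \<alpha> y \<longrightarrow> off_peak_bound j (\<epsilon> / 2) (\<epsilon> / 2) \<alpha> y"
    using off_peak_mass_small[OF e2 e2, of j] by (elim exE)
  have "coord_mass j \<alpha> \<le> \<epsilon> * mass \<alpha>"
    if deg: "N \<le> mdeg \<alpha>" and \<alpha>j: "\<alpha> j = 0" for \<alpha>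
  proof -
    obtain y' where pk': "is_peak \<alpha> y'" using ex_peak by blast
    define y where "y = coord_scale j 0 y'"
    have "monom_vec \<alpha> y = monom_vec \<alpha> y'"
      unfolding y_def monom_vec_def using \<alpha>j by (intro prod.cong) auto
    moreover have "y \<in> K" unfolding y_def using pk' by (intro coord_scale_mem_K) (auto simp: is_peak_def)
    ultimately have pk: "is_peak \<alpha> y" using pk' by (simp add: is_peak_def)
    have yj: "y $ j = 0" by (simp add: y_def)
    obtain b where "\<forall>z\<in>K. \<epsilon> / 2 \<le> \<bar>(cmod (z $ j))\<^sup>2 - (cmod (y $ j))\<^sup>2\<bar> \<longrightarrow> (cmod (monom_vec \<alpha> z))\<^sup>2 \<le> b" "0 \<le> b"
      and b3: "b * measure (nu p) K \<le> \<epsilon> / 2 * mass \<alpha>"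
      using N[rule_format, OF deg pk] by (elim exE conjE)
    then have b: "\<And>z. z \<in> K \<Longrightarrow> \<epsilon> / 2 \<le> (cmod (z $ j))\<^sup>2 \<Longrightarrow> (cmod (monom_vec \<alpha> z))\<^sup>2 \<le> b" "0 \<le> b"
      by (auto simp: yj)
    have pt: "(cmod (monom_vec \<alpha> z))\<^sup>2 * (cmod (z $ j))\<^sup>2 \<le> \<epsilon> / 2 * (cmod (monom_vec \<alpha> z))\<^sup>2 + b" if z: "z \<in> K" for z
    proof -
      let ?t = "(cmod (z $ j))\<^sup>2" and ?m = "(cmod (monom_vec \<alpha> z))\<^sup>2"
      have t: "0 \<le> ?t" "?t \<le> 1" using K_nth_le[OF z, of j] by (auto simp: power_le_one)
      show ?thesis
      proof (cases "\<epsilon> / 2 \<le> ?t")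
        case True
        have "?m * ?t \<le> ?m * 1" using t by (intro mult_left_mono) auto
        also have "\<dots> \<le> b" using b(1)[OF z True] by simp
        also have "\<dots> \<le> \<epsilon> / 2 * ?m + b" using \<epsilon> by simp
        finally show ?thesis .
      next
        case False
        then have "?m * ?t \<le> ?m * (\<epsilon> / 2)" by (intro mult_left_mono) auto
        then show ?thesis using b(2) by (simp add: mult_ac)
      qed
    qed
    have int: "integrable (nu p) (\<lambda>z. (cmod (monom_vec \<alpha> z))\<^sup>2)"
      "integrable (nu p) (\<lambda>z. (cmod (monom_vec \<alpha> z))\<^sup>2 * (cmod (z $ j))\<^sup>2)"
      by (intro integrable_nu_continuous continuous_intros)+
    have "coord_mass j \<alpha>
      \<le> (LINT z|nu p. \<epsilon> / 2 * (cmod (monom_vec \<alpha> z))\<^sup>2 + b)"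
      using pt int by (intro integral_mono Bochner_Integration.integrable_add integrable_mult_right nu.integrable_const) auto
    also have "\<dots> = \<epsilon> / 2 * mass \<alpha> + b * measure (nu p) K"
      using int(1) nu.integrable_const by (subst Bochner_Integration.integral_add) (auto simp: mult.commute)
    also have "\<dots> \<le> \<epsilon> * mass \<alpha>"
      using b3 by (simp add: field_simps)
    finally show ?thesis .
  qed
  then show ?thesis by blast
qed

end

section \<open>Conjugate coordinate symbols\<close>

context omega_domain
begin

lemma monom_vec_continuous_K: "continuous_on K (monom_vec \<alpha>)"
  by (rule continuous_on_monom_vec)

lemma monom_vec_L2: "monom_vec \<alpha> \<in> L2 (nu p)"
  by (rule continuous_L2[OF monom_vec_continuous_K])

text \<open>Rotating a single coordinate in which the exponents differ flips the sign of the
  integrand. The factor \<open>u\<close> common to both functions cancels; it allows for the extra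
  weight \<open>cnj (w j)\<close> of the remainders.\<close>

lemma inner_eq_0_if_weights_differ:
  assumes ne: "\<alpha> \<noteq> \<beta>" and f: "f \<in> borel_measurable (nu p)" and g: "g \<in> borel_measurable (nu p)"
    and u: "\<And>w. (\<And>i. cmod (w i) = 1) \<Longrightarrow> cmod (u w) = 1"
    and fw: "\<And>w z. (\<And>i. cmod (w i) = 1) \<Longrightarrow> f (scale_coords w z) = u w * (\<Prod>i\<in>UNIV. w i ^ \<alpha> i) * f z"
    and gw: "\<And>w z. (\<And>i. cmod (w i) = 1) \<Longrightarrow> g (scale_coords w z) = u w * (\<Prod>i\<in>UNIV. w i ^ \<beta> i) * g z"
  shows "l2_inner (nu p) f g = 0"
proof -
  obtain i where i: "\<alpha> i \<noteq> \<beta> i" using ne by (auto simp: fun_eq_iff)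
  \<comment> \<open>The angle is chosen so that the two weights differ by exactly
    \<open>cis pi = -1\<close>.\<close>
  define x where "x = pi / (real (\<alpha> i) - real (\<beta> i))"
  define w where "w = (\<lambda>_. 1)(i := cis x)"
  have w1: "cmod (w k) = 1" for k by (simp add: w_def)
  have pr: "(\<Prod>k\<in>UNIV. w k ^ \<gamma> k) = cis (real (\<gamma> i) * x)" for \<gamma> :: "'n \<Rightarrow> nat"
  proof -
    have "(\<Prod>k\<in>UNIV. w k ^ \<gamma> k) = (\<Prod>k\<in>UNIV. if k = i then cis x ^ \<gamma> i else 1)"
      by (intro prod.cong) (auto simp: w_def)
    also have "\<dots> = cis x ^ \<gamma> i" by simp
    finally show ?thesis by (simp only: Complex.DeMoivre)
  qed
  have d: "real (\<alpha> i) - real (\<beta> i) \<noteq> 0" using i by simp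
  have uu: "u w * cnj (u w) = 1" using u[of w] w1 by (simp add: complex_norm_square[symmetric])
  have "cis (real (\<alpha> i) * x) * cnj (cis (real (\<beta> i) * x)) = cis ((real (\<alpha> i) - real (\<beta> i)) * x)"
    by (simp add: cis_cnj cis_mult left_diff_distrib)
  also have "\<dots> = -1" using d by (simp add: x_def)
  finally have cc: "cis (real (\<alpha> i) * x) * cnj (cis (real (\<beta> i) * x)) = -1" .
  show ?thesis
  proof (rule l2_inner_eq_0_if_rotation[OF w1 f g, where c = "-1"])
    fix z assume "z \<in> K"
    have "f (scale_coords w z) * cnj (g (scale_coords w z))
      = (u w * cnj (u w)) * (cis (real (\<alpha> i) * x) * cnj (cis (real (\<beta> i) * x))) * (f z * cnj (g z))"
      unfolding fw[OF w1] gw[OF w1] pr by (simp add: mult_ac)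
    then show "f (scale_coords w z) * cnj (g (scale_coords w z)) = - 1 * (f z * cnj (g z))"
      by (simp only: uu cc mult_1_left)
  qed simp
qed

lemma monom_vec_orthogonal: "\<alpha> \<noteq> \<beta> \<Longrightarrow> l2_inner (nu p) (monom_vec \<alpha>) (monom_vec \<beta>) = 0"
  by (rule inner_eq_0_if_weights_differ[where u = "\<lambda>_. 1"])
     (auto intro: continuous_measurable monom_vec_continuous_K simp: monom_vec_scale_coords)

text \<open>The witness \<open>h\<close> is a multiple of \<open>z\<^sup>\<alpha>\<close> divided by \<open>z\<^sub>j\<close> (zero if \<open>z\<^sub>j\<close> does not occur), so the
  remainders keep distinct torus weights and remain orthogonal for different \<open>\<alpha>\<close>.\<close>

lemma cnj_coord_monom_approx:
  assumes \<epsilon>: "\<epsilon> > 0"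
  shows "\<exists>N. \<forall>\<alpha>. N \<le> mdeg \<alpha> \<longrightarrow> (\<exists>h\<in>A_space p.
    (l2_norm (nu p) (\<lambda>z. cnj (z $ j) * monom_vec \<alpha> z - h z))\<^sup>2 \<le> \<epsilon> * (l2_norm (nu p) (monom_vec \<alpha>))\<^sup>2 \<and>
    (\<forall>w. (\<forall>i. cmod (w i) = 1) \<longrightarrow>
      (\<forall>z. h (scale_coords w z) = cnj (w j) * (\<Prod>i\<in>UNIV. w i ^ \<alpha> i) * h z)))"
proof -
  obtain N1 where N1: "\<forall>\<beta>. N1 \<le> mdeg \<beta> \<longrightarrow> (\<exists>c. (LINT z|nu p. (cmod (monom_vec \<beta> z))\<^sup>2 * ((cmod (z $ j))\<^sup>2 - c)\<^sup>2)
    \<le> \<epsilon> * coord_mass j \<beta>)"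
    using monom_variance_small[OF \<epsilon>, of j] by (elim exE)
  obtain N2 where N2: "\<forall>\<alpha>. N2 \<le> mdeg \<alpha> \<longrightarrow> \<alpha> j = 0 \<longrightarrow>
    coord_mass j \<alpha> \<le> \<epsilon> * mass \<alpha>"
    using monom_missing_coord_small[OF \<epsilon>, of j] by (elim exE)
  \<comment> \<open>The \<open>Suc\<close> compensates for the exponent \<beta> of the variance
    estimate having degree one less than \<alpha>.\<close>
  have "\<exists>h\<in>A_space p.
    (l2_norm (nu p) (\<lambda>z. cnj (z $ j) * monom_vec \<alpha> z - h z))\<^sup>2 \<le> \<epsilon> * (l2_norm (nu p) (monom_vec \<alpha>))\<^sup>2 \<and>
    (\<forall>w. (\<forall>i. cmod (w i) = 1) \<longrightarrow>
      (\<forall>z. h (scale_coords w z) = cnj (w j) * (\<Prod>i\<in>UNIV. w i ^ \<alpha> i) * h z))"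
    if deg: "max (Suc N1) N2 \<le> mdeg \<alpha>" for \<alpha>
  proof (cases "\<alpha> j")
    case 0
    have "(l2_norm (nu p) (\<lambda>z. cnj (z $ j) * monom_vec \<alpha> z - 0))\<^sup>2
      = coord_mass j \<alpha>"
      unfolding l2_norm_sq by (simp add: norm_mult power_mult_distrib mult.commute)
    also have "\<dots> \<le> \<epsilon> * (l2_norm (nu p) (monom_vec \<alpha>))\<^sup>2"
      unfolding l2_norm_sq using N2 deg 0 by simp
    finally show ?thesis
      by (intro bexI[of _ "\<lambda>z. 0"] A_space_const) simp
  next
    case (Suc k)
    define \<beta> where "\<beta> = \<alpha>(j := k)"
    have \<alpha>: "\<alpha> = \<beta>(j := Suc (\<beta> j))" using Suc by (auto simp: \<beta>_def)
    have m\<alpha>: "monom_vec \<alpha> z = z $ j * monom_vec \<beta> z" for z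
      by (subst \<alpha>) (rule monom_vec_add_coord)
    have "mdeg \<alpha> = Suc (mdeg \<beta>)" by (subst \<alpha>) (rule mdeg_add_coord)
    then have "N1 \<le> mdeg \<beta>" using deg by simp
    then obtain c where c: "(LINT z|nu p. (cmod (monom_vec \<beta> z))\<^sup>2 * ((cmod (z $ j))\<^sup>2 - c)\<^sup>2)
      \<le> \<epsilon> * coord_mass j \<beta>"
      using N1 by blast
    define h where "h = (\<lambda>z. of_real c * monom_vec \<beta> z)"
    have hA: "h \<in> A_space p" unfolding h_def by (rule A_space_mult[OF A_space_const monom_vec_A_space])
    \<comment> \<open>This identity makes the squared norm of the remainder the second moment from
      \<open>monom_variance_small\<close>, while the squared norm of z^\<alpha> is
      \<open>coord_mass j \<beta>\<close>.\<close>
    have "cnj (z $ j) * monom_vec \<alpha> z - h z = monom_vec \<beta> z * of_real ((cmod (z $ j))\<^sup>2 - c)" for z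
      unfolding m\<alpha> h_def of_real_diff complex_norm_square by (simp add: algebra_simps)
    then have "(l2_norm (nu p) (\<lambda>z. cnj (z $ j) * monom_vec \<alpha> z - h z))\<^sup>2
      = (LINT z|nu p. (cmod (monom_vec \<beta> z))\<^sup>2 * ((cmod (z $ j))\<^sup>2 - c)\<^sup>2)"
      unfolding l2_norm_sq by (simp add: norm_mult power_mult_distrib del: of_real_diff)
    also have "\<dots> \<le> \<epsilon> * (l2_norm (nu p) (monom_vec \<alpha>))\<^sup>2"
      using c unfolding l2_norm_sq m\<alpha> by (simp add: norm_mult power_mult_distrib mult.commute)
    finally have small: "(l2_norm (nu p) (\<lambda>z. cnj (z $ j) * monom_vec \<alpha> z - h z))\<^sup>2 \<le> \<epsilon> * (l2_norm (nu p) (monom_vec \<alpha>))\<^sup>2" .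
    have "h (scale_coords w z) = cnj (w j) * (\<Prod>i\<in>UNIV. w i ^ \<alpha> i) * h z"
      if w: "\<forall>i. cmod (w i) = 1" for w z
    proof -
      have "(\<Prod>i\<in>UNIV. w i ^ \<alpha> i) = monom_vec \<alpha> (\<chi> i. w i)" by (simp add: monom_vec_def)
      also have "\<dots> = w j * (\<Prod>i\<in>UNIV. w i ^ \<beta> i)" unfolding m\<alpha> by (simp add: monom_vec_def)
      finally have "cnj (w j) * (\<Prod>i\<in>UNIV. w i ^ \<alpha> i) = (w j * cnj (w j)) * (\<Prod>i\<in>UNIV. w i ^ \<beta> i)"
        by (simp add: mult_ac)
      also have "w j * cnj (w j) = 1" using w by (simp add: complex_norm_square[symmetric])
      finally show ?thesis by (simp add: h_def monom_vec_scale_coords mult_ac)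
    qed
    then show ?thesis using hA small by (intro bexI[of _ h]) auto
  qed
  then show ?thesis by (intro exI[of _ "max (Suc N1) N2"] allI impI)
qed

text \<open>In high degree the monomials and their remainders are both orthogonal families, so the
  bound for single monomials sums without loss. In low degree finitely many coefficients remain,
  each recovered by pairing with a monomial. The list depends on \<open>e\<close> and
  \<open>j\<close> but not on the polynomial.\<close>

lemma hankel_cnj_poly_estimate:
  assumes e: "e > 0"
  shows "\<exists>gs. set gs \<subseteq> L2 (nu p) \<and> (\<forall>q. is_poly q \<longrightarrow>
    l2_norm (nu p) (hankel (\<lambda>z. cnj (z $ j)) q) \<le> e * l2_norm (nu p) q + pairing_sum (nu p) gs q)"
proof -
  let ?n = "l2_norm (nu p)"
  have "e\<^sup>2 > 0" using e by simp
  then obtain N where N: "\<forall>\<alpha>. N \<le> mdeg \<alpha> \<longrightarrow> (\<exists>h\<in>A_space p.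
    (?n (\<lambda>z. cnj (z $ j) * monom_vec \<alpha> z - h z))\<^sup>2 \<le> e\<^sup>2 * (?n (monom_vec \<alpha>))\<^sup>2 \<and>
    (\<forall>w. (\<forall>i. cmod (w i) = 1) \<longrightarrow> (\<forall>z. h (scale_coords w z) = cnj (w j) * (\<Prod>i\<in>UNIV. w i ^ \<alpha> i) * h z)))"
    using cnj_coord_monom_approx[of "e\<^sup>2" j] by (elim meta_impE exE)
  then have "\<forall>\<alpha>. \<exists>h. N \<le> mdeg \<alpha> \<longrightarrow> h \<in> A_space p \<and>
    (?n (\<lambda>z. cnj (z $ j) * monom_vec \<alpha> z - h z))\<^sup>2 \<le> e\<^sup>2 * (?n (monom_vec \<alpha>))\<^sup>2 \<and>
    (\<forall>w. (\<forall>i. cmod (w i) = 1) \<longrightarrow> (\<forall>z. h (scale_coords w z) = cnj (w j) * (\<Prod>i\<in>UNIV. w i ^ \<alpha> i) * h z))"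
    by blast
  then obtain h where h: "\<forall>\<alpha>. N \<le> mdeg \<alpha> \<longrightarrow> h \<alpha> \<in> A_space p \<and>
    (?n (\<lambda>z. cnj (z $ j) * monom_vec \<alpha> z - h \<alpha> z))\<^sup>2 \<le> e\<^sup>2 * (?n (monom_vec \<alpha>))\<^sup>2 \<and>
    (\<forall>w. (\<forall>i. cmod (w i) = 1) \<longrightarrow> (\<forall>z. h \<alpha> (scale_coords w z) = cnj (w j) * (\<Prod>i\<in>UNIV. w i ^ \<alpha> i) * h \<alpha> z))"
    by (rule choice[THEN exE])
  define L where "L = {\<alpha> :: 'n \<Rightarrow> nat. mdeg \<alpha> < N}"
  have finL: "finite L" unfolding L_def by (rule finite_mdeg_less)
  obtain ls where ls: "set ls = L" "distinct ls" using finite_distinct_list[OF finL] by blast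
  define g where "g \<alpha> = (\<lambda>z. cnj (z $ j) * monom_vec \<alpha> z - h \<alpha> z)" for \<alpha>
  have hA: "h \<alpha> \<in> A_space p" if "N \<le> mdeg \<alpha>" for \<alpha> using h that by blast
  have gL2: "g \<alpha> \<in> L2 (nu p)" if "N \<le> mdeg \<alpha>" for \<alpha>
    unfolding g_def
    by (rule L2_diff[OF continuous_mult_L2[OF continuous_on_coord(2) monom_vec_L2] A_space_L2[OF hA[OF that]]])
  have g_orth: "l2_inner (nu p) (g \<alpha>) (g \<beta>) = 0" if "N \<le> mdeg \<alpha>" "N \<le> mdeg \<beta>" "\<alpha> \<noteq> \<beta>" for \<alpha> \<beta>
  proof (rule inner_eq_0_if_weights_differ[OF that(3) L2_measurable[OF gL2[OF that(1)]] L2_measurable[OF gL2[OF that(2)]],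
        where u = "\<lambda>w. cnj (w j)"])
    have gw: "g \<gamma> (scale_coords w z) = cnj (w j) * (\<Prod>i\<in>UNIV. w i ^ \<gamma> i) * g \<gamma> z"
      if "N \<le> mdeg \<gamma>" "\<And>i. cmod (w i) = 1" for \<gamma> w z
    proof -
      have "h \<gamma> (scale_coords w z) = cnj (w j) * (\<Prod>i\<in>UNIV. w i ^ \<gamma> i) * h \<gamma> z" using h that by simp
      then show ?thesis by (simp add: g_def monom_vec_scale_coords algebra_simps)
    qed
    show "g \<alpha> (scale_coords w z) = cnj (w j) * (\<Prod>i\<in>UNIV. w i ^ \<alpha> i) * g \<alpha> z" if "\<And>i. cmod (w i) = 1" for w z
      by (rule gw[OF \<open>N \<le> mdeg \<alpha>\<close> that])
    show "g \<beta> (scale_coords w z) = cnj (w j) * (\<Prod>i\<in>UNIV. w i ^ \<beta> i) * g \<beta> z" if "\<And>i. cmod (w i) = 1" for w z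
      by (rule gw[OF \<open>N \<le> mdeg \<beta>\<close> that])
  qed simp
  \<comment> \<open>Normalised so that the pairing with \<open>q\<close> has modulus equal to the
    norm of the corresponding term. For a monomial of norm 0 the quotient is 0 by convention and
    both sides vanish.\<close>
  let ?G = "\<lambda>\<alpha> z. of_real (1 / ?n (monom_vec \<alpha>)) * monom_vec \<alpha> z"
  let ?gs = "map ?G ls"
  have "?n (hankel (\<lambda>z. cnj (z $ j)) q) \<le> e * ?n q + pairing_sum (nu p) ?gs q" if q: "is_poly q" for q
  proof -
    obtain A c where A: "finite A" "q = (\<lambda>z. \<Sum>\<alpha>\<in>A. c \<alpha> * monom_vec \<alpha> z)"
      using q unfolding is_poly_def by (elim exE conjE)
    define hi where "hi = (\<lambda>z. \<Sum>\<alpha>\<in>A - L. c \<alpha> * g \<alpha> z)"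
    define lo where "lo = (\<lambda>z. cnj (z $ j) * (\<Sum>\<alpha>\<in>A \<inter> L. c \<alpha> * monom_vec \<alpha> z))"
    have hiN: "N \<le> mdeg \<alpha>" if "\<alpha> \<in> A - L" for \<alpha> using that by (simp add: L_def)
    have m2: "(\<lambda>z. c \<alpha> * monom_vec \<alpha> z) \<in> L2 (nu p)" for \<alpha> by (rule L2_cmult[OF monom_vec_L2])
    have q2: "q \<in> L2 (nu p)" unfolding A(2) by (rule L2_sum[OF m2])
    have hi2: "hi \<in> L2 (nu p)" unfolding hi_def by (rule L2_sum[OF L2_cmult[OF gL2[OF hiN]]])
    have losum2: "(\<lambda>z. \<Sum>\<alpha>\<in>A \<inter> L. c \<alpha> * monom_vec \<alpha> z) \<in> L2 (nu p)" by (rule L2_sum[OF m2])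
    have lo2: "lo \<in> L2 (nu p)" unfolding lo_def by (rule continuous_mult_L2[OF continuous_on_coord(2) losum2])
    \<comment> \<open>The competitor for the projection uses the witnesses of the high-degree terms
      only; low-degree terms are compared with 0.\<close>
    let ?h = "\<lambda>z. \<Sum>\<alpha>\<in>A - L. c \<alpha> * h \<alpha> z"
    have hH: "?h \<in> H"
      by (rule B.sum_mem[OF B.cmult_mem[OF A_space_mem_H[OF hA[OF hiN]]]])
    have split: "cnj (z $ j) * q z - ?h z = lo z + hi z" for z
    proof -
      have "q z = (\<Sum>\<alpha>\<in>A \<inter> L. c \<alpha> * monom_vec \<alpha> z) + (\<Sum>\<alpha>\<in>A - L. c \<alpha> * monom_vec \<alpha> z)"
        unfolding A(2) by (rule sum.Int_Diff[OF A(1)])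
      moreover have "hi z = cnj (z $ j) * (\<Sum>\<alpha>\<in>A - L. c \<alpha> * monom_vec \<alpha> z) - ?h z"
        unfolding hi_def g_def sum_distrib_left sum_subtractf[symmetric]
        by (rule sum.cong) (simp_all add: algebra_simps)
      ultimately show ?thesis by (simp add: lo_def algebra_simps)
    qed
    have "?n (hankel (\<lambda>z. cnj (z $ j)) q) \<le> ?n (\<lambda>z. cnj (z $ j) * q z - ?h z)"
      by (rule hankel_best[OF continuous_on_coord(2) q2 hH])
    also have "\<dots> = ?n (\<lambda>z. lo z + hi z)" unfolding split by (rule refl)
    also have "\<dots> \<le> ?n lo + ?n hi" by (rule l2_norm_triangle[OF lo2 hi2])
    finally have main: "?n (hankel (\<lambda>z. cnj (z $ j)) q) \<le> ?n lo + ?n hi" .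
    have orth_m: "l2_inner (nu p) (\<lambda>z. c \<alpha> * monom_vec \<alpha> z) (\<lambda>z. c \<beta> * monom_vec \<beta> z) = 0" if "\<alpha> \<noteq> \<beta>" for \<alpha> \<beta>
      by (simp add: l2_inner_cmult_left l2_inner_cmult_right monom_vec_orthogonal[OF that])
    have nq: "(?n q)\<^sup>2 = (\<Sum>\<alpha>\<in>A. (?n (\<lambda>z. c \<alpha> * monom_vec \<alpha> z))\<^sup>2)"
      unfolding A(2) by (rule l2_norm_sq_orthogonal_sum[OF A(1) m2 orth_m])
    have "(?n hi)\<^sup>2 = (\<Sum>\<alpha>\<in>A - L. (?n (\<lambda>z. c \<alpha> * g \<alpha> z))\<^sup>2)"
      unfolding hi_def
    proof (rule l2_norm_sq_orthogonal_sum)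
      show "finite (A - L)" using A(1) by simp
      show "(\<lambda>z. c \<alpha> * g \<alpha> z) \<in> L2 (nu p)" if "\<alpha> \<in> A - L" for \<alpha>
        by (rule L2_cmult[OF gL2[OF hiN[OF that]]])
      show "l2_inner (nu p) (\<lambda>z. c \<alpha> * g \<alpha> z) (\<lambda>z. c \<beta> * g \<beta> z) = 0" if "\<alpha> \<in> A - L" "\<beta> \<in> A - L" "\<alpha> \<noteq> \<beta>" for \<alpha> \<beta>
        by (simp add: l2_inner_cmult_left l2_inner_cmult_right g_orth[OF hiN[OF that(1)] hiN[OF that(2)] that(3)])
    qed
    also have "\<dots> \<le> (\<Sum>\<alpha>\<in>A - L. e\<^sup>2 * (?n (\<lambda>z. c \<alpha> * monom_vec \<alpha> z))\<^sup>2)"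
    proof (rule sum_mono)
      fix \<alpha> assume "\<alpha> \<in> A - L"
      then have "(?n (g \<alpha>))\<^sup>2 \<le> e\<^sup>2 * (?n (monom_vec \<alpha>))\<^sup>2" using h hiN unfolding g_def by blast
      then have "(cmod (c \<alpha>))\<^sup>2 * (?n (g \<alpha>))\<^sup>2 \<le> (cmod (c \<alpha>))\<^sup>2 * (e\<^sup>2 * (?n (monom_vec \<alpha>))\<^sup>2)"
        by (rule mult_left_mono) simp
      then show "(?n (\<lambda>z. c \<alpha> * g \<alpha> z))\<^sup>2 \<le> e\<^sup>2 * (?n (\<lambda>z. c \<alpha> * monom_vec \<alpha> z))\<^sup>2"
        by (simp add: l2_norm_cmult power_mult_distrib mult_ac)
    qed
    also have "\<dots> \<le> (\<Sum>\<alpha>\<in>A. e\<^sup>2 * (?n (\<lambda>z. c \<alpha> * monom_vec \<alpha> z))\<^sup>2)"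
      using A(1) by (intro sum_mono2) auto
    also have "\<dots> = (e * ?n q)\<^sup>2" unfolding power_mult_distrib nq sum_distrib_left by (rule refl)
    finally have hi_le: "?n hi \<le> e * ?n q"
      by (rule power2_le_imp_le) (use e in simp)
    have inner_q: "l2_inner (nu p) q (monom_vec \<alpha>) = c \<alpha> * of_real ((?n (monom_vec \<alpha>))\<^sup>2)" if "\<alpha> \<in> A" for \<alpha>
    proof -
      have "l2_inner (nu p) q (monom_vec \<alpha>) = (\<Sum>\<beta>\<in>A. l2_inner (nu p) (\<lambda>z. c \<beta> * monom_vec \<beta> z) (monom_vec \<alpha>))"
        unfolding A(2) by (rule l2_inner_sum_left[OF m2 monom_vec_L2])
      also have "\<dots> = (\<Sum>\<beta>\<in>A. if \<beta> = \<alpha> then c \<alpha> * l2_inner (nu p) (monom_vec \<alpha>) (monom_vec \<alpha>) else 0)"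
        by (intro sum.cong refl) (auto simp: l2_inner_cmult_left monom_vec_orthogonal)
      also have "\<dots> = c \<alpha> * l2_inner (nu p) (monom_vec \<alpha>) (monom_vec \<alpha>)" using that A(1) by simp
      finally show ?thesis by (simp only: l2_inner_self)
    qed
    have "?n lo \<le> ?n (\<lambda>z. \<Sum>\<alpha>\<in>A \<inter> L. c \<alpha> * monom_vec \<alpha> z)"
      using bounded_mult_norm[OF losum2 continuous_measurable[OF continuous_on_coord(2)], of j 1] K_nth_le
      unfolding lo_def by simp
    also have "\<dots> \<le> (\<Sum>\<alpha>\<in>A \<inter> L. ?n (\<lambda>z. c \<alpha> * monom_vec \<alpha> z))" by (rule l2_norm_sum[OF m2])
    also have "\<dots> = (\<Sum>\<alpha>\<in>A \<inter> L. cmod (l2_inner (nu p) q (?G \<alpha>)))"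
    proof (rule sum.cong[OF refl])
      fix \<alpha> assume "\<alpha> \<in> A \<inter> L"
      then have "cmod (l2_inner (nu p) q (?G \<alpha>)) = \<bar>1 / ?n (monom_vec \<alpha>)\<bar> * (cmod (c \<alpha>) * (?n (monom_vec \<alpha>))\<^sup>2)"
        unfolding l2_inner_cmult_right using inner_q[of \<alpha>] by (simp only: norm_mult complex_cnj_complex_of_real norm_of_real abs_power2 IntD1)
      also have "\<dots> = cmod (c \<alpha>) * ?n (monom_vec \<alpha>)"
        by (cases "?n (monom_vec \<alpha>) = 0") (simp_all add: power2_eq_square)
      finally show "?n (\<lambda>z. c \<alpha> * monom_vec \<alpha> z) = cmod (l2_inner (nu p) q (?G \<alpha>))"
        by (simp only: l2_norm_cmult)
    qed
    also have "\<dots> \<le> (\<Sum>\<alpha>\<in>L. cmod (l2_inner (nu p) q (?G \<alpha>)))"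
      using finL by (intro sum_mono2) auto
    also have "\<dots> = pairing_sum (nu p) ?gs q"
      unfolding ls(1)[symmetric] by (simp add: sum_list_distinct_conv_sum_set[OF ls(2)] o_def)
    finally show ?thesis using main hi_le by simp
  qed
  moreover have "set ?gs \<subseteq> L2 (nu p)" unfolding set_map by (rule image_subsetI) (rule L2_cmult[OF monom_vec_L2])
  ultimately show ?thesis by (intro exI[of _ ?gs] conjI allI impI)
qed

section \<open>From polynomials to the whole Bergman space\<close>

lemma is_poly_A_space: assumes "is_poly q" shows "q \<in> A_space p"
proof -
  obtain A c where A: "finite A" "q = (\<lambda>z. \<Sum>\<alpha>\<in>A. c \<alpha> * monom_vec \<alpha> z)"
    using assms unfolding is_poly_def by (elim exE conjE)
  have "(\<lambda>z. \<Sum>\<alpha>\<in>A. c \<alpha> * monom_vec \<alpha> z) \<in> A_space p"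
    using A(1)
  proof (induction A rule: finite_induct)
    case (insert \<beta> A)
    then show ?case
      using A_space_lin[OF monom_vec_A_space[of \<beta>] insert.IH, of "c \<beta>" 1] by simp
  qed (simp add: A_space_const)
  then show ?thesis by (simp add: A(2))
qed

lemma H_approx_poly:
  assumes f: "f \<in> H" and d: "d > 0"
  shows "\<exists>q. is_poly q \<and> l2_norm (nu p) (\<lambda>z. f z - q z) \<le> d"
proof -
  let ?n = "l2_norm (nu p)"
  obtain g where g: "g \<in> A_space p" "?n (\<lambda>z. f z - g z) < d / 2"
    using H_approx[OF f half_gt_zero[OF d]] by blast
  define D where "D = ?n (\<lambda>z. 1) + 1"
  have pos: "D > 0" "?n (\<lambda>z. 1) \<le> D" by (simp_all add: D_def add_nonneg_pos)
  define \<delta> where "\<delta> = d / 2 / D"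
  have \<delta>: "\<delta> > 0" using d pos by (simp add: \<delta>_def)
  obtain q where q: "is_poly q" "\<forall>z\<in>K. cmod (g z - q z) \<le> \<delta>"
    using A_space_approx_poly[OF g(1) \<delta>] by blast
  have gq: "(\<lambda>z. g z - q z) \<in> L2 (nu p)" by (rule L2_diff[OF A_space_L2[OF g(1)] A_space_L2[OF is_poly_A_space[OF q(1)]]])
  have "?n (\<lambda>z. g z - q z) \<le> \<delta> * ?n (\<lambda>z. 1)"
    using q(2) by (intro l2_norm_le_sup L2_measurable[OF gq]) auto
  also have "\<dots> \<le> \<delta> * D" using \<delta> pos(2) by (intro mult_left_mono) auto
  also have "\<dots> = d / 2" using pos(1) by (simp add: \<delta>_def)
  finally have "?n (\<lambda>z. g z - q z) \<le> d / 2" .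
  then have "?n (\<lambda>z. f z - q z) \<le> d"
    using l2_dist_triangle[OF B.mem_L2[OF f] A_space_L2[OF g(1)] A_space_L2[OF is_poly_A_space[OF q(1)]]] g(2)
    by linarith
  then show ?thesis using q(1) by (intro exI[of _ q] conjI)
qed

text \<open>For a fixed list both sides of the estimate depend continuously on \<open>f\<close> in
  the norm, so it extends from polynomials to their closure with the same list.\<close>

lemma hankel_compact_cnj_coord: "hankel_compact (\<lambda>z. cnj (z $ j))"
  unfolding hankel_compact_def compactness_estimate_def
proof (intro conjI allI impI)
  let ?n = "l2_norm (nu p)" and ?T = "hankel (\<lambda>z. cnj (z $ j))"
  show "continuous_on K (\<lambda>z. cnj (z $ j))" by (rule continuous_on_coord(2))
  fix e :: real assume e: "e > 0"
  obtain gs where gs: "set gs \<subseteq> L2 (nu p)" and est: "\<forall>q. is_poly q \<longrightarrow>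
      ?n (?T q) \<le> e * ?n q + pairing_sum (nu p) gs q"
    using hankel_cnj_poly_estimate[OF e, of j] by (elim exE conjE)
  have "?n (?T f) \<le> e * ?n f + pairing_sum (nu p) gs f" if f: "f \<in> H" for f
  proof (rule field_le_epsilon)
    fix \<epsilon> :: real assume \<epsilon>: "\<epsilon> > 0"
    \<comment> \<open>Collects the errors of replacing \<open>f\<close> by \<open>q\<close>: 1 from
      the Hankel operator, \<open>e\<close> from the norm term and the norms of the list from the
      pairings. With distance \<epsilon> / C the total error is \<epsilon>.\<close>
    define C where "C = 1 + e + (\<Sum>g\<leftarrow>gs. ?n g)"
    have "(\<Sum>g\<leftarrow>gs. ?n g) \<ge> 0" by (intro sum_list_nonneg) auto
    then have C: "C > 0" using e by (simp add: C_def)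
    define d where "d = \<epsilon> / C"
    have d: "d > 0" "d * C = \<epsilon>" using C \<epsilon> by (auto simp: d_def)
    obtain q where q: "is_poly q" "?n (\<lambda>z. f z - q z) \<le> d" using H_approx_poly[OF f d(1)] by blast
    note f2 = B.mem_L2[OF f] and q2 = A_space_L2[OF is_poly_A_space[OF q(1)]]
    have fq2: "(\<lambda>z. f z - q z) \<in> L2 (nu p)" by (rule L2_diff[OF f2 q2])
    have zq: "(\<lambda>z. cnj (z $ j) * q z) \<in> L2 (nu p)" by (rule continuous_mult_L2[OF continuous_on_coord(2) q2])
    have "?n (?T f) \<le> ?n (\<lambda>z. cnj (z $ j) * f z - B.P (\<lambda>z. cnj (z $ j) * q z) z)"
      by (rule hankel_best[OF continuous_on_coord(2) f2 B.proj_mem[OF zq]])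
    also have "\<dots> = ?n (\<lambda>z. ?T q z + cnj (z $ j) * (f z - q z))" by (simp add: hankel_def algebra_simps)
    also have "\<dots> \<le> ?n (?T q) + ?n (\<lambda>z. cnj (z $ j) * (f z - q z))"
      by (rule l2_norm_triangle[OF hankel_L2[OF continuous_on_coord(2) q2] continuous_mult_L2[OF continuous_on_coord(2) fq2]])
    also have "?n (\<lambda>z. cnj (z $ j) * (f z - q z)) \<le> ?n (\<lambda>z. f z - q z)"
      using bounded_mult_norm[OF fq2 continuous_measurable[OF continuous_on_coord(2)], of j 1] K_nth_le by simp
    finally have 1: "?n (?T f) \<le> ?n (?T q) + d" using q(2) by simp
    have "?n (\<lambda>z. f z - (f z - q z)) \<le> ?n f + ?n (\<lambda>z. f z - q z)" by (rule l2_norm_triangle_diff[OF f2 fq2])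
    then have "?n q \<le> ?n f + d" using q(2) by simp
    then have 2: "e * ?n q \<le> e * (?n f + d)" using e by (intro mult_left_mono) auto
    have "pairing_sum (nu p) gs q \<le> (\<Sum>g\<leftarrow>gs. cmod (l2_inner (nu p) f g) + d * ?n g)"
    proof (rule sum_list_mono)
      fix g assume "g \<in> set gs"
      then have g2: "g \<in> L2 (nu p)" using gs by blast
      have "l2_inner (nu p) q g = l2_inner (nu p) f g - l2_inner (nu p) (\<lambda>z. f z - q z) g"
        by (simp add: l2_inner_diff_left[OF f2 q2 g2])
      then have "cmod (l2_inner (nu p) q g) \<le> cmod (l2_inner (nu p) f g) + cmod (l2_inner (nu p) (\<lambda>z. f z - q z) g)"
        by (metis norm_triangle_ineq4)
      also have "cmod (l2_inner (nu p) (\<lambda>z. f z - q z) g) \<le> ?n (\<lambda>z. f z - q z) * ?n g"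
        by (rule l2_Cauchy_Schwarz[OF fq2 g2])
      also have "\<dots> \<le> d * ?n g" using q(2) by (rule mult_right_mono) simp
      finally show "cmod (l2_inner (nu p) q g) \<le> cmod (l2_inner (nu p) f g) + d * ?n g" by simp
    qed
    also have "\<dots> = pairing_sum (nu p) gs f + d * (\<Sum>g\<leftarrow>gs. ?n g)"
      by (simp add: sum_list_addf sum_list_const_mult)
    finally have 3: "pairing_sum (nu p) gs q \<le> pairing_sum (nu p) gs f + d * (\<Sum>g\<leftarrow>gs. ?n g)" .
    have "?n (?T q) \<le> e * ?n q + pairing_sum (nu p) gs q" using est q(1) by blast
    then have "?n (?T f) \<le> e * (?n f + d) + (pairing_sum (nu p) gs f + d * (\<Sum>g\<leftarrow>gs. ?n g)) + d"
      using 1 2 3 by linarith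
    also have "\<dots> = e * ?n f + pairing_sum (nu p) gs f + d * C"
      by (simp add: C_def algebra_simps)
    finally show "?n (?T f) \<le> e * ?n f + pairing_sum (nu p) gs f + \<epsilon>"
      by (simp only: d(2))
  qed
  then show "\<exists>gs. set gs \<subseteq> L2 (nu p) \<and> (\<forall>f\<in>H. ?n (?T f) \<le> e * ?n f + pairing_sum (nu p) gs f)"
    using gs by (intro exI[of _ gs] conjI ballI)
qed

end

theorem corollary3p4:
  fixes p :: "'n::finite \<Rightarrow> nat list"
  assumes "CARD('n) \<ge> 2"
    and "admissible p"
  shows "(\<forall>\<phi> \<psi> :: complex ^ 'n \<Rightarrow> complex.
            continuous_on (closure (Omega p)) \<phi> \<longrightarrow>
            continuous_on (closure (Omega p)) \<psi> \<longrightarrow>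
            l2_compact_operator (nu p) (bergman p)
              (op_commutator (toeplitz p \<phi>) (toeplitz p \<psi>)))
         \<and> essentially_normal (nu p) (bergman p) (coord_mult :: 'n \<Rightarrow> _)"
proof -
  interpret omega_domain p by (unfold_locales) (rule assms(2))
  note cnj = hankel_compact_cnj_coord
  show ?thesis
    using compact_toeplitz_commutator[OF hankel_compact_continuous[OF cnj] hankel_compact_continuous[OF cnj]]
      essentially_normal_coord_mult[OF cnj]
    by simp
qed

end
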